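(* Let $\Gamma \vdash V : A$ and $\Gamma \vdash W : A$ be value terms of $\lambda_{\mathrm{eff}}$ such that $[\![V]\!] = [\![W]\!]$ holds in every $\lambda_{\mathrm{eff}}$-model. Then $\Gamma \vdash V = W : A$ is derivable. Similar statements hold for computation terms and handlers.
   Context: The calculus $\lambda_{\mathrm{eff}}$ (fine-grain call-by-value with deep effect handlers). Value types $A ::= A \to C \mid \prod_{i=1}^n A_i$; computation types $C ::= A\,!\,\Sigma$; a signature $\Sigma$ is a finite set of entries $\mathtt{op} : A \to B$ (operation $\mathtt{op}$ with argument type $A$ and result type $B$; in a signature entry the arrow denotes an operation signature, not a function type); handler types $\Sigma \Rightarrow C$. Values $V ::= x \mid \lambda x.M \mid \langle V_1,\dots,V_n\rangle \mid \pi_i\,V$; computations $M ::= V\,W \mid \mathtt{return}\ V \mid \mathtt{let}\ x \Leftarrow M\ \mathtt{in}\ N \mid \mathtt{op}(V) \mid \mathtt{handle}\ M\ \mathtt{with}\ H\ \mathtt{to}\ x.\,N$; handlers $H ::= \emptyset \mid \{\mathtt{op}(x,k)\mapsto M\}\cup H$, where a handler $H:\Sigma\Rightarrow C$ has a clause $\Gamma,x:A_{\mathtt{op}},k:B_{\mathtt{op}}\to C\vdash M_{\mathtt{op}}:C$ for each $(\mathtt{op}:A_{\mathtt{op}}\to B_{\mathtt{op}})\in\Sigma$, and $\mathtt{handle}\ M\ \mathtt{with}\ H\ \mathtt{to}\ x.N : C$ requires $M : A!\Sigma$, $H:\Sigma\Rightarrow C$, $\Gamma,x:A\vdash N:C$.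 Equations: least congruence containing $\beta/\eta$ for functions and products, monad laws for $\mathtt{let}$, and $\mathtt{handle}\ \mathtt{return}\ V\ \mathtt{with}\ H\ \mathtt{to}\ x.M = M[V/x]$; $\mathtt{handle}\ (\mathtt{let}\ x\Leftarrow L\ \mathtt{in}\ M)\ \mathtt{with}\ H\ \mathtt{to}\ y.N = \mathtt{handle}\ L\ \mathtt{with}\ H\ \mathtt{to}\ x.(\mathtt{handle}\ M\ \mathtt{with}\ H\ \mathtt{to}\ y.N)$; $\mathtt{handle}\ \mathtt{op}(V)\ \mathtt{with}\ H\ \mathtt{to}\ x.M = M_{\mathtt{op}}[V/x,\lambda x.M/k]$. A $\lambda_{\mathrm{eff}}$-model: a cartesian category $\mathcal{C}$; strong monads $T_S$ indexed by semantic signatures $S$ (finite partial maps from operation symbols to pairs of objects) with Kleisli exponentials $(Y\Rightarrow_{T} Z)$ (defined by $\mathcal{C}_T(J(X\times Y),Z)\cong\mathcal{C}(X,Y\Rightarrow_T Z)$, with evaluation $\mathrm{ev}$); morphisms $[\![\mathtt{op}]\!]_S : A_{\mathtt{op}}\to T_S B_{\mathtt{op}}$; and $\mathrm{handle}_{S,S',X} : \mathcal{H}_S(X)\times T_S T_{S'}X\to T_{S'}X$, where $\mathcal{H}_S(X)=\prod_{(\mathtt{op}:A_{\mathtt{op}}\to B_{\mathtt{op}})\in S}((A_{\mathtt{op}}\times(B_{\mathtt{op}}\Rightarrow_{T_{S'}}X))\Rightarrow_{T_{S'}}X)$, satisfying $\mathrm{handle}\circ(\mathrm{id}\times\eta)=\pi_2$,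 $\mathrm{handle}\circ(\mathrm{id}\times\mu)=\mathrm{handle}\circ(\mathrm{id}\times T_S\mathrm{handle})\circ\langle\pi_1,\mathrm{st}\rangle$, and $\mathrm{handle}\circ(\mathrm{id}\times a_{\mathtt{op}})=\mathrm{ev}\circ(\pi_{\mathtt{op}}\times\mathrm{id})$ with $a_{\mathtt{op}}=T_S\mathrm{ev}\circ\mathrm{st}\circ\mathrm{swap}\circ([\![\mathtt{op}]\!]_S\times\mathrm{id})$. Terms are interpreted compositionally as in fine-grain call-by-value, with $[\![\mathtt{op}(V)]\!]=[\![\mathtt{op}]\!]\circ[\![V]\!]$, handlers as tuples of curried clauses, and $[\![\mathtt{handle}\ M\ \mathtt{with}\ H\ \mathtt{to}\ x.N]\!]=\mathrm{handle}\circ\langle[\![H]\!],T[\![N]\!]\circ\mathrm{st}\circ\langle\mathrm{id},[\![M]\!]\rangle\rangle$. *)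

theory Defs
  imports "HOL-Library.Finite_Map"
begin

section \<open>Types and terms\<close>

datatype 'op ty = TFun "'op ty" "'op cty" | TProd "'op ty list"
and 'op cty = Eff "'op ty" "('op, 'op ty \<times> 'op ty) fmap"

type_synonym 'op sgn = "('op, 'op ty \<times> 'op ty) fmap"

text \<open>
  Raw terms in de Bruijn notation; \<open>Proj i\<close> counts components from 0. The second argument of
  \<open>LetIn\<close>, the third argument of \<open>Handle\<close> and the body of \<open>Lam\<close> bind index 0.
  In a handler clause \<open>op(x,k) \<mapsto> M\<close> the body binds two variables: index 0 is \<open>k\<close>, index 1 is \<open>x\<close>.
\<close>

datatype 'op val =
    Var nat
  | Lam "'op cmp"
  | Tuple "'op val list"
  | Proj nat "'op val"
and 'op cmp =
    App "'op val" "'op val"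
  | Return "'op val"
  | LetIn "'op cmp" "'op cmp"
  | Op 'op "'op val"
  | Handle "'op cmp" "('op, 'op cmp) fmap" "'op cmp"

type_synonym 'op handler = "('op, 'op cmp) fmap"

type_synonym 'op ctx = "'op ty list"  \<comment> \<open>\<open>\<Gamma>, x : A\<close> is \<open>A # \<Gamma>\<close>\<close>

definition up_ren :: "(nat \<Rightarrow> nat) \<Rightarrow> nat \<Rightarrow> nat" where
  "up_ren \<xi> = case_nat 0 (\<lambda>n. Suc (\<xi> n))"

primrec ren_val :: "'op val \<Rightarrow> (nat \<Rightarrow> nat) \<Rightarrow> 'op val"
  and ren_cmp :: "'op cmp \<Rightarrow> (nat \<Rightarrow> nat) \<Rightarrow> 'op cmp" where
  "ren_val (Var n) = (\<lambda>\<xi>. Var (\<xi> n))"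
| "ren_val (Lam M) = (\<lambda>\<xi>. Lam (ren_cmp M (up_ren \<xi>)))"
| "ren_val (Tuple Vs) = (\<lambda>\<xi>. Tuple (map (\<lambda>V. ren_val V \<xi>) Vs))"
| "ren_val (Proj i V) = (\<lambda>\<xi>. Proj i (ren_val V \<xi>))"
| "ren_cmp (App V W) = (\<lambda>\<xi>. App (ren_val V \<xi>) (ren_val W \<xi>))"
| "ren_cmp (Return V) = (\<lambda>\<xi>. Return (ren_val V \<xi>))"
| "ren_cmp (LetIn M N) = (\<lambda>\<xi>. LetIn (ren_cmp M \<xi>) (ren_cmp N (up_ren \<xi>)))"
| "ren_cmp (Op oper V) = (\<lambda>\<xi>. Op oper (ren_val V \<xi>))"
| "ren_cmp (Handle M H N) = (\<lambda>\<xi>. Handle (ren_cmp M \<xi>)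
     (fmmap (\<lambda>L. ren_cmp L (up_ren (up_ren \<xi>))) H) (ren_cmp N (up_ren \<xi>)))"

definition ren_handler :: "'op handler \<Rightarrow> (nat \<Rightarrow> nat) \<Rightarrow> 'op handler" where
  "ren_handler H \<xi> = fmmap (\<lambda>L. ren_cmp L (up_ren (up_ren \<xi>))) H"

definition up_sub :: "(nat \<Rightarrow> 'op val) \<Rightarrow> nat \<Rightarrow> 'op val" where
  "up_sub \<sigma> = case_nat (Var 0) (\<lambda>n. ren_val (\<sigma> n) Suc)"

primrec sub_val :: "'op val \<Rightarrow> (nat \<Rightarrow> 'op val) \<Rightarrow> 'op val"
  and sub_cmp :: "'op cmp \<Rightarrow> (nat \<Rightarrow> 'op val) \<Rightarrow> 'op cmp" where
  "sub_val (Var n) = (\<lambda>\<sigma>. \<sigma> n)"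
| "sub_val (Lam M) = (\<lambda>\<sigma>. Lam (sub_cmp M (up_sub \<sigma>)))"
| "sub_val (Tuple Vs) = (\<lambda>\<sigma>. Tuple (map (\<lambda>V. sub_val V \<sigma>) Vs))"
| "sub_val (Proj i V) = (\<lambda>\<sigma>. Proj i (sub_val V \<sigma>))"
| "sub_cmp (App V W) = (\<lambda>\<sigma>. App (sub_val V \<sigma>) (sub_val W \<sigma>))"
| "sub_cmp (Return V) = (\<lambda>\<sigma>. Return (sub_val V \<sigma>))"
| "sub_cmp (LetIn M N) = (\<lambda>\<sigma>. LetIn (sub_cmp M \<sigma>) (sub_cmp N (up_sub \<sigma>)))"
| "sub_cmp (Op oper V) = (\<lambda>\<sigma>. Op oper (sub_val V \<sigma>))"
| "sub_cmp (Handle M H N) = (\<lambda>\<sigma>. Handle (sub_cmp M \<sigma>)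
     (fmmap (\<lambda>L. sub_cmp L (up_sub (up_sub \<sigma>))) H) (sub_cmp N (up_sub \<sigma>)))"

definition inst1 :: "'op cmp \<Rightarrow> 'op val \<Rightarrow> 'op cmp" where
  "inst1 M V = sub_cmp M (case_nat V Var)"

text \<open>\<open>inst2 M V W\<close> is \<open>M[V/x, W/k]\<close> for a clause body \<open>M\<close>.\<close>

definition inst2 :: "'op cmp \<Rightarrow> 'op val \<Rightarrow> 'op val \<Rightarrow> 'op cmp" where
  "inst2 M V W = sub_cmp M (case_nat W (case_nat V Var))"

section \<open>Typing and equations\<close>

inductive val_typed :: "'op ctx \<Rightarrow> 'op val \<Rightarrow> 'op ty \<Rightarrow> bool"
  and cmp_typed :: "'op ctx \<Rightarrow> 'op cmp \<Rightarrow> 'op cty \<Rightarrow> bool"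
  and handler_typed :: "'op ctx \<Rightarrow> 'op handler \<Rightarrow> 'op sgn \<Rightarrow> 'op cty \<Rightarrow> bool" where
  ty_Var: "i < length \<Gamma> \<Longrightarrow> val_typed \<Gamma> (Var i) (\<Gamma> ! i)"
| ty_Lam: "cmp_typed (A # \<Gamma>) M C \<Longrightarrow> val_typed \<Gamma> (Lam M) (TFun A C)"
| ty_Tuple: "\<lbrakk>length Vs = length As; \<And>i. i < length As \<Longrightarrow> val_typed \<Gamma> (Vs ! i) (As ! i)\<rbrakk>
    \<Longrightarrow> val_typed \<Gamma> (Tuple Vs) (TProd As)"
| ty_Proj: "\<lbrakk>val_typed \<Gamma> V (TProd As); i < length As\<rbrakk> \<Longrightarrow> val_typed \<Gamma> (Proj i V) (As ! i)"
| ty_App: "\<lbrakk>val_typed \<Gamma> V (TFun A C); val_typed \<Gamma> W A\<rbrakk> \<Longrightarrow> cmp_typed \<Gamma> (App V W) C"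
| ty_Return: "val_typed \<Gamma> V A \<Longrightarrow> cmp_typed \<Gamma> (Return V) (Eff A \<Sigma>)"
| ty_LetIn: "\<lbrakk>cmp_typed \<Gamma> M (Eff A \<Sigma>); cmp_typed (A # \<Gamma>) N (Eff B \<Sigma>)\<rbrakk>
    \<Longrightarrow> cmp_typed \<Gamma> (LetIn M N) (Eff B \<Sigma>)"
| ty_Op: "\<lbrakk>fmlookup \<Sigma> oper = Some (A, B); val_typed \<Gamma> V A\<rbrakk> \<Longrightarrow> cmp_typed \<Gamma> (Op oper V) (Eff B \<Sigma>)"
| ty_Handle: "\<lbrakk>cmp_typed \<Gamma> M (Eff A \<Sigma>); handler_typed \<Gamma> H \<Sigma> C; cmp_typed (A # \<Gamma>) N C\<rbrakk>
    \<Longrightarrow> cmp_typed \<Gamma> (Handle M H N) C"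
| ty_handler: "\<lbrakk>fmdom H = fmdom \<Sigma>;
      \<And>oper A B M. \<lbrakk>fmlookup \<Sigma> oper = Some (A, B); fmlookup H oper = Some M\<rbrakk>
        \<Longrightarrow> cmp_typed (TFun B C # A # \<Gamma>) M C\<rbrakk>
    \<Longrightarrow> handler_typed \<Gamma> H \<Sigma> C"

inductive val_eq :: "'op ctx \<Rightarrow> 'op val \<Rightarrow> 'op val \<Rightarrow> 'op ty \<Rightarrow> bool"
  and cmp_eq :: "'op ctx \<Rightarrow> 'op cmp \<Rightarrow> 'op cmp \<Rightarrow> 'op cty \<Rightarrow> bool"
  and handler_eq :: "'op ctx \<Rightarrow> 'op handler \<Rightarrow> 'op handler \<Rightarrow> 'op sgn \<Rightarrow> 'op cty \<Rightarrow> bool" where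
  veq_refl: "val_typed \<Gamma> V A \<Longrightarrow> val_eq \<Gamma> V V A"
| veq_sym: "val_eq \<Gamma> V W A \<Longrightarrow> val_eq \<Gamma> W V A"
| veq_trans: "\<lbrakk>val_eq \<Gamma> U V A; val_eq \<Gamma> V W A\<rbrakk> \<Longrightarrow> val_eq \<Gamma> U W A"
| ceq_refl: "cmp_typed \<Gamma> M C \<Longrightarrow> cmp_eq \<Gamma> M M C"
| ceq_sym: "cmp_eq \<Gamma> M N C \<Longrightarrow> cmp_eq \<Gamma> N M C"
| ceq_trans: "\<lbrakk>cmp_eq \<Gamma> L M C; cmp_eq \<Gamma> M N C\<rbrakk> \<Longrightarrow> cmp_eq \<Gamma> L N C"
| heq_refl: "handler_typed \<Gamma> H \<Sigma> C \<Longrightarrow> handler_eq \<Gamma> H H \<Sigma> C"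
| heq_sym: "handler_eq \<Gamma> H H' \<Sigma> C \<Longrightarrow> handler_eq \<Gamma> H' H \<Sigma> C"
| heq_trans: "\<lbrakk>handler_eq \<Gamma> H H' \<Sigma> C; handler_eq \<Gamma> H' H'' \<Sigma> C\<rbrakk> \<Longrightarrow> handler_eq \<Gamma> H H'' \<Sigma> C"
| cong_Lam: "cmp_eq (A # \<Gamma>) M M' C \<Longrightarrow> val_eq \<Gamma> (Lam M) (Lam M') (TFun A C)"
| cong_Tuple: "\<lbrakk>length Vs = length As; length Ws = length As;
      \<And>i. i < length As \<Longrightarrow> val_eq \<Gamma> (Vs ! i) (Ws ! i) (As ! i)\<rbrakk>
    \<Longrightarrow> val_eq \<Gamma> (Tuple Vs) (Tuple Ws) (TProd As)"
| cong_Proj: "\<lbrakk>val_eq \<Gamma> V W (TProd As); i < length As\<rbrakk> \<Longrightarrow> val_eq \<Gamma> (Proj i V) (Proj i W) (As ! i)"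
| cong_App: "\<lbrakk>val_eq \<Gamma> V V' (TFun A C); val_eq \<Gamma> W W' A\<rbrakk> \<Longrightarrow> cmp_eq \<Gamma> (App V W) (App V' W') C"
| cong_Return: "val_eq \<Gamma> V W A \<Longrightarrow> cmp_eq \<Gamma> (Return V) (Return W) (Eff A \<Sigma>)"
| cong_LetIn: "\<lbrakk>cmp_eq \<Gamma> M M' (Eff A \<Sigma>); cmp_eq (A # \<Gamma>) N N' (Eff B \<Sigma>)\<rbrakk>
    \<Longrightarrow> cmp_eq \<Gamma> (LetIn M N) (LetIn M' N') (Eff B \<Sigma>)"
| cong_Op: "\<lbrakk>fmlookup \<Sigma> oper = Some (A, B); val_eq \<Gamma> V W A\<rbrakk>
    \<Longrightarrow> cmp_eq \<Gamma> (Op oper V) (Op oper W) (Eff B \<Sigma>)"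
| cong_Handle: "\<lbrakk>cmp_eq \<Gamma> M M' (Eff A \<Sigma>); handler_eq \<Gamma> H H' \<Sigma> C; cmp_eq (A # \<Gamma>) N N' C\<rbrakk>
    \<Longrightarrow> cmp_eq \<Gamma> (Handle M H N) (Handle M' H' N') C"
| cong_handler: "\<lbrakk>fmdom H = fmdom \<Sigma>; fmdom H' = fmdom \<Sigma>;
      \<And>oper A B M M'. \<lbrakk>fmlookup \<Sigma> oper = Some (A, B); fmlookup H oper = Some M; fmlookup H' oper = Some M'\<rbrakk>
        \<Longrightarrow> cmp_eq (TFun B C # A # \<Gamma>) M M' C\<rbrakk>
    \<Longrightarrow> handler_eq \<Gamma> H H' \<Sigma> C"
| beta_fun: "\<lbrakk>cmp_typed (A # \<Gamma>) M C; val_typed \<Gamma> V A\<rbrakk>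
    \<Longrightarrow> cmp_eq \<Gamma> (App (Lam M) V) (inst1 M V) C"
| eta_fun: "val_typed \<Gamma> V (TFun A C)
    \<Longrightarrow> val_eq \<Gamma> V (Lam (App (ren_val V Suc) (Var 0))) (TFun A C)"
| beta_prod: "\<lbrakk>val_typed \<Gamma> (Tuple Vs) (TProd As); i < length As\<rbrakk>
    \<Longrightarrow> val_eq \<Gamma> (Proj i (Tuple Vs)) (Vs ! i) (As ! i)"
| eta_prod: "val_typed \<Gamma> V (TProd As)
    \<Longrightarrow> val_eq \<Gamma> V (Tuple (map (\<lambda>i. Proj i V) [0..<length As])) (TProd As)"
| let_return: "\<lbrakk>val_typed \<Gamma> V A; cmp_typed (A # \<Gamma>) M (Eff B \<Sigma>)\<rbrakk>
    \<Longrightarrow> cmp_eq \<Gamma> (LetIn (Return V) M) (inst1 M V) (Eff B \<Sigma>)"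
| let_eta: "cmp_typed \<Gamma> M (Eff A \<Sigma>)
    \<Longrightarrow> cmp_eq \<Gamma> (LetIn M (Return (Var 0))) M (Eff A \<Sigma>)"
| let_assoc: "\<lbrakk>cmp_typed \<Gamma> L (Eff A \<Sigma>); cmp_typed (A # \<Gamma>) M (Eff B \<Sigma>); cmp_typed (B # \<Gamma>) N (Eff D \<Sigma>)\<rbrakk>
    \<Longrightarrow> cmp_eq \<Gamma> (LetIn (LetIn L M) N) (LetIn L (LetIn M (ren_cmp N (up_ren Suc)))) (Eff D \<Sigma>)"
| handle_return: "\<lbrakk>val_typed \<Gamma> V A; handler_typed \<Gamma> H \<Sigma> C; cmp_typed (A # \<Gamma>) M C\<rbrakk>
    \<Longrightarrow> cmp_eq \<Gamma> (Handle (Return V) H M) (inst1 M V) C"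
| handle_let: "\<lbrakk>cmp_typed \<Gamma> L (Eff A \<Sigma>); cmp_typed (A # \<Gamma>) M (Eff B \<Sigma>);
      handler_typed \<Gamma> H \<Sigma> C; cmp_typed (B # \<Gamma>) N C\<rbrakk>
    \<Longrightarrow> cmp_eq \<Gamma> (Handle (LetIn L M) H N)
          (Handle L H (Handle M (ren_handler H Suc) (ren_cmp N (up_ren Suc)))) C"
| handle_op: "\<lbrakk>fmlookup \<Sigma> oper = Some (A, B); val_typed \<Gamma> V A; handler_typed \<Gamma> H \<Sigma> C;
      fmlookup H oper = Some L; cmp_typed (B # \<Gamma>) M C\<rbrakk>
    \<Longrightarrow> cmp_eq \<Gamma> (Handle (Op oper V) H M) (inst2 L V (Lam M)) C"

section \<open>Models\<close>

type_synonym ('op, 'o) ssgn = "('op, 'o \<times> 'o) fmap"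

text \<open>
  Finite products are chosen products of lists of objects; the terminal object and binary products
  are the instances \<open>[]\<close> and \<open>[X, Y]\<close>. Hom-sets need not be disjoint.
  \<open>cur M S X Y Z\<close> is the bijection from \<open>X \<times> Y \<rightarrow> T\<^sub>S Z\<close> to \<open>X \<rightarrow> (Y \<Rightarrow> Z)\<close> for
  the Kleisli exponential \<open>kexp M S Y Z\<close>.
\<close>

record ('op, 'o, 'm) leff_structure =
  obj :: "'o set"
  hom :: "'o \<Rightarrow> 'o \<Rightarrow> 'm set"
  idm :: "'o \<Rightarrow> 'm"
  compose :: "'m \<Rightarrow> 'm \<Rightarrow> 'm" (infixr "\<cdot>\<index>" 70)
  prd :: "'o list \<Rightarrow> 'o"
  prj :: "'o list \<Rightarrow> nat \<Rightarrow> 'm"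
  T_ob :: "('op, 'o) ssgn \<Rightarrow> 'o \<Rightarrow> 'o"
  T_mor :: "('op, 'o) ssgn \<Rightarrow> 'm \<Rightarrow> 'm"
  T_unit :: "('op, 'o) ssgn \<Rightarrow> 'o \<Rightarrow> 'm"
  T_mult :: "('op, 'o) ssgn \<Rightarrow> 'o \<Rightarrow> 'm"
  T_st :: "('op, 'o) ssgn \<Rightarrow> 'o \<Rightarrow> 'o \<Rightarrow> 'm"
  kexp :: "('op, 'o) ssgn \<Rightarrow> 'o \<Rightarrow> 'o \<Rightarrow> 'o"
  cur :: "('op, 'o) ssgn \<Rightarrow> 'o \<Rightarrow> 'o \<Rightarrow> 'o \<Rightarrow> 'm \<Rightarrow> 'm"
  opm :: "('op, 'o) ssgn \<Rightarrow> 'op \<Rightarrow> 'm"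
  hndl :: "('op, 'o) ssgn \<Rightarrow> ('op, 'o) ssgn \<Rightarrow> 'o \<Rightarrow> 'm"

definition ssgns :: "('op, 'o, 'm) leff_structure \<Rightarrow> ('op, 'o) ssgn set" where
  "ssgns M = {S. \<forall>oper A B. fmlookup S oper = Some (A, B) \<longrightarrow> A \<in> obj M \<and> B \<in> obj M}"

definition tuple :: "('op, 'o, 'm) leff_structure \<Rightarrow> 'o \<Rightarrow> 'o list \<Rightarrow> 'm list \<Rightarrow> 'm" where
  "tuple M X Ys fs = (THE h. h \<in> hom M X (prd M Ys) \<and> (\<forall>i<length Ys. prj M Ys i \<cdot>\<^bsub>M\<^esub> h = fs ! i))"

definition binprod :: "('op, 'o, 'm) leff_structure \<Rightarrow> 'o \<Rightarrow> 'o \<Rightarrow> 'o" where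
  "binprod M X Y = prd M [X, Y]"

definition p1 :: "('op, 'o, 'm) leff_structure \<Rightarrow> 'o \<Rightarrow> 'o \<Rightarrow> 'm" where
  "p1 M X Y = prj M [X, Y] 0"

definition p2 :: "('op, 'o, 'm) leff_structure \<Rightarrow> 'o \<Rightarrow> 'o \<Rightarrow> 'm" where
  "p2 M X Y = prj M [X, Y] 1"

text \<open>\<open>pair M X Y Z f g : X \<rightarrow> Y \<times> Z\<close>, and
  \<open>pmap M X Y X' Y' f g : X \<times> Y \<rightarrow> X' \<times> Y'\<close>.\<close>

definition pair :: "('op, 'o, 'm) leff_structure \<Rightarrow> 'o \<Rightarrow> 'o \<Rightarrow> 'o \<Rightarrow> 'm \<Rightarrow> 'm \<Rightarrow> 'm" where
  "pair M X Y Z f g = tuple M X [Y, Z] [f, g]"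

definition pmap :: "('op, 'o, 'm) leff_structure \<Rightarrow> 'o \<Rightarrow> 'o \<Rightarrow> 'o \<Rightarrow> 'o \<Rightarrow> 'm \<Rightarrow> 'm \<Rightarrow> 'm" where
  "pmap M X Y X' Y' f g = pair M (binprod M X Y) X' Y' (f \<cdot>\<^bsub>M\<^esub> p1 M X Y) (g \<cdot>\<^bsub>M\<^esub> p2 M X Y)"

definition swap :: "('op, 'o, 'm) leff_structure \<Rightarrow> 'o \<Rightarrow> 'o \<Rightarrow> 'm" where
  "swap M X Y = pair M (binprod M X Y) Y X (p2 M X Y) (p1 M X Y)"

text \<open>\<open>assocr : (X \<times> Y) \<times> Z \<rightarrow> X \<times> (Y \<times> Z)\<close> and its inverse \<open>assocl\<close>.\<close>

definition assocr :: "('op, 'o, 'm) leff_structure \<Rightarrow> 'o \<Rightarrow> 'o \<Rightarrow> 'o \<Rightarrow> 'm" where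
  "assocr M X Y Z = (let XY = binprod M X Y; W = binprod M XY Z in
     pair M W X (binprod M Y Z)
       (p1 M X Y \<cdot>\<^bsub>M\<^esub> p1 M XY Z)
       (pair M W Y Z (p2 M X Y \<cdot>\<^bsub>M\<^esub> p1 M XY Z) (p2 M XY Z)))"

definition assocl :: "('op, 'o, 'm) leff_structure \<Rightarrow> 'o \<Rightarrow> 'o \<Rightarrow> 'o \<Rightarrow> 'm" where
  "assocl M X Y Z = (let YZ = binprod M Y Z; W = binprod M X YZ in
     pair M W (binprod M X Y) Z
       (pair M W X Y (p1 M X YZ) (p1 M Y Z \<cdot>\<^bsub>M\<^esub> p2 M X YZ))
       (p2 M Y Z \<cdot>\<^bsub>M\<^esub> p2 M X YZ))"

definition ev :: "('op, 'o, 'm) leff_structure \<Rightarrow> ('op, 'o) ssgn \<Rightarrow> 'o \<Rightarrow> 'o \<Rightarrow> 'm" where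
  "ev M S Y Z = (let E = kexp M S Y Z in
     inv_into (hom M (binprod M E Y) (T_ob M S Z)) (cur M S E Y Z) (idm M E))"

text \<open>
  A product indexed by the operations of a signature is taken in an arbitrary but fixed order
  of its domain.
\<close>

definition enum_ops :: "'op fset \<Rightarrow> 'op list" where
  "enum_ops D = (SOME xs. distinct xs \<and> set xs = fset D)"

text \<open>\<open>clause_obj M S' X (A, B)\<close> is \<open>(A \<times> (B \<Rightarrow> X)) \<Rightarrow> X\<close> with respect to \<open>T\<^sub>S\<^sub>'\<close>, and
  \<open>hobj M S S' X\<close> is \<open>\<H>\<^sub>S(X)\<close>.\<close>

definition clause_obj :: "('op, 'o, 'm) leff_structure \<Rightarrow> ('op, 'o) ssgn \<Rightarrow> 'o \<Rightarrow> 'o \<times> 'o \<Rightarrow> 'o" where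
  "clause_obj M S' X = (\<lambda>(A, B). kexp M S' (binprod M A (kexp M S' B X)) X)"

definition clause_objs ::
  "('op, 'o, 'm) leff_structure \<Rightarrow> ('op, 'o) ssgn \<Rightarrow> ('op, 'o) ssgn \<Rightarrow> 'o \<Rightarrow> 'o list" where
  "clause_objs M S S' X =
     map (\<lambda>oper. clause_obj M S' X (the (fmlookup S oper))) (enum_ops (fmdom S))"

definition hobj :: "('op, 'o, 'm) leff_structure \<Rightarrow> ('op, 'o) ssgn \<Rightarrow> ('op, 'o) ssgn \<Rightarrow> 'o \<Rightarrow> 'o" where
  "hobj M S S' X = prd M (clause_objs M S S' X)"

text \<open>\<open>a\<^sub>o\<^sub>p : A \<times> (B \<Rightarrow> X) \<rightarrow> T\<^sub>S T\<^sub>S\<^sub>' X\<close> for an operation \<open>A \<rightarrow> B\<close> of \<open>S\<close>.\<close>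

definition algop :: "('op, 'o, 'm) leff_structure \<Rightarrow> ('op, 'o) ssgn \<Rightarrow> ('op, 'o) ssgn \<Rightarrow> 'o \<Rightarrow> 'op \<Rightarrow> 'm" where
  "algop M S S' X oper = (case the (fmlookup S oper) of (A, B) \<Rightarrow>
     let E = kexp M S' B X in
     T_mor M S (ev M S' B X) \<cdot>\<^bsub>M\<^esub> T_st M S E B \<cdot>\<^bsub>M\<^esub> swap M (T_ob M S B) E
       \<cdot>\<^bsub>M\<^esub> pmap M A E (T_ob M S B) E (opm M S oper) (idm M E))"

locale cartesian_category =
  fixes M :: "('op, 'o, 'm) leff_structure" (structure)
  assumes id_hom: "X \<in> obj M \<Longrightarrow> idm M X \<in> hom M X X"
    and comp_hom: "\<lbrakk>X \<in> obj M; Y \<in> obj M; Z \<in> obj M; f \<in> hom M X Y; g \<in> hom M Y Z\<rbrakk> \<Longrightarrow> g \<cdot> f \<in> hom M X Z"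
    and id_left: "\<lbrakk>X \<in> obj M; Y \<in> obj M; f \<in> hom M X Y\<rbrakk> \<Longrightarrow> idm M Y \<cdot> f = f"
    and id_right: "\<lbrakk>X \<in> obj M; Y \<in> obj M; f \<in> hom M X Y\<rbrakk> \<Longrightarrow> f \<cdot> idm M X = f"
    and comp_assoc: "\<lbrakk>X \<in> obj M; Y \<in> obj M; Z \<in> obj M; W \<in> obj M;
        f \<in> hom M X Y; g \<in> hom M Y Z; h \<in> hom M Z W\<rbrakk> \<Longrightarrow> (h \<cdot> g) \<cdot> f = h \<cdot> (g \<cdot> f)"
    and prd_obj: "set Ys \<subseteq> obj M \<Longrightarrow> prd M Ys \<in> obj M"
    and prj_hom: "\<lbrakk>set Ys \<subseteq> obj M; i < length Ys\<rbrakk> \<Longrightarrow> prj M Ys i \<in> hom M (prd M Ys) (Ys ! i)"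
    and prd_universal: "\<lbrakk>X \<in> obj M; set Ys \<subseteq> obj M; length fs = length Ys;
        \<And>i. i < length Ys \<Longrightarrow> fs ! i \<in> hom M X (Ys ! i)\<rbrakk>
      \<Longrightarrow> \<exists>!h. h \<in> hom M X (prd M Ys) \<and> (\<forall>i<length Ys. prj M Ys i \<cdot> h = fs ! i)"

locale strong_monads = cartesian_category +
  assumes T_obj: "\<lbrakk>S \<in> ssgns M; X \<in> obj M\<rbrakk> \<Longrightarrow> T_ob M S X \<in> obj M"
    and Tm_hom: "\<lbrakk>S \<in> ssgns M; X \<in> obj M; Y \<in> obj M; f \<in> hom M X Y\<rbrakk> \<Longrightarrow> T_mor M S f \<in> hom M (T_ob M S X) (T_ob M S Y)"
    and Tm_id: "\<lbrakk>S \<in> ssgns M; X \<in> obj M\<rbrakk> \<Longrightarrow> T_mor M S (idm M X) = idm M (T_ob M S X)"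
    and Tm_comp: "\<lbrakk>S \<in> ssgns M; X \<in> obj M; Y \<in> obj M; Z \<in> obj M; f \<in> hom M X Y; g \<in> hom M Y Z\<rbrakk>
      \<Longrightarrow> T_mor M S (g \<cdot> f) = T_mor M S g \<cdot> T_mor M S f"
    and unit_hom: "\<lbrakk>S \<in> ssgns M; X \<in> obj M\<rbrakk> \<Longrightarrow> T_unit M S X \<in> hom M X (T_ob M S X)"
    and unit_nat: "\<lbrakk>S \<in> ssgns M; X \<in> obj M; Y \<in> obj M; f \<in> hom M X Y\<rbrakk>
      \<Longrightarrow> T_mor M S f \<cdot> T_unit M S X = T_unit M S Y \<cdot> f"
    and mult_hom: "\<lbrakk>S \<in> ssgns M; X \<in> obj M\<rbrakk> \<Longrightarrow> T_mult M S X \<in> hom M (T_ob M S (T_ob M S X)) (T_ob M S X)"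
    and mult_nat: "\<lbrakk>S \<in> ssgns M; X \<in> obj M; Y \<in> obj M; f \<in> hom M X Y\<rbrakk>
      \<Longrightarrow> T_mor M S f \<cdot> T_mult M S X = T_mult M S Y \<cdot> T_mor M S (T_mor M S f)"
    and mult_unit: "\<lbrakk>S \<in> ssgns M; X \<in> obj M\<rbrakk> \<Longrightarrow> T_mult M S X \<cdot> T_unit M S (T_ob M S X) = idm M (T_ob M S X)"
    and mult_Tm_unit: "\<lbrakk>S \<in> ssgns M; X \<in> obj M\<rbrakk> \<Longrightarrow> T_mult M S X \<cdot> T_mor M S (T_unit M S X) = idm M (T_ob M S X)"
    and mult_mult: "\<lbrakk>S \<in> ssgns M; X \<in> obj M\<rbrakk> \<Longrightarrow> T_mult M S X \<cdot> T_mult M S (T_ob M S X) = T_mult M S X \<cdot> T_mor M S (T_mult M S X)"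
    and st_hom: "\<lbrakk>S \<in> ssgns M; X \<in> obj M; Y \<in> obj M\<rbrakk>
      \<Longrightarrow> T_st M S X Y \<in> hom M (binprod M X (T_ob M S Y)) (T_ob M S (binprod M X Y))"
    and st_nat: "\<lbrakk>S \<in> ssgns M; X \<in> obj M; Y \<in> obj M; X' \<in> obj M; Y' \<in> obj M; f \<in> hom M X X'; g \<in> hom M Y Y'\<rbrakk>
      \<Longrightarrow> T_mor M S (pmap M X Y X' Y' f g) \<cdot> T_st M S X Y = T_st M S X' Y' \<cdot> pmap M X (T_ob M S Y) X' (T_ob M S Y') f (T_mor M S g)"
    and st_terminal: "\<lbrakk>S \<in> ssgns M; X \<in> obj M\<rbrakk>
      \<Longrightarrow> T_mor M S (p2 M (prd M []) X) \<cdot> T_st M S (prd M []) X = p2 M (prd M []) (T_ob M S X)"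
    and st_assoc: "\<lbrakk>S \<in> ssgns M; X \<in> obj M; Y \<in> obj M; Z \<in> obj M\<rbrakk>
      \<Longrightarrow> T_mor M S (assocr M X Y Z) \<cdot> T_st M S (binprod M X Y) Z
        = T_st M S X (binprod M Y Z)
          \<cdot> pmap M X (binprod M Y (T_ob M S Z)) X (T_ob M S (binprod M Y Z)) (idm M X) (T_st M S Y Z)
          \<cdot> assocr M X Y (T_ob M S Z)"
    and st_unit: "\<lbrakk>S \<in> ssgns M; X \<in> obj M; Y \<in> obj M\<rbrakk>
      \<Longrightarrow> T_st M S X Y \<cdot> pmap M X Y X (T_ob M S Y) (idm M X) (T_unit M S Y) = T_unit M S (binprod M X Y)"
    and st_mult: "\<lbrakk>S \<in> ssgns M; X \<in> obj M; Y \<in> obj M\<rbrakk>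
      \<Longrightarrow> T_st M S X Y \<cdot> pmap M X (T_ob M S (T_ob M S Y)) X (T_ob M S Y) (idm M X) (T_mult M S Y)
        = T_mult M S (binprod M X Y) \<cdot> T_mor M S (T_st M S X Y) \<cdot> T_st M S X (T_ob M S Y)"

locale kleisli_exponentials = strong_monads +
  assumes kexp_obj: "\<lbrakk>S \<in> ssgns M; Y \<in> obj M; Z \<in> obj M\<rbrakk> \<Longrightarrow> kexp M S Y Z \<in> obj M"
    and cur_bij: "\<lbrakk>S \<in> ssgns M; X \<in> obj M; Y \<in> obj M; Z \<in> obj M\<rbrakk>
      \<Longrightarrow> bij_betw (cur M S X Y Z) (hom M (binprod M X Y) (T_ob M S Z)) (hom M X (kexp M S Y Z))"
    and cur_nat: "\<lbrakk>S \<in> ssgns M; X \<in> obj M; X' \<in> obj M; Y \<in> obj M; Z \<in> obj M;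
        f \<in> hom M (binprod M X Y) (T_ob M S Z); h \<in> hom M X' X\<rbrakk>
      \<Longrightarrow> cur M S X' Y Z (f \<cdot> pmap M X' Y X Y h (idm M Y)) = cur M S X Y Z f \<cdot> h"

locale leff_model = kleisli_exponentials +
  assumes opm_hom: "\<lbrakk>S \<in> ssgns M; fmlookup S oper = Some (A, B)\<rbrakk> \<Longrightarrow> opm M S oper \<in> hom M A (T_ob M S B)"
    and handle_hom: "\<lbrakk>S \<in> ssgns M; S' \<in> ssgns M; X \<in> obj M\<rbrakk>
      \<Longrightarrow> hndl M S S' X \<in> hom M (binprod M (hobj M S S' X) (T_ob M S (T_ob M S' X))) (T_ob M S' X)"
    and handle_unit: "\<lbrakk>S \<in> ssgns M; S' \<in> ssgns M; X \<in> obj M\<rbrakk>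
      \<Longrightarrow> (let H = hobj M S S' X; Y = T_ob M S' X in
            hndl M S S' X \<cdot> pmap M H Y H (T_ob M S Y) (idm M H) (T_unit M S Y) = p2 M H Y)"
    and handle_mult: "\<lbrakk>S \<in> ssgns M; S' \<in> ssgns M; X \<in> obj M\<rbrakk>
      \<Longrightarrow> (let H = hobj M S S' X; Y = T_ob M S' X in
            hndl M S S' X \<cdot> pmap M H (T_ob M S (T_ob M S Y)) H (T_ob M S Y) (idm M H) (T_mult M S Y)
          = hndl M S S' X
            \<cdot> pmap M H (T_ob M S (binprod M H (T_ob M S Y))) H (T_ob M S Y) (idm M H) (T_mor M S (hndl M S S' X))
            \<cdot> pair M (binprod M H (T_ob M S (T_ob M S Y))) H (T_ob M S (binprod M H (T_ob M S Y)))
                (p1 M H (T_ob M S (T_ob M S Y))) (T_st M S H (T_ob M S Y)))"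
    and handle_op: "\<lbrakk>S \<in> ssgns M; S' \<in> ssgns M; X \<in> obj M;
        i < length (enum_ops (fmdom S)); enum_ops (fmdom S) ! i = oper;
        fmlookup S oper = Some (A, B)\<rbrakk>
      \<Longrightarrow> (let H = hobj M S S' X; AK = binprod M A (kexp M S' B X) in
            hndl M S S' X \<cdot> pmap M H AK H (T_ob M S (T_ob M S' X)) (idm M H) (algop M S S' X oper)
          = ev M S' AK X
            \<cdot> pmap M H AK (clause_obj M S' X (A, B)) AK (prj M (clause_objs M S S' X) i) (idm M AK))"

section \<open>Interpretation\<close>

text \<open>\<open>cty_int M (Eff A \<Sigma>)\<close> is the pair of the interpretations of \<open>\<Sigma>\<close> and \<open>A\<close>.\<close>

primrec ty_int :: "('op, 'o, 'm) leff_structure \<Rightarrow> 'op ty \<Rightarrow> 'o"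
  and cty_int :: "('op, 'o, 'm) leff_structure \<Rightarrow> 'op cty \<Rightarrow> ('op, 'o) ssgn \<times> 'o" where
  "ty_int M (TFun A C) = (case cty_int M C of (S, B) \<Rightarrow> kexp M S (ty_int M A) B)"
| "ty_int M (TProd As) = prd M (map (ty_int M) As)"
| "cty_int M (Eff A \<Sigma>) = (fmmap (map_prod (ty_int M) (ty_int M)) \<Sigma>, ty_int M A)"

definition sgn_int :: "('op, 'o, 'm) leff_structure \<Rightarrow> 'op sgn \<Rightarrow> ('op, 'o) ssgn" where
  "sgn_int M \<Sigma> = fmmap (map_prod (ty_int M) (ty_int M)) \<Sigma>"

primrec ctx_int :: "('op, 'o, 'm) leff_structure \<Rightarrow> 'op ctx \<Rightarrow> 'o" where
  "ctx_int M [] = prd M []"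
| "ctx_int M (A # \<Gamma>) = binprod M (ctx_int M \<Gamma>) (ty_int M A)"

fun var_int :: "('op, 'o, 'm) leff_structure \<Rightarrow> 'op ctx \<Rightarrow> nat \<Rightarrow> 'm" where
  "var_int M (A # \<Gamma>) 0 = p2 M (ctx_int M \<Gamma>) (ty_int M A)"
| "var_int M (A # \<Gamma>) (Suc i) = var_int M \<Gamma> i \<cdot>\<^bsub>M\<^esub> p1 M (ctx_int M \<Gamma>) (ty_int M A)"
| "var_int M [] i = undefined"

text \<open>
  Terms carry no type annotations, so the interpretation is defined along typing derivations:
  \<open>val_int M \<Gamma> V A f\<close> says that \<open>f\<close> is the morphism assigned to some derivation of
  \<open>\<Gamma> \<turnstile> V : A\<close>. The rules are in one-to-one correspondence with the typing rules, and every
  derivable judgement has an interpretation (lemma \<open>interpretation_total\<close> below).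
\<close>

inductive val_int :: "('op, 'o, 'm) leff_structure \<Rightarrow> 'op ctx \<Rightarrow> 'op val \<Rightarrow> 'op ty \<Rightarrow> 'm \<Rightarrow> bool"
  and cmp_int :: "('op, 'o, 'm) leff_structure \<Rightarrow> 'op ctx \<Rightarrow> 'op cmp \<Rightarrow> 'op cty \<Rightarrow> 'm \<Rightarrow> bool"
  and handler_int ::
    "('op, 'o, 'm) leff_structure \<Rightarrow> 'op ctx \<Rightarrow> 'op handler \<Rightarrow> 'op sgn \<Rightarrow> 'op cty \<Rightarrow> 'm \<Rightarrow> bool"
  for M :: "('op, 'o, 'm) leff_structure" where
  int_Var: "i < length \<Gamma> \<Longrightarrow> val_int M \<Gamma> (Var i) (\<Gamma> ! i) (var_int M \<Gamma> i)"
| int_Lam: "cmp_int M (A # \<Gamma>) N (Eff B \<Sigma>) f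
    \<Longrightarrow> val_int M \<Gamma> (Lam N) (TFun A (Eff B \<Sigma>))
          (cur M (sgn_int M \<Sigma>) (ctx_int M \<Gamma>) (ty_int M A) (ty_int M B) f)"
| int_Tuple: "\<lbrakk>length Vs = length As; length fs = length As;
      \<And>i. i < length As \<Longrightarrow> val_int M \<Gamma> (Vs ! i) (As ! i) (fs ! i)\<rbrakk>
    \<Longrightarrow> val_int M \<Gamma> (Tuple Vs) (TProd As) (tuple M (ctx_int M \<Gamma>) (map (ty_int M) As) fs)"
| int_Proj: "\<lbrakk>val_int M \<Gamma> V (TProd As) f; i < length As\<rbrakk>
    \<Longrightarrow> val_int M \<Gamma> (Proj i V) (As ! i) (prj M (map (ty_int M) As) i \<cdot>\<^bsub>M\<^esub> f)"
| int_App: "\<lbrakk>val_int M \<Gamma> V (TFun A (Eff B \<Sigma>)) f; val_int M \<Gamma> W A g\<rbrakk>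
    \<Longrightarrow> cmp_int M \<Gamma> (App V W) (Eff B \<Sigma>)
          (ev M (sgn_int M \<Sigma>) (ty_int M A) (ty_int M B)
           \<cdot>\<^bsub>M\<^esub> pair M (ctx_int M \<Gamma>) (ty_int M (TFun A (Eff B \<Sigma>))) (ty_int M A) f g)"
| int_Return: "val_int M \<Gamma> V A f
    \<Longrightarrow> cmp_int M \<Gamma> (Return V) (Eff A \<Sigma>) (T_unit M (sgn_int M \<Sigma>) (ty_int M A) \<cdot>\<^bsub>M\<^esub> f)"
| int_LetIn: "\<lbrakk>cmp_int M \<Gamma> L (Eff A \<Sigma>) f; cmp_int M (A # \<Gamma>) N (Eff B \<Sigma>) g;
      S = sgn_int M \<Sigma>; G = ctx_int M \<Gamma>; X = ty_int M A\<rbrakk>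
    \<Longrightarrow> cmp_int M \<Gamma> (LetIn L N) (Eff B \<Sigma>)
          (T_mult M S (ty_int M B) \<cdot>\<^bsub>M\<^esub> T_mor M S g \<cdot>\<^bsub>M\<^esub> T_st M S G X
           \<cdot>\<^bsub>M\<^esub> pair M G G (T_ob M S X) (idm M G) f)"
| int_Op: "\<lbrakk>fmlookup \<Sigma> oper = Some (A, B); val_int M \<Gamma> V A f\<rbrakk>
    \<Longrightarrow> cmp_int M \<Gamma> (Op oper V) (Eff B \<Sigma>) (opm M (sgn_int M \<Sigma>) oper \<cdot>\<^bsub>M\<^esub> f)"
| int_Handle: "\<lbrakk>cmp_int M \<Gamma> L (Eff A \<Sigma>) f; handler_int M \<Gamma> H \<Sigma> (Eff B \<Sigma>') h;
      cmp_int M (A # \<Gamma>) N (Eff B \<Sigma>') g;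
      S = sgn_int M \<Sigma>; S' = sgn_int M \<Sigma>'; G = ctx_int M \<Gamma>; X = ty_int M A; Y = ty_int M B\<rbrakk>
    \<Longrightarrow> cmp_int M \<Gamma> (Handle L H N) (Eff B \<Sigma>')
          (hndl M S S' Y
           \<cdot>\<^bsub>M\<^esub> pair M G (hobj M S S' Y) (T_ob M S (T_ob M S' Y)) h
                 (T_mor M S g \<cdot>\<^bsub>M\<^esub> T_st M S G X \<cdot>\<^bsub>M\<^esub> pair M G G (T_ob M S X) (idm M G) f))"
| int_handler: "\<lbrakk>fmdom H = fmdom \<Sigma>;
      \<And>oper A B N. \<lbrakk>fmlookup \<Sigma> oper = Some (A, B); fmlookup H oper = Some N\<rbrakk>
        \<Longrightarrow> cmp_int M (TFun B (Eff D \<Sigma>') # A # \<Gamma>) N (Eff D \<Sigma>') (F oper);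
      S = sgn_int M \<Sigma>; S' = sgn_int M \<Sigma>'; G = ctx_int M \<Gamma>; Y = ty_int M D\<rbrakk>
    \<Longrightarrow> handler_int M \<Gamma> H \<Sigma> (Eff D \<Sigma>')
          (tuple M G (clause_objs M S S' Y)
            (map (\<lambda>oper. case the (fmlookup S oper) of (A, B) \<Rightarrow>
                let K = kexp M S' B Y in
                cur M S' G (binprod M A K) Y (F oper \<cdot>\<^bsub>M\<^esub> assocl M G A K))
              (enum_ops (fmdom S))))"

lemma interpretation_total:
  "val_typed \<Gamma> V A \<Longrightarrow> \<exists>f. val_int M \<Gamma> V A f"
  "cmp_typed \<Gamma> N C \<Longrightarrow> \<exists>f. cmp_int M \<Gamma> N C f"
  "handler_typed \<Gamma> H \<Sigma> C \<Longrightarrow> \<exists>f. handler_int M \<Gamma> H \<Sigma> C f"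
proof (induction rule: val_typed_cmp_typed_handler_typed.inducts)
  case (ty_Var i \<Gamma>)
  then show ?case by (blast intro: int_Var)
next
  case (ty_Lam A \<Gamma> N C)
  then show ?case by (cases C) (blast intro: int_Lam)
next
  case (ty_Tuple Vs As \<Gamma>)
  then obtain F where F: "\<And>i. i < length As \<Longrightarrow> val_int M \<Gamma> (Vs ! i) (As ! i) (F i)"
    by metis
  have "val_int M \<Gamma> (Tuple Vs) (TProd As)
      (tuple M (ctx_int M \<Gamma>) (map (ty_int M) As) (map F [0..<length As]))"
    by (rule int_Tuple) (use ty_Tuple F in simp_all)
  then show ?case by blast
next
  case (ty_Proj \<Gamma> V As i)
  then show ?case by (blast intro: int_Proj)
next
  case (ty_App \<Gamma> V A C W)
  then show ?case by (cases C) (blast intro: int_App)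
next
  case (ty_Return \<Gamma> V A \<Sigma>)
  then show ?case by (blast intro: int_Return)
next
  case (ty_LetIn \<Gamma> L A \<Sigma> N B)
  then show ?case by (blast intro: int_LetIn)
next
  case (ty_Op \<Sigma> oper A B \<Gamma> V)
  then show ?case by (blast intro: int_Op)
next
  case (ty_Handle \<Gamma> L A \<Sigma> H C N)
  then show ?case by (cases C) (blast intro: int_Handle)
next
  case (ty_handler H \<Sigma> C \<Gamma>)
  obtain D \<Sigma>' where C: "C = Eff D \<Sigma>'" by (cases C)
  define P where "P oper f \<longleftrightarrow> (\<forall>A B N. fmlookup \<Sigma> oper = Some (A, B) \<longrightarrow> fmlookup H oper = Some N
    \<longrightarrow> cmp_int M (TFun B C # A # \<Gamma>) N C f)" for oper f
  have "\<exists>f. P oper f" for oper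
  proof (cases "fmlookup \<Sigma> oper = None \<or> fmlookup H oper = None")
    case False
    then obtain A B N where "fmlookup \<Sigma> oper = Some (A, B)" "fmlookup H oper = Some N" by auto
    then show ?thesis using ty_handler.IH[of oper A B N] by (auto simp: P_def)
  qed (auto simp: P_def)
  then obtain F where F: "\<And>oper. P oper (F oper)" by metis
  show ?case
    unfolding C
    by (intro exI, rule int_handler[where F = F, OF _ _ refl refl refl refl])
      (use F ty_handler.hyps C in \<open>auto simp: P_def\<close>)
qed

lemma interpretation_typed:
  "val_int M \<Gamma> V A f \<Longrightarrow> val_typed \<Gamma> V A"
  "cmp_int M \<Gamma> N C f \<Longrightarrow> cmp_typed \<Gamma> N C"
  "handler_int M \<Gamma> H \<Sigma> C f \<Longrightarrow> handler_typed \<Gamma> H \<Sigma> C"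
  by (induction rule: val_int_cmp_int_handler_int.inducts)
    (auto intro: val_typed_cmp_typed_handler_typed.intros)

text \<open>
  A premise cannot quantify over all types of objects and morphisms. It is stated for the models
  whose objects and morphisms are elements of the following types. This is a subclass of all
  models, so a completeness theorem with this premise implies the one with a premise
  about all models.
\<close>

type_synonym 'op syn_structure = "('op, 'op ty, 'op ty \<times> 'op ty \<times> 'op val set) leff_structure"

end

theory Submission
  imports Defs
begin

text \<open>
  The syntactic model has types as objects and, as morphisms \<open>X \<rightarrow> Y\<close>, values \<open>V\<close> with
  \<open>x : X \<turnstile> V : Y\<close> up to derivable equality; \<open>T\<^sub>S X\<close> is the type of thunks \<open>() \<rightarrow> X ! S\<close>. The
  terms carry no annotations and a class collects raw terms, so every typing derivation of
  \<open>\<Gamma> \<turnstile> V : A\<close> is interpreted by the same morphism, namely the class of \<open>V\<close> with its variables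
  replaced by projections from the product of \<open>\<Gamma>\<close>. Substituting the tuple of the variables of \<open>\<Gamma>\<close>
  undoes this replacement up to derivable equality; hence terms with equal interpretations are equal.

  Each model axiom is an equation between concrete terms. Both sides are normalised with an
  \<^emph>\<open>untyped\<close> reduction relation that satisfies subject reduction, so that typing has to be checked
  only once per side; the few uses of \<open>\<eta>\<close> are added by hand.
\<close>

section \<open>Substitution calculus\<close>

text \<open>Equality in the calculus is typed: a step deep inside a term is derivable only together
  with the types of all surrounding subterms. In a composite of several morphism terms these typings
  would have to be supplied again at every step; hence the detour through a relation without
  contexts. It omits the \<eta> laws of functions and products; the one for products depends on the
  number of components, which is part of the type and not of the term. These laws enter in the
  uniqueness of tuples, in laws with a bare variable or projection as one side, in the unit law of
  the strength, in the bijection of currying, and in the law for operations.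

  Thunks make effectful computations representable by values. With them a computation of type
  \<open>X ! S\<close> becomes a value of an object, and the Kleisli exponential is the function
  type itself, up to the passage between \<open>App\<close> and a thunk.

  Handlers are not values. In a model a handler is the tuple of its curried clauses, so a
  translation back from tuples to handlers is needed, both for defining the handling morphism and
  for recovering equations between handlers.\<close>

lemma up_ren_simps [simp]:
  "up_ren \<xi> 0 = 0" "up_ren \<xi> (Suc n) = Suc (\<xi> n)"
  by (simp_all add: up_ren_def)

lemma up_sub_simps [simp]:
  "up_sub \<sigma> 0 = Var 0" "up_sub \<sigma> (Suc n) = ren_val (\<sigma> n) Suc"
  by (simp_all add: up_sub_def)

text \<open>Naming the action on clause maps, as \<open>ren_handler\<close> does for renamings, lets
  handlers be treated as a third syntactic class with its own fusion and typing laws.\<close>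

definition sub_handler :: "'op handler \<Rightarrow> (nat \<Rightarrow> 'op val) \<Rightarrow> 'op handler" where
  "sub_handler H \<sigma> = fmmap (\<lambda>L. sub_cmp L (up_sub (up_sub \<sigma>))) H"

lemma ren_cmp_Handle [simp]:
  "ren_cmp (Handle M H N) \<xi> = Handle (ren_cmp M \<xi>) (ren_handler H \<xi>) (ren_cmp N (up_ren \<xi>))"
  by (simp add: ren_handler_def)

lemma sub_cmp_Handle [simp]:
  "sub_cmp (Handle M H N) \<sigma> = Handle (sub_cmp M \<sigma>) (sub_handler H \<sigma>) (sub_cmp N (up_sub \<sigma>))"
  by (simp add: sub_handler_def)

declare ren_cmp.simps(5) [simp del] sub_cmp.simps(5) [simp del]

lemma fmlookup_ren_handler [simp]:
  "fmlookup (ren_handler H \<xi>) oper = map_option (\<lambda>L. ren_cmp L (up_ren (up_ren \<xi>))) (fmlookup H oper)"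
  by (simp add: ren_handler_def)

lemma fmlookup_sub_handler [simp]:
  "fmlookup (sub_handler H \<sigma>) oper = map_option (\<lambda>L. sub_cmp L (up_sub (up_sub \<sigma>))) (fmlookup H oper)"
  by (simp add: sub_handler_def)

lemma fmdom_ren_handler [simp]: "fmdom (ren_handler H \<xi>) = fmdom H"
  by (simp add: ren_handler_def)

lemma fmdom_sub_handler [simp]: "fmdom (sub_handler H \<sigma>) = fmdom H"
  by (simp add: sub_handler_def)

lemma up_ren_comp: "(\<lambda>n. up_ren \<zeta> (up_ren \<xi> n)) = up_ren (\<lambda>n. \<zeta> (\<xi> n))"
  by (rule ext) (simp add: up_ren_def split: nat.split)

lemma up_sub_up_ren: "(\<lambda>n. up_sub \<sigma> (up_ren \<xi> n)) = up_sub (\<lambda>n. \<sigma> (\<xi> n))"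
  by (rule ext) (simp add: up_ren_def up_sub_def split: nat.split)

lemma up_sub_Var: "up_sub Var = Var"
  by (rule ext) (simp add: up_sub_def split: nat.split)

lemma handler_map_cong:
  "(\<And>L. L \<in> fmran' H \<Longrightarrow> f L = g L) \<Longrightarrow> fmmap f H = fmmap g H"
  by (rule fmap.map_cong0)

lemma fmmap_fmmap: "fmmap f (fmmap g H) = fmmap (\<lambda>L. f (g L)) H"
  by (simp add: fmap.map_comp comp_def)

text \<open>The order of the fusion laws matters: moving a renaming under \<open>up_sub\<close>
  (\<open>ren_up_sub\<close>) uses this one, and moving a substitution under \<open>up_sub\<close>
  (\<open>sub_up_sub\<close>) uses the two mixed ones. In the \<open>Handle\<close> case the
  induction hypothesis covers the clauses in the range of the map.\<close>

lemma ren_ren: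
  fixes V :: "'op val" and M :: "'op cmp"
  shows
  "ren_val (ren_val V \<xi>) \<zeta> = ren_val V (\<lambda>n. \<zeta> (\<xi> n))"
  "ren_cmp (ren_cmp M \<xi>) \<zeta> = ren_cmp M (\<lambda>n. \<zeta> (\<xi> n))"
proof (induction V and M arbitrary: \<xi> \<zeta> and \<xi> \<zeta> rule: val.induct cmp.induct)
  case (Handle M H N)
  have "ren_handler (ren_handler H \<xi>) \<zeta> = ren_handler H (\<lambda>n. \<zeta> (\<xi> n))"
    unfolding ren_handler_def fmmap_fmmap
    by (rule handler_map_cong) (use Handle.IH(2) in \<open>auto simp: up_ren_comp\<close>)
  then show ?case using Handle by (simp add: up_ren_comp)
qed (simp_all add: up_ren_comp)

lemma sub_ren:
  "sub_val (ren_val V \<xi>) \<sigma> = sub_val V (\<lambda>n. \<sigma> (\<xi> n))"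
  "sub_cmp (ren_cmp M \<xi>) \<sigma> = sub_cmp M (\<lambda>n. \<sigma> (\<xi> n))"
proof (induction V and M arbitrary: \<xi> \<sigma> and \<xi> \<sigma> rule: val.induct cmp.induct)
  case (Handle M H N)
  have "sub_handler (ren_handler H \<xi>) \<sigma> = sub_handler H (\<lambda>n. \<sigma> (\<xi> n))"
    unfolding ren_handler_def sub_handler_def fmmap_fmmap
    by (rule handler_map_cong) (use Handle.IH(2) in \<open>auto simp: up_sub_up_ren\<close>)
  then show ?case using Handle by (simp add: up_sub_up_ren)
qed (simp_all add: up_sub_up_ren)

lemma ren_up_sub: "(\<lambda>n. ren_val (up_sub \<sigma> n) (up_ren \<xi>)) = up_sub (\<lambda>n. ren_val (\<sigma> n) \<xi>)"
  by (rule ext) (simp add: up_sub_def ren_ren split: nat.split)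

lemma ren_sub:
  "ren_val (sub_val V \<sigma>) \<xi> = sub_val V (\<lambda>n. ren_val (\<sigma> n) \<xi>)"
  "ren_cmp (sub_cmp M \<sigma>) \<xi> = sub_cmp M (\<lambda>n. ren_val (\<sigma> n) \<xi>)"
proof (induction V and M arbitrary: \<xi> \<sigma> and \<xi> \<sigma> rule: val.induct cmp.induct)
  case (Handle M H N)
  have "ren_handler (sub_handler H \<sigma>) \<xi> = sub_handler H (\<lambda>n. ren_val (\<sigma> n) \<xi>)"
    unfolding ren_handler_def sub_handler_def fmmap_fmmap
    by (rule handler_map_cong) (use Handle.IH(2) in \<open>auto simp: ren_up_sub\<close>)
  then show ?case using Handle by (simp add: ren_up_sub)
qed (simp_all add: ren_up_sub)

lemma sub_up_sub: "(\<lambda>n. sub_val (up_sub \<sigma> n) (up_sub \<tau>)) = up_sub (\<lambda>n. sub_val (\<sigma> n) \<tau>)"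
  by (rule ext) (simp add: up_sub_def sub_ren ren_sub split: nat.split)

lemma sub_sub:
  "sub_val (sub_val V \<sigma>) \<tau> = sub_val V (\<lambda>n. sub_val (\<sigma> n) \<tau>)"
  "sub_cmp (sub_cmp M \<sigma>) \<tau> = sub_cmp M (\<lambda>n. sub_val (\<sigma> n) \<tau>)"
proof (induction V and M arbitrary: \<sigma> \<tau> and \<sigma> \<tau> rule: val.induct cmp.induct)
  case (Handle M H N)
  have "sub_handler (sub_handler H \<sigma>) \<tau> = sub_handler H (\<lambda>n. sub_val (\<sigma> n) \<tau>)"
    unfolding sub_handler_def fmmap_fmmap
    by (rule handler_map_cong) (use Handle.IH(2) in \<open>auto simp: sub_up_sub\<close>)
  then show ?case using Handle by (simp add: sub_up_sub)
qed (simp_all add: sub_up_sub)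

lemma sub_Var [simp]:
  fixes V :: "'op val" and M :: "'op cmp"
  shows
  "sub_val V Var = V" "sub_cmp M Var = M"
proof (induction V and M rule: val.induct cmp.induct)
  case (Handle M H N)
  have "sub_handler H Var = fmmap (\<lambda>L. L) H"
    unfolding sub_handler_def
    by (rule handler_map_cong) (use Handle.IH(2) in \<open>auto simp: up_sub_Var\<close>)
  then show ?case using Handle by (simp add: up_sub_Var fmap.map_ident)
qed (simp_all add: up_sub_Var map_idI)

lemma sub_handler_Var [simp]: "sub_handler H Var = H"
  by (rule fmap_ext) (simp add: up_sub_Var option.map_ident)

lemma sub_ren_handler: "sub_handler (ren_handler H \<xi>) \<sigma> = sub_handler H (\<lambda>n. \<sigma> (\<xi> n))"
  by (rule fmap_ext) (simp add: option.map_comp comp_def sub_ren up_sub_up_ren)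

lemma ren_sub_handler: "ren_handler (sub_handler H \<sigma>) \<xi> = sub_handler H (\<lambda>n. ren_val (\<sigma> n) \<xi>)"
  by (rule fmap_ext) (simp add: option.map_comp comp_def ren_sub ren_up_sub)

lemma sub_sub_handler: "sub_handler (sub_handler H \<sigma>) \<tau> = sub_handler H (\<lambda>n. sub_val (\<sigma> n) \<tau>)"
  by (rule fmap_ext) (simp add: option.map_comp comp_def sub_sub sub_up_sub)

lemma ren_ren_handler: "ren_handler (ren_handler H \<xi>) \<zeta> = ren_handler H (\<lambda>n. \<zeta> (\<xi> n))"
  by (rule fmap_ext) (simp add: option.map_comp comp_def ren_ren up_ren_comp)

text \<open>Renamings are substitutions by variables; stability of equality and of reduction is
  therefore proved for substitutions and inherited by renamings.\<close>

lemma ren_as_sub: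
  "ren_val V \<xi> = sub_val V (\<lambda>n. Var (\<xi> n))"
  "ren_cmp M \<xi> = sub_cmp M (\<lambda>n. Var (\<xi> n))"
  using sub_ren(1)[of V \<xi> Var] sub_ren(2)[of M \<xi> Var] by simp_all

lemma ren_handler_as_sub: "ren_handler H \<xi> = sub_handler H (\<lambda>n. Var (\<xi> n))"
  using sub_ren_handler[of H \<xi> Var] by simp

lemmas sub_simps = ren_ren sub_ren ren_sub sub_sub
  sub_ren_handler ren_sub_handler sub_sub_handler ren_ren_handler

lemma sub_inst1: "sub_cmp (inst1 M V) \<sigma> = inst1 (sub_cmp M (up_sub \<sigma>)) (sub_val V \<sigma>)"
proof -
  have "(\<lambda>n. sub_val (case_nat V Var n) \<sigma>)
      = (\<lambda>n. sub_val (up_sub \<sigma> n) (case_nat (sub_val V \<sigma>) Var))"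
    by (rule ext) (simp add: sub_simps split: nat.split)
  then show ?thesis by (simp add: inst1_def sub_simps)
qed

lemma sub_inst2:
  "sub_cmp (inst2 M V W) \<sigma> = inst2 (sub_cmp M (up_sub (up_sub \<sigma>))) (sub_val V \<sigma>) (sub_val W \<sigma>)"
proof -
  have "(\<lambda>n. sub_val (case_nat W (case_nat V Var) n) \<sigma>)
      = (\<lambda>n. sub_val (up_sub (up_sub \<sigma>) n) (case_nat (sub_val W \<sigma>) (case_nat (sub_val V \<sigma>) Var)))"
    by (rule ext) (auto simp: sub_simps up_sub_def split: nat.split)
  then show ?thesis by (simp add: inst2_def sub_simps)
qed

section \<open>Typing and substitution\<close>

inductive_cases val_typed_VarE: "val_typed \<Gamma> (Var i) A"
inductive_cases val_typed_LamE: "val_typed \<Gamma> (Lam M) A"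
inductive_cases val_typed_TupleE: "val_typed \<Gamma> (Tuple Vs) A"
inductive_cases val_typed_ProjE: "val_typed \<Gamma> (Proj i V) A"
inductive_cases cmp_typed_AppE: "cmp_typed \<Gamma> (App V W) C"
inductive_cases cmp_typed_ReturnE: "cmp_typed \<Gamma> (Return V) C"
inductive_cases cmp_typed_LetInE: "cmp_typed \<Gamma> (LetIn M N) C"
inductive_cases cmp_typed_OpE: "cmp_typed \<Gamma> (Op oper V) C"
inductive_cases cmp_typed_HandleE: "cmp_typed \<Gamma> (Handle M H N) C"
inductive_cases handler_typedE: "handler_typed \<Gamma> H \<Sigma> C"

lemmas typed_intros = val_typed_cmp_typed_handler_typed.intros

lemma ty_VarI: "i < length \<Gamma> \<Longrightarrow> \<Gamma> ! i = A \<Longrightarrow> val_typed \<Gamma> (Var i) A"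
  using ty_Var by blast

lemma ty_ProjI: "val_typed \<Gamma> V (TProd As) \<Longrightarrow> i < length As \<Longrightarrow> As ! i = A \<Longrightarrow> val_typed \<Gamma> (Proj i V) A"
  using ty_Proj by blast

definition ren_typed :: "'op ctx \<Rightarrow> (nat \<Rightarrow> nat) \<Rightarrow> 'op ctx \<Rightarrow> bool" where
  "ren_typed \<Delta> \<xi> \<Gamma> \<longleftrightarrow> (\<forall>i<length \<Gamma>. \<xi> i < length \<Delta> \<and> \<Delta> ! \<xi> i = \<Gamma> ! i)"

definition sub_typed :: "'op ctx \<Rightarrow> (nat \<Rightarrow> 'op val) \<Rightarrow> 'op ctx \<Rightarrow> bool" where
  "sub_typed \<Delta> \<sigma> \<Gamma> \<longleftrightarrow> (\<forall>i<length \<Gamma>. val_typed \<Delta> (\<sigma> i) (\<Gamma> ! i))"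

definition sub_eq :: "'op ctx \<Rightarrow> (nat \<Rightarrow> 'op val) \<Rightarrow> (nat \<Rightarrow> 'op val) \<Rightarrow> 'op ctx \<Rightarrow> bool" where
  "sub_eq \<Delta> \<sigma> \<tau> \<Gamma> \<longleftrightarrow> (\<forall>i<length \<Gamma>. val_eq \<Delta> (\<sigma> i) (\<tau> i) (\<Gamma> ! i))"

lemma ren_typed_up: "ren_typed \<Delta> \<xi> \<Gamma> \<Longrightarrow> ren_typed (A # \<Delta>) (up_ren \<xi>) (A # \<Gamma>)"
  by (auto simp: ren_typed_def less_Suc_eq_0_disj)

lemma ren_typed_Suc: "ren_typed (A # \<Gamma>) Suc \<Gamma>"
  by (simp add: ren_typed_def)

lemma typed_ren:
  "val_typed \<Gamma> V A \<Longrightarrow> ren_typed \<Delta> \<xi> \<Gamma> \<Longrightarrow> val_typed \<Delta> (ren_val V \<xi>) A"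
  "cmp_typed \<Gamma> M C \<Longrightarrow> ren_typed \<Delta> \<xi> \<Gamma> \<Longrightarrow> cmp_typed \<Delta> (ren_cmp M \<xi>) C"
  "handler_typed \<Gamma> H \<Sigma> C \<Longrightarrow> ren_typed \<Delta> \<xi> \<Gamma> \<Longrightarrow> handler_typed \<Delta> (ren_handler H \<xi>) \<Sigma> C"
proof (induction arbitrary: \<Delta> \<xi> and \<Delta> \<xi> and \<Delta> \<xi> rule: val_typed_cmp_typed_handler_typed.inducts)
  case (ty_Var i \<Gamma>)
  then show ?case by (auto simp: ren_typed_def intro: ty_VarI)
next
  case (ty_handler H \<Sigma> C \<Gamma>)
  show ?case
    by (rule typed_intros)
      (use ty_handler in \<open>auto intro!: ty_handler.IH ren_typed_up\<close>)
next
  case (ty_LetIn \<Gamma> M A \<Sigma> N B)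
  show ?case
    by simp (rule typed_intros ty_LetIn.IH ren_typed_up ty_LetIn.prems)+
next
  case (ty_Handle \<Gamma> M A \<Sigma> H C N)
  show ?case
    by simp (rule ty_Handle.IH ren_typed_up ty_Handle.prems typed_intros)+
next
  case (ty_Lam A \<Gamma> M C)
  show ?case
    by simp (rule typed_intros ty_Lam.IH ren_typed_up ty_Lam.prems)+
next
  case (ty_App \<Gamma> V A C W)
  show ?case
    by simp (rule typed_intros ty_App.IH ty_App.prems)+
qed (auto intro: typed_intros)

lemma typed_weaken:
  "val_typed \<Gamma> V A \<Longrightarrow> val_typed (B # \<Gamma>) (ren_val V Suc) A"
  "cmp_typed \<Gamma> M C \<Longrightarrow> cmp_typed (B # \<Gamma>) (ren_cmp M Suc) C"
  "handler_typed \<Gamma> H \<Sigma> C \<Longrightarrow> handler_typed (B # \<Gamma>) (ren_handler H Suc) \<Sigma> C"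
  by (auto intro: typed_ren ren_typed_Suc)

lemma sub_typed_up: "sub_typed \<Delta> \<sigma> \<Gamma> \<Longrightarrow> sub_typed (A # \<Delta>) (up_sub \<sigma>) (A # \<Gamma>)"
  by (auto simp: sub_typed_def less_Suc_eq_0_disj intro!: typed_weaken intro: ty_VarI)

lemma typed_sub:
  "val_typed \<Gamma> V A \<Longrightarrow> sub_typed \<Delta> \<sigma> \<Gamma> \<Longrightarrow> val_typed \<Delta> (sub_val V \<sigma>) A"
  "cmp_typed \<Gamma> M C \<Longrightarrow> sub_typed \<Delta> \<sigma> \<Gamma> \<Longrightarrow> cmp_typed \<Delta> (sub_cmp M \<sigma>) C"
  "handler_typed \<Gamma> H \<Sigma> C \<Longrightarrow> sub_typed \<Delta> \<sigma> \<Gamma> \<Longrightarrow> handler_typed \<Delta> (sub_handler H \<sigma>) \<Sigma> C"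
proof (induction arbitrary: \<Delta> \<sigma> and \<Delta> \<sigma> and \<Delta> \<sigma> rule: val_typed_cmp_typed_handler_typed.inducts)
  case (ty_Var i \<Gamma>)
  then show ?case by (auto simp: sub_typed_def)
next
  case (ty_handler H \<Sigma> C \<Gamma>)
  show ?case
    by (rule typed_intros)
      (use ty_handler in \<open>auto intro!: ty_handler.IH sub_typed_up\<close>)
next
  case (ty_LetIn \<Gamma> M A \<Sigma> N B)
  show ?case
    by simp (rule typed_intros ty_LetIn.IH sub_typed_up ty_LetIn.prems)+
next
  case (ty_Handle \<Gamma> M A \<Sigma> H C N)
  show ?case
    by simp (rule ty_Handle.IH sub_typed_up ty_Handle.prems typed_intros)+
next
  case (ty_Lam A \<Gamma> M C)
  show ?case
    by simp (rule typed_intros ty_Lam.IH sub_typed_up ty_Lam.prems)+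
next
  case (ty_App \<Gamma> V A C W)
  show ?case
    by simp (rule typed_intros ty_App.IH ty_App.prems)+
qed (auto intro: typed_intros)

lemma sub_typed_Var: "sub_typed \<Gamma> Var \<Gamma>"
  by (simp add: sub_typed_def ty_Var)

lemma sub_typed_ren: "ren_typed \<Delta> \<xi> \<Gamma> \<Longrightarrow> sub_typed \<Delta> (\<lambda>n. Var (\<xi> n)) \<Gamma>"
  by (auto simp: sub_typed_def ren_typed_def intro: ty_VarI)

lemma sub_typed_case_nat:
  "val_typed \<Delta> V A \<Longrightarrow> sub_typed \<Delta> \<sigma> \<Gamma> \<Longrightarrow> sub_typed \<Delta> (case_nat V \<sigma>) (A # \<Gamma>)"
  by (auto simp: sub_typed_def less_Suc_eq_0_disj)

lemma typed_inst1: "cmp_typed (A # \<Gamma>) M C \<Longrightarrow> val_typed \<Gamma> V A \<Longrightarrow> cmp_typed \<Gamma> (inst1 M V) C"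
  unfolding inst1_def by (blast intro: typed_sub sub_typed_case_nat sub_typed_Var)

lemma typed_inst2:
  "cmp_typed (B # A # \<Gamma>) M C \<Longrightarrow> val_typed \<Gamma> V A \<Longrightarrow> val_typed \<Gamma> W B \<Longrightarrow> cmp_typed \<Gamma> (inst2 M V W) C"
  unfolding inst2_def by (blast intro: typed_sub sub_typed_case_nat sub_typed_Var)

section \<open>Substitution and equality\<close>

lemma fmdom_eq_lookup:
  "fmdom H = fmdom H' \<Longrightarrow> fmlookup H x = Some y \<Longrightarrow> \<exists>z. fmlookup H' x = Some z"
  by (metis fmdom_notI fmdom_notD not_None_eq)

lemma eq_typed:
  "val_eq \<Gamma> V W A \<Longrightarrow> val_typed \<Gamma> V A \<and> val_typed \<Gamma> W A"
  "cmp_eq \<Gamma> M N C \<Longrightarrow> cmp_typed \<Gamma> M C \<and> cmp_typed \<Gamma> N C"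
  "handler_eq \<Gamma> H H' \<Sigma> C \<Longrightarrow> handler_typed \<Gamma> H \<Sigma> C \<and> handler_typed \<Gamma> H' \<Sigma> C"
proof (induction rule: val_eq_cmp_eq_handler_eq.inducts)
  case (cong_handler H \<Sigma> H' C \<Gamma>)
  \<comment> \<open>The hypotheses of the rule concern operations with a clause in both handlers;
    equality of the domains supplies the partner clause.\<close>
  then show ?case
    by (auto intro!: ty_handler) (metis fmdom_eq_lookup)+
next
  case (beta_fun A \<Gamma> M C V)
  then show ?case by (auto intro: typed_intros typed_inst1)
next
  case (eta_fun \<Gamma> V A C)
  then show ?case by (auto intro!: ty_Lam ty_App[OF typed_weaken(1)] ty_VarI)
next
  case (beta_prod \<Gamma> Vs As i)
  then show ?case by (auto intro: typed_intros elim: val_typed_TupleE)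
next
  case (eta_prod \<Gamma> V As)
  then show ?case by (auto intro!: ty_Tuple ty_Proj)
next
  case (let_return \<Gamma> V A M B \<Sigma>)
  then show ?case by (auto intro: typed_intros typed_inst1)
next
  case (let_eta \<Gamma> M A \<Sigma>)
  then show ?case by (auto intro!: ty_LetIn ty_Return ty_VarI)
next
  case (let_assoc \<Gamma> L A \<Sigma> M B N D)
  then show ?case by (blast intro: typed_intros typed_ren ren_typed_up ren_typed_Suc)
next
  case (handle_return \<Gamma> V A H \<Sigma> C M)
  then show ?case by (blast intro: typed_intros typed_inst1)
next
  case (handle_let \<Gamma> L A \<Sigma> M B H C N)
  then show ?case by (blast intro: typed_intros typed_ren ren_typed_up ren_typed_Suc)
next
  case (handle_op \<Sigma> oper A B \<Gamma> V H C L M)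
  then show ?case by (blast intro: typed_intros typed_inst2 elim: handler_typedE)
qed (blast intro: typed_intros)+

lemma eq_sub:
  "val_eq \<Gamma> V W A \<Longrightarrow> sub_typed \<Delta> \<sigma> \<Gamma> \<Longrightarrow> val_eq \<Delta> (sub_val V \<sigma>) (sub_val W \<sigma>) A"
  "cmp_eq \<Gamma> M N C \<Longrightarrow> sub_typed \<Delta> \<sigma> \<Gamma> \<Longrightarrow> cmp_eq \<Delta> (sub_cmp M \<sigma>) (sub_cmp N \<sigma>) C"
  "handler_eq \<Gamma> H H' \<Sigma> C \<Longrightarrow> sub_typed \<Delta> \<sigma> \<Gamma> \<Longrightarrow> handler_eq \<Delta> (sub_handler H \<sigma>) (sub_handler H' \<sigma>) \<Sigma> C"
proof (induction arbitrary: \<Delta> \<sigma> and \<Delta> \<sigma> and \<Delta> \<sigma> rule: val_eq_cmp_eq_handler_eq.inducts)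
  case (cong_handler H \<Sigma> H' C \<Gamma>)
  show ?case
    by (rule val_eq_cmp_eq_handler_eq.cong_handler) (use cong_handler in \<open>auto intro!: cong_handler.IH sub_typed_up\<close>)
next
  case (beta_fun A \<Gamma> M C V)
  then show ?case by (auto simp: sub_inst1 intro!: val_eq_cmp_eq_handler_eq.beta_fun typed_sub sub_typed_up)
next
  case (eta_fun \<Gamma> V A C)
  then have "val_eq \<Delta> (sub_val V \<sigma>) (Lam (App (ren_val (sub_val V \<sigma>) Suc) (Var 0))) (TFun A C)"
    by (intro val_eq_cmp_eq_handler_eq.eta_fun typed_sub)
  then show ?case by (simp add: sub_simps)
next
  case (beta_prod \<Gamma> Vs As i)
  then have "val_eq \<Delta> (Proj i (sub_val (Tuple Vs) \<sigma>)) (map (\<lambda>V. sub_val V \<sigma>) Vs ! i) (As ! i)"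
    using typed_sub(1)[OF beta_prod(1) beta_prod(3)] by (auto intro!: val_eq_cmp_eq_handler_eq.beta_prod)
  with beta_prod show ?case by (auto elim!: val_typed_TupleE)
next
  case (eta_prod \<Gamma> V As)
  then have "val_eq \<Delta> (sub_val V \<sigma>) (Tuple (map (\<lambda>i. Proj i (sub_val V \<sigma>)) [0..<length As])) (TProd As)"
    by (intro val_eq_cmp_eq_handler_eq.eta_prod typed_sub)
  then show ?case by (simp add: comp_def)
next
  case (let_return \<Gamma> V A M B \<Sigma>)
  then show ?case by (auto simp: sub_inst1 intro!: val_eq_cmp_eq_handler_eq.let_return typed_sub sub_typed_up)
next
  case (let_eta \<Gamma> M A \<Sigma>)
  then show ?case by (auto intro!: val_eq_cmp_eq_handler_eq.let_eta typed_sub)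
next
  case (let_assoc \<Gamma> L A \<Sigma> M B N D)
  have "cmp_eq \<Delta> (LetIn (LetIn (sub_cmp L \<sigma>) (sub_cmp M (up_sub \<sigma>))) (sub_cmp N (up_sub \<sigma>)))
     (LetIn (sub_cmp L \<sigma>) (LetIn (sub_cmp M (up_sub \<sigma>)) (ren_cmp (sub_cmp N (up_sub \<sigma>)) (up_ren Suc)))) (Eff D \<Sigma>)"
    using let_assoc by (intro val_eq_cmp_eq_handler_eq.let_assoc typed_sub)
      (assumption | rule sub_typed_up)+
  then show ?case by (simp add: sub_simps ren_up_sub up_sub_up_ren)
next
  case (handle_return \<Gamma> V A H \<Sigma> C M)
  then show ?case by (auto simp: sub_inst1 intro!: val_eq_cmp_eq_handler_eq.handle_return typed_sub sub_typed_up)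
next
  case (handle_let \<Gamma> L A \<Sigma> M B H C N)
  have "cmp_eq \<Delta> (Handle (LetIn (sub_cmp L \<sigma>) (sub_cmp M (up_sub \<sigma>))) (sub_handler H \<sigma>) (sub_cmp N (up_sub \<sigma>)))
     (Handle (sub_cmp L \<sigma>) (sub_handler H \<sigma>) (Handle (sub_cmp M (up_sub \<sigma>)) (ren_handler (sub_handler H \<sigma>) Suc)
        (ren_cmp (sub_cmp N (up_sub \<sigma>)) (up_ren Suc)))) C"
    using handle_let by (intro val_eq_cmp_eq_handler_eq.handle_let typed_sub)
      (assumption | rule sub_typed_up)+
  then show ?case by (simp add: sub_simps ren_up_sub up_sub_up_ren)
next
  case (handle_op \<Sigma> oper A B \<Gamma> V H C L M)
  then show ?case by (auto simp: sub_inst2 intro!: val_eq_cmp_eq_handler_eq.handle_op typed_sub sub_typed_up)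
next
  case (cong_Lam A \<Gamma> M M' C)
  show ?case
    by simp (rule cong_Lam.IH sub_typed_up cong_Lam.prems val_eq_cmp_eq_handler_eq.cong_Lam)+
next
  case (cong_Tuple Vs As Ws \<Gamma>)
  then show ?case by (auto intro!: val_eq_cmp_eq_handler_eq.cong_Tuple)
next
  case (cong_LetIn \<Gamma> M M' A \<Sigma> N N' B)
  show ?case
    by simp (rule cong_LetIn.IH sub_typed_up cong_LetIn.prems val_eq_cmp_eq_handler_eq.cong_LetIn)+
next
  case (cong_Handle \<Gamma> M M' A \<Sigma> H H' C N N')
  show ?case
    by simp (rule cong_Handle.IH sub_typed_up cong_Handle.prems val_eq_cmp_eq_handler_eq.cong_Handle)+
next
  case (veq_trans \<Gamma> U V A W)
  then show ?case by (blast intro: val_eq_cmp_eq_handler_eq.veq_trans)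
next
  case (ceq_trans \<Gamma> L M C N)
  then show ?case by (blast intro: val_eq_cmp_eq_handler_eq.ceq_trans)
next
  case (heq_trans \<Gamma> H H' \<Sigma> C H'')
  then show ?case by (blast intro: val_eq_cmp_eq_handler_eq.heq_trans)
next
  case (cong_App \<Gamma> V V' A C W W')
  show ?case
    by simp (rule val_eq_cmp_eq_handler_eq.cong_App cong_App.IH cong_App.prems)+
qed (auto intro: veq_refl ceq_refl heq_refl veq_sym ceq_sym heq_sym
    cong_Proj cong_Return cong_Op typed_sub)

lemma eq_ren:
  "val_eq \<Gamma> V W A \<Longrightarrow> ren_typed \<Delta> \<xi> \<Gamma> \<Longrightarrow> val_eq \<Delta> (ren_val V \<xi>) (ren_val W \<xi>) A"
  "cmp_eq \<Gamma> M N C \<Longrightarrow> ren_typed \<Delta> \<xi> \<Gamma> \<Longrightarrow> cmp_eq \<Delta> (ren_cmp M \<xi>) (ren_cmp N \<xi>) C"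
  by (simp_all add: ren_as_sub eq_sub sub_typed_ren)

lemma sub_eq_up: "sub_eq \<Delta> \<sigma> \<tau> \<Gamma> \<Longrightarrow> sub_eq (A # \<Delta>) (up_sub \<sigma>) (up_sub \<tau>) (A # \<Gamma>)"
  by (auto simp: sub_eq_def less_Suc_eq_0_disj intro!: veq_refl[OF ty_VarI] eq_ren[OF _ ren_typed_Suc])

text \<open>The complement of \<open>eq_sub\<close>: the term is fixed and the substitution varies
  up to equality, so the induction runs over the typing derivation and each case is a congruence
  rule.\<close>

lemma sub_cong:
  "val_typed \<Gamma> V A \<Longrightarrow> sub_eq \<Delta> \<sigma> \<tau> \<Gamma> \<Longrightarrow> val_eq \<Delta> (sub_val V \<sigma>) (sub_val V \<tau>) A"
  "cmp_typed \<Gamma> M C \<Longrightarrow> sub_eq \<Delta> \<sigma> \<tau> \<Gamma> \<Longrightarrow> cmp_eq \<Delta> (sub_cmp M \<sigma>) (sub_cmp M \<tau>) C"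
  "handler_typed \<Gamma> H \<Sigma> C \<Longrightarrow> sub_eq \<Delta> \<sigma> \<tau> \<Gamma> \<Longrightarrow> handler_eq \<Delta> (sub_handler H \<sigma>) (sub_handler H \<tau>) \<Sigma> C"
proof (induction arbitrary: \<Delta> \<sigma> \<tau> and \<Delta> \<sigma> \<tau> and \<Delta> \<sigma> \<tau> rule: val_typed_cmp_typed_handler_typed.inducts)
  case (ty_Var i \<Gamma>)
  then show ?case by (auto simp: sub_eq_def)
next
  case (ty_handler H \<Sigma> C \<Gamma>)
  show ?case
    by (rule cong_handler) (use ty_handler in \<open>auto intro!: ty_handler.IH sub_eq_up\<close>)
next
  case (ty_Proj \<Gamma> V As i)
  then show ?case by (auto intro: cong_Proj)
next
  case (ty_Op \<Sigma> oper A B \<Gamma> V)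
  then show ?case by (auto intro: cong_Op)
next
  case (ty_LetIn \<Gamma> M A \<Sigma> N B)
  show ?case
    by simp (rule cong_LetIn ty_LetIn.IH sub_eq_up ty_LetIn.prems)+
next
  case (ty_Handle \<Gamma> M A \<Sigma> H C N)
  show ?case
    by simp (rule ty_Handle.IH sub_eq_up ty_Handle.prems cong_Handle)+
next
  case (ty_Lam A \<Gamma> M C)
  show ?case
    by simp (rule cong_Lam ty_Lam.IH sub_eq_up ty_Lam.prems)+
next
  case (ty_Tuple Vs As \<Gamma>)
  then show ?case by (auto intro!: cong_Tuple)
next
  case (ty_App \<Gamma> V A C W)
  show ?case
    by simp (rule cong_App ty_App.IH ty_App.prems)+
qed (auto intro: cong_Return)

declare veq_trans [trans] ceq_trans [trans] heq_trans [trans]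

section \<open>Reduction\<close>

text \<open>Closed under reflexivity, transitivity and all congruences, but without contexts, types
  or symmetry. The contraction of \<open>let_eta\<close> can be included because it looks at the
  term alone.\<close>

inductive vred :: "'op val \<Rightarrow> 'op val \<Rightarrow> bool"
  and cred :: "'op cmp \<Rightarrow> 'op cmp \<Rightarrow> bool" where
  vred_refl: "vred V V"
| vred_trans: "\<lbrakk>vred U V; vred V W\<rbrakk> \<Longrightarrow> vred U W"
| cred_refl: "cred M M"
| cred_trans: "\<lbrakk>cred L M; cred M N\<rbrakk> \<Longrightarrow> cred L N"
| vred_Lam: "cred M M' \<Longrightarrow> vred (Lam M) (Lam M')"
| vred_Tuple: "list_all2 vred Vs Ws \<Longrightarrow> vred (Tuple Vs) (Tuple Ws)"
| vred_Proj: "vred V W \<Longrightarrow> vred (Proj i V) (Proj i W)"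
| cred_App: "\<lbrakk>vred V V'; vred W W'\<rbrakk> \<Longrightarrow> cred (App V W) (App V' W')"
| cred_Return: "vred V W \<Longrightarrow> cred (Return V) (Return W)"
| cred_LetIn: "\<lbrakk>cred M M'; cred N N'\<rbrakk> \<Longrightarrow> cred (LetIn M N) (LetIn M' N')"
| cred_Op: "vred V W \<Longrightarrow> cred (Op oper V) (Op oper W)"
| cred_Handle: "\<lbrakk>cred M M'; fmdom H = fmdom H';
      \<And>oper L L'. \<lbrakk>fmlookup H oper = Some L; fmlookup H' oper = Some L'\<rbrakk> \<Longrightarrow> cred L L'; cred N N'\<rbrakk>
    \<Longrightarrow> cred (Handle M H N) (Handle M' H' N')"
| cred_beta: "cred (App (Lam M) V) (inst1 M V)"
| vred_proj_tuple: "i < length Vs \<Longrightarrow> vred (Proj i (Tuple Vs)) (Vs ! i)"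
| cred_let_return: "cred (LetIn (Return V) M) (inst1 M V)"
| cred_let_eta: "cred (LetIn M (Return (Var 0))) M"
| cred_let_let: "cred (LetIn (LetIn L M) N) (LetIn L (LetIn M (ren_cmp N (up_ren Suc))))"
| cred_handle_return: "cred (Handle (Return V) H M) (inst1 M V)"
| cred_handle_let: "cred (Handle (LetIn L M) H N)
      (Handle L H (Handle M (ren_handler H Suc) (ren_cmp N (up_ren Suc))))"
| cred_handle_op: "fmlookup H oper = Some L \<Longrightarrow> cred (Handle (Op oper V) H M) (inst2 L V (Lam M))"
  monos list_all2_mono

text \<open>Soundness and subject reduction in one statement: an equation types both of its sides,
  so the transitivity cases obtain the typing of the middle term from the first half. Inverting the
  typing of a redex yields the premises of the matching equality rule, whichever type the
  unannotated term was given.\<close>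

lemma red_eq:
  "vred V W \<Longrightarrow> val_typed \<Gamma> V A \<Longrightarrow> val_eq \<Gamma> V W A"
  "cred M N \<Longrightarrow> cmp_typed \<Gamma> M C \<Longrightarrow> cmp_eq \<Gamma> M N C"
proof (induction arbitrary: \<Gamma> A and \<Gamma> C rule: vred_cred.inducts)
  case (vred_trans U V W)
  then show ?case by (blast dest: eq_typed intro: veq_trans)
next
  case (cred_trans L M N)
  then show ?case by (blast dest: eq_typed intro: ceq_trans)
next
  case (vred_Lam M M')
  then show ?case by (auto elim!: val_typed_LamE intro: cong_Lam)
next
  case (vred_Tuple Vs Ws)
  from vred_Tuple.prems obtain As where As: "A = TProd As" "length Vs = length As"
    "\<And>i. i < length As \<Longrightarrow> val_typed \<Gamma> (Vs ! i) (As ! i)"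
    by (auto elim: val_typed_TupleE)
  show ?case unfolding As(1)
    by (rule cong_Tuple) (use vred_Tuple.IH As in \<open>auto simp: list_all2_conv_all_nth\<close>)
next
  case (vred_Proj V W i)
  then show ?case by (auto elim!: val_typed_ProjE intro: cong_Proj)
next
  case (cred_App V V' W W')
  then show ?case by (blast elim!: cmp_typed_AppE intro: cong_App)
next
  case (cred_LetIn M M' N N')
  from cred_LetIn.prems obtain A \<Sigma> B where "C = Eff B \<Sigma>" "cmp_typed \<Gamma> M (Eff A \<Sigma>)"
    "cmp_typed (A # \<Gamma>) N (Eff B \<Sigma>)" by (auto elim: cmp_typed_LetInE)
  then show ?case using cred_LetIn.IH by (metis cong_LetIn)
next
  case (cred_Handle M M' H H' N N')
  from cred_Handle.prems obtain A \<Sigma> where *: "cmp_typed \<Gamma> M (Eff A \<Sigma>)" "handler_typed \<Gamma> H \<Sigma> C"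
    "cmp_typed (A # \<Gamma>) N C" by (auto elim: cmp_typed_HandleE)
  have "handler_eq \<Gamma> H H' \<Sigma> C"
    using *(2) by (auto intro!: cong_handler cred_Handle.IH simp: cred_Handle.hyps elim!: handler_typedE)
  then show ?case using * cred_Handle.IH by (blast intro: cong_Handle)
next
  case (cred_beta M V)
  then show ?case by (auto elim!: cmp_typed_AppE val_typed_LamE intro: beta_fun)
next
  case (vred_proj_tuple i Vs)
  then show ?case by (auto elim!: val_typed_ProjE intro: beta_prod elim: val_typed_TupleE)
next
  case (cred_let_return V M)
  then show ?case by (auto elim!: cmp_typed_LetInE cmp_typed_ReturnE intro: let_return)
next
  case (cred_let_eta M)
  \<comment> \<open>Typing \<open>Return (Var 0)\<close> in the extended context identifies the
    result type with the type of the bound variable, as \<open>let_eta\<close> demands.\<close>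
  then show ?case by (auto elim!: cmp_typed_LetInE cmp_typed_ReturnE val_typed_VarE intro: let_eta)
next
  case (cred_let_let L M N)
  then show ?case by (auto elim!: cmp_typed_LetInE intro: let_assoc)
next
  case (cred_handle_return V H M)
  then show ?case by (auto elim!: cmp_typed_HandleE cmp_typed_ReturnE intro: handle_return)
next
  case (cred_handle_let L M H N)
  then show ?case by (auto elim!: cmp_typed_HandleE cmp_typed_LetInE intro: handle_let)
next
  case (cred_handle_op H oper L V M)
  then show ?case by (auto elim!: cmp_typed_HandleE cmp_typed_OpE intro: handle_op)
qed (auto elim!: cmp_typed_ReturnE cmp_typed_OpE intro: veq_refl ceq_refl cong_Return cong_Op)

lemma red_sub:
  "vred V W \<Longrightarrow> vred (sub_val V \<sigma>) (sub_val W \<sigma>)"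
  "cred M N \<Longrightarrow> cred (sub_cmp M \<sigma>) (sub_cmp N \<sigma>)"
proof (induction arbitrary: \<sigma> and \<sigma> rule: vred_cred.inducts)
  case (vred_trans U V W)
  then show ?case by (blast intro: vred_cred.vred_trans)
next
  case (cred_trans L M N)
  then show ?case by (blast intro: vred_cred.cred_trans)
next
  case (vred_Tuple Vs Ws)
  then show ?case
    by (auto intro!: vred_cred.vred_Tuple simp: list_all2_conv_all_nth)
next
  case (cred_Handle M M' H H' N N')
  then show ?case
    by (auto intro!: vred_cred.cred_Handle)
next
  case (vred_proj_tuple i Vs)
  then show ?case using vred_cred.vred_proj_tuple[of i "map (\<lambda>V. sub_val V \<sigma>) Vs"] by simp
next
  case (cred_let_let L M N)
  show ?case using vred_cred.cred_let_let[of "sub_cmp L \<sigma>" "sub_cmp M (up_sub \<sigma>)" "sub_cmp N (up_sub \<sigma>)"]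
    by (simp add: sub_simps ren_up_sub up_sub_up_ren)
next
  case (cred_handle_let L M H N)
  show ?case using vred_cred.cred_handle_let[of "sub_cmp L \<sigma>" "sub_cmp M (up_sub \<sigma>)"
        "sub_handler H \<sigma>" "sub_cmp N (up_sub \<sigma>)"]
    by (simp add: sub_simps ren_up_sub up_sub_up_ren)
next
  case (cred_handle_op H oper L V M)
  then show ?case by (auto simp: sub_inst2 intro!: vred_cred.cred_handle_op)
next
  case (cred_let_eta M)
  then show ?case by (simp add: vred_cred.cred_let_eta)
qed (auto simp: sub_inst1 intro: vred_cred.intros(1,3,5,7-11,13,15,18))

lemma red_ren:
  "vred V W \<Longrightarrow> vred (ren_val V \<xi>) (ren_val W \<xi>)"
  "cred M N \<Longrightarrow> cred (ren_cmp M \<xi>) (ren_cmp N \<xi>)"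
  by (simp_all add: ren_as_sub red_sub)

lemma red_up_sub: "(\<And>n. vred (\<sigma> n) (\<tau> n)) \<Longrightarrow> vred (up_sub \<sigma> n) (up_sub \<tau> n)"
  by (cases n) (auto intro: vred_refl red_ren)

text \<open>The relation is a congruence, so all copies of a substituted value reduce together, also
  under binders. This permits reduction in the argument of an unknown morphism term
  (\<open>red_ap\<close>).\<close>

lemma red_sub_cong:
  fixes V :: "'op val" and M :: "'op cmp"
  shows
  "(\<And>n. vred (\<sigma> n) (\<tau> n)) \<Longrightarrow> vred (sub_val V \<sigma>) (sub_val V \<tau>)"
  "(\<And>n. vred (\<sigma> n) (\<tau> n)) \<Longrightarrow> cred (sub_cmp M \<sigma>) (sub_cmp M \<tau>)"
proof (induction V and M arbitrary: \<sigma> \<tau> and \<sigma> \<tau> rule: val.induct cmp.induct)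
  case (Tuple Vs)
  then show ?case by (auto intro!: vred_Tuple simp: list_all2_conv_all_nth)
next
  case (Handle M H N)
  show ?case
    unfolding sub_cmp_Handle
    by (rule cred_Handle) (auto intro!: Handle.IH red_up_sub fmran'I Handle.prems)
next
  case (LetIn M N)
  show ?case by simp (rule cred_LetIn LetIn.IH red_up_sub LetIn.prems)+
next
  case (Lam M)
  show ?case by simp (rule vred_Lam Lam.IH red_up_sub Lam.prems)+
qed (auto intro!: vred_Proj cred_App cred_Return cred_Op)

text \<open>Only the two ends have to be typed, since reducts inherit typing. Keeping
  \<open>U = U'\<close> as a separate premise lets both reducts be computed before they are
  compared.\<close>

lemma red_joinV:
  assumes "val_typed \<Gamma> V A" "val_typed \<Gamma> W A" "vred V U" "vred W U'" "U = U'"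
  shows "val_eq \<Gamma> V W A"
  using veq_trans[OF red_eq(1)[OF assms(3,1)] veq_sym] red_eq(1)[OF assms(4,2)] assms(5) by blast

section \<open>Morphism terms\<close>

text \<open>\<open>F\<close> is meant to live in a one-variable context; replacing every variable by \<open>V\<close> makes the
  commutation of \<open>ap\<close> with substitution unconditional.\<close>

definition ap :: "'op val \<Rightarrow> 'op val \<Rightarrow> 'op val" where
  "ap F V = sub_val F (\<lambda>_. V)"

definition thunk :: "'op cmp \<Rightarrow> 'op val" where
  "thunk M = Lam (ren_cmp M Suc)"

definition run :: "'op val \<Rightarrow> 'op cmp" where
  "run V = App V (Tuple [])"

lemma ren_ap [simp]: "ren_val (ap F V) \<xi> = ap F (ren_val V \<xi>)"
  by (simp add: ap_def sub_simps)

lemma sub_ap [simp]: "sub_val (ap F V) \<sigma> = ap F (sub_val V \<sigma>)"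
  by (simp add: ap_def sub_simps)

lemma ap_Var [simp]: "ap (Var n) V = V"
  by (simp add: ap_def)

text \<open>Two constant substitutions fuse to a constant one, so composition is associative already
  on raw terms.\<close>

lemma ap_ap [simp]: "ap (ap F G) V = ap F (ap G V)"
  by (simp add: ap_def[of "ap F G"] ap_def[of G])

lemma ap_Tuple [simp]: "ap (Tuple Vs) V = Tuple (map (\<lambda>F. ap F V) Vs)"
  by (simp add: ap_def)

lemma ap_Proj [simp]: "ap (Proj i F) V = Proj i (ap F V)"
  by (simp add: ap_def)

lemma ap_Lam [simp]: "ap (Lam M) V = Lam (sub_cmp M (up_sub (\<lambda>_. V)))"
  by (simp add: ap_def)

lemma ren_thunk [simp]: "ren_val (thunk M) \<xi> = thunk (ren_cmp M \<xi>)"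
  by (simp add: thunk_def sub_simps)

lemma sub_thunk [simp]: "sub_val (thunk M) \<sigma> = thunk (sub_cmp M \<sigma>)"
  by (simp add: thunk_def sub_simps)

lemma ap_thunk [simp]: "ap (thunk M) V = thunk (sub_cmp M (\<lambda>_. V))"
  by (simp add: ap_def)

lemma ren_run [simp]: "ren_cmp (run V) \<xi> = run (ren_val V \<xi>)"
  by (simp add: run_def)

lemma sub_run [simp]: "sub_cmp (run V) \<sigma> = run (sub_val V \<sigma>)"
  by (simp add: run_def)

lemma ap_cong_typed:
  assumes "val_typed [X] F Y" "val_eq \<Gamma> V W X"
  shows "val_eq \<Gamma> (ap F V) (ap F W) Y"
  unfolding ap_def by (rule sub_cong(1)[OF assms(1)]) (use assms in \<open>simp add: sub_eq_def\<close>)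

lemma ap_typed: "val_typed [X] F Y \<Longrightarrow> val_typed \<Gamma> V X \<Longrightarrow> val_typed \<Gamma> (ap F V) Y"
  unfolding ap_def by (rule typed_sub(1)) (auto simp: sub_typed_def)

lemma ap_eq:
  assumes "val_eq [X] F G Y" "val_eq \<Gamma> V W X"
  shows "val_eq \<Gamma> (ap F V) (ap G W) Y"
proof -
  have "val_eq \<Gamma> (ap F V) (ap G V) Y"
    unfolding ap_def by (rule eq_sub(1)[OF assms(1)]) (use eq_typed(1)[OF assms(2)] in \<open>simp add: sub_typed_def\<close>)
  also have "val_eq \<Gamma> (ap G V) (ap G W) Y"
    using assms eq_typed(1)[OF assms(1)] by (blast intro: ap_cong_typed)
  finally show ?thesis .
qed

text \<open>Here typing matters: the substitutions \<open>\<lambda>_. Var 0\<close> and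
  \<open>Var\<close> agree at index 0, the only variable available in the context
  \<open>[X]\<close>.\<close>

lemma ap_Var_right: "val_typed [X] F Y \<Longrightarrow> val_eq [X] (ap F (Var 0)) F Y"
  using sub_cong(1)[of "[X]" F Y "[X]" "\<lambda>_. Var 0" Var]
  by (simp add: ap_def sub_eq_def veq_refl ty_VarI)

lemma thunk_typed: "cmp_typed \<Gamma> M C \<Longrightarrow> val_typed \<Gamma> (thunk M) (TFun (TProd []) C)"
  unfolding thunk_def by (intro ty_Lam typed_weaken)

lemma run_typed: "val_typed \<Gamma> V (TFun (TProd []) C) \<Longrightarrow> cmp_typed \<Gamma> (run V) C"
  unfolding run_def by (erule ty_App) (rule ty_Tuple; simp)

lemma run_eq: "val_eq \<Gamma> V W (TFun (TProd []) C) \<Longrightarrow> cmp_eq \<Gamma> (run V) (run W) C"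
  unfolding run_def by (erule cong_App) (rule veq_refl, rule ty_Tuple; simp)

lemma thunk_eq: "cmp_eq \<Gamma> M N C \<Longrightarrow> val_eq \<Gamma> (thunk M) (thunk N) (TFun (TProd []) C)"
  unfolding thunk_def by (rule cong_Lam, erule eq_ren, rule ren_typed_Suc)

lemma inst1_ren_Suc [simp]: "inst1 (ren_cmp M Suc) V = M"
  by (simp add: inst1_def sub_simps)

lemma run_thunk: "cred (run (thunk M)) M"
  unfolding run_def thunk_def using cred_beta[of "ren_cmp M Suc" "Tuple []"] by simp

lemma unit_eta: "val_typed \<Gamma> V (TProd []) \<Longrightarrow> val_eq \<Gamma> V (Tuple []) (TProd [])"
  using eta_prod[of \<Gamma> V "[]"] by simp

text \<open>The \<eta> law of thunks. \<open>thunk (run V)\<close> applies \<open>V\<close> to the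
  empty tuple where the function \<eta> law has the bound variable; the two arguments are equal by
  \<eta> for the empty product.\<close>

lemma thunk_run:
  assumes "val_typed \<Gamma> V (TFun (TProd []) C)"
  shows "val_eq \<Gamma> (thunk (run V)) V (TFun (TProd []) C)"
proof -
  have "val_eq \<Gamma> V (Lam (App (ren_val V Suc) (Var 0))) (TFun (TProd []) C)"
    using assms by (rule eta_fun)
  also have "val_eq \<Gamma> (Lam (App (ren_val V Suc) (Var 0))) (thunk (run V)) (TFun (TProd []) C)"
    unfolding thunk_def run_def using assms
    by (auto intro!: cong_Lam cong_App[OF veq_refl[OF typed_weaken(1)]] unit_eta ty_VarI)
  finally show ?thesis by (rule veq_sym)
qed

text \<open>A model stores the clauses of a handler in the order of \<open>enum_ops\<close>, the
  calculus as a map on operations. This passes from an operation to its position, which is unique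
  because the enumeration has no repetitions.\<close>

definition op_index :: "('op, 'a) fmap \<Rightarrow> 'op \<Rightarrow> nat" where
  "op_index S oper = (THE i. i < length (enum_ops (fmdom S)) \<and> enum_ops (fmdom S) ! i = oper)"

text \<open>The handler whose clauses are the components of a value \<open>h\<close> of type \<open>\<H>\<^sub>S(X)\<close>.\<close>

definition proj_handler :: "('op, 'a) fmap \<Rightarrow> 'op val \<Rightarrow> 'op handler" where
  "proj_handler S h = fmmap_keys (\<lambda>oper _.
     App (Proj (op_index S oper) (ren_val h (\<lambda>n. Suc (Suc n)))) (Tuple [Var (Suc 0), Var 0])) S"

lemma fmlookup_proj_handler [simp]:
  "fmlookup (proj_handler S h) oper = map_option (\<lambda>_.
     App (Proj (op_index S oper) (ren_val h (\<lambda>n. Suc (Suc n)))) (Tuple [Var (Suc 0), Var 0])) (fmlookup S oper)"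
  by (simp add: proj_handler_def)

lemma fmdom_proj_handler [simp]: "fmdom (proj_handler S h) = fmdom S"
  by (simp add: proj_handler_def)

lemma sub_proj_handler [simp]: "sub_handler (proj_handler S h) \<sigma> = proj_handler S (sub_val h \<sigma>)"
  by (rule fmap_ext) (auto simp: option.map_comp sub_simps intro!: option.map_cong)

lemma ren_proj_handler [simp]: "ren_handler (proj_handler S h) \<xi> = proj_handler S (ren_val h \<xi>)"
  by (simp add: ren_handler_as_sub ren_as_sub)

text \<open>Big-step rules that compute the reduct of a term by resolution; the auxiliary relations
  inspect a subterm that is already reduced.\<close>

definition red_proj :: "nat \<Rightarrow> 'op val \<Rightarrow> 'op val \<Rightarrow> bool" where
  "red_proj i V W \<longleftrightarrow> vred (Proj i V) W"

definition red_run :: "'op val \<Rightarrow> 'op cmp \<Rightarrow> bool" where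
  "red_run V M \<longleftrightarrow> cred (run V) M"

definition red_app :: "'op val \<Rightarrow> 'op val \<Rightarrow> 'op cmp \<Rightarrow> bool" where
  "red_app V W M \<longleftrightarrow> cred (App V W) M"

definition red_let :: "'op cmp \<Rightarrow> 'op cmp \<Rightarrow> 'op cmp \<Rightarrow> bool" where
  "red_let M N L \<longleftrightarrow> cred (LetIn M N) L"

text \<open>Second stage of \<open>red_let\<close>: the head is not inspected any further, and only
  the contraction by \<open>let_eta\<close> is still tried.\<close>

definition red_let' :: "'op cmp \<Rightarrow> 'op cmp \<Rightarrow> 'op cmp \<Rightarrow> bool" where
  "red_let' M N L \<longleftrightarrow> cred (LetIn M N) L"

definition red_handle :: "'op cmp \<Rightarrow> 'op handler \<Rightarrow> 'op cmp \<Rightarrow> 'op cmp \<Rightarrow> bool" where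
  "red_handle M H N L \<longleftrightarrow> cred (Handle M H N) L"

definition red_handler :: "'op handler \<Rightarrow> 'op handler \<Rightarrow> bool" where
  "red_handler H H' \<longleftrightarrow> fmdom H = fmdom H' \<and>
     (\<forall>oper L L'. fmlookup H oper = Some L \<longrightarrow> fmlookup H' oper = Some L' \<longrightarrow> cred L L')"

lemma red_handlerD: "red_handler H H' \<Longrightarrow> cred (Handle M H N) (Handle M H' N)"
  unfolding red_handler_def by (rule cred_Handle) (auto intro: cred_refl)

lemma red_proj_handler:
  assumes "vred h h'"
  shows "red_handler (proj_handler S h) (proj_handler S h')"
proof -
  have "cred (App (Proj i (ren_val h \<xi>)) W) (App (Proj i (ren_val h' \<xi>)) W)" for i \<xi> W
    by (intro cred_App vred_Proj vred_refl red_ren assms)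
  then show ?thesis by (auto simp: red_handler_def)
qed

section \<open>Rules for computing reducts by resolution\<close>

lemma vred_Var: "vred (Var n) (Var n)"
  by (rule vred_refl)

lemma red_ap: "vred V W \<Longrightarrow> vred (ap F V) (ap F W)"
  unfolding ap_def by (rule red_sub_cong)

lemma red_thunk: "cred M N \<Longrightarrow> vred (thunk M) (thunk N)"
  unfolding thunk_def by (intro vred_Lam red_ren)

lemma red_Proj: "\<lbrakk>vred V W; red_proj i W U\<rbrakk> \<Longrightarrow> vred (Proj i V) U"
  unfolding red_proj_def by (rule vred_trans[OF vred_Proj])

lemma red_proj_0: "red_proj 0 (Tuple (V # Vs)) V"
  unfolding red_proj_def using vred_proj_tuple[of 0 "V # Vs"] by simp

lemma red_proj_1: "red_proj (Suc 0) (Tuple (U # V # Vs)) V"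
  unfolding red_proj_def using vred_proj_tuple[of "Suc 0" "U # V # Vs"] by simp

lemma red_proj_refl: "red_proj i V (Proj i V)"
  unfolding red_proj_def by (rule vred_refl)

lemma red_App: "\<lbrakk>vred V V'; vred W W'; red_app V' W' M\<rbrakk> \<Longrightarrow> cred (App V W) M"
  unfolding red_app_def by (rule cred_trans[OF cred_App])

lemma red_app_Lam: "\<lbrakk>inst1 M W = M'; cred M' N\<rbrakk> \<Longrightarrow> red_app (Lam M) W N"
  unfolding red_app_def by (rule cred_trans, rule cred_beta, simp)

lemma red_app_refl: "red_app V W (App V W)"
  unfolding red_app_def by (rule cred_refl)

lemma red_run: "\<lbrakk>vred V W; red_run W M\<rbrakk> \<Longrightarrow> cred (run V) M"
  unfolding red_run_def unfolding run_def by (rule cred_trans[OF cred_App[OF _ vred_refl]])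

lemma red_run_thunk: "red_run (thunk M) M"
  unfolding red_run_def by (rule run_thunk)

lemma red_run_refl: "red_run V (run V)"
  unfolding red_run_def by (rule cred_refl)

lemma red_LetIn: "\<lbrakk>cred M M'; red_let M' N L\<rbrakk> \<Longrightarrow> cred (LetIn M N) L"
  unfolding red_let_def by (rule cred_trans[OF cred_LetIn[OF _ cred_refl]])

lemma red_let_Return: "\<lbrakk>inst1 N V = N'; cred N' L\<rbrakk> \<Longrightarrow> red_let (Return V) N L"
  unfolding red_let_def by (rule cred_trans, rule cred_let_return, simp)

text \<open>After reassociation the inner \<open>let\<close> is inspected again, because its head
  \<open>M\<close> may itself be a \<open>Return\<close> or a \<open>LetIn\<close>; the outer one is
  afterwards tested for \<open>let_eta\<close>.\<close>

lemma red_let_LetIn: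
  "\<lbrakk>ren_cmp N (up_ren Suc) = N'; red_let M N' L; red_let' K L L'\<rbrakk> \<Longrightarrow> red_let (LetIn K M) N L'"
  unfolding red_let_def red_let'_def
  by (rule cred_trans, rule cred_let_let, rule cred_trans, rule cred_LetIn[OF cred_refl]) simp_all

lemma red_let_other: "\<lbrakk>cred N N'; red_let' M N' L\<rbrakk> \<Longrightarrow> red_let M N L"
  unfolding red_let_def red_let'_def by (rule cred_trans[OF cred_LetIn[OF cred_refl]])

lemma red_let'_eta: "red_let' M (Return (Var 0)) M"
  unfolding red_let'_def by (rule cred_let_eta)

lemma red_let'_refl: "red_let' M N (LetIn M N)"
  unfolding red_let'_def by (rule cred_refl)

lemma cred_Handle': "cred M M' \<Longrightarrow> cred N N' \<Longrightarrow> cred (Handle M H N) (Handle M' H N')"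
  by (rule cred_Handle) (auto intro: cred_refl)

lemma red_Handle: "\<lbrakk>cred M M'; red_handle M' H N L\<rbrakk> \<Longrightarrow> cred (Handle M H N) L"
  unfolding red_handle_def by (rule cred_trans[OF cred_Handle'[OF _ cred_refl]])

lemma red_handle_Return: "\<lbrakk>inst1 N V = N'; cred N' L\<rbrakk> \<Longrightarrow> red_handle (Return V) H N L"
  unfolding red_handle_def by (rule cred_trans, rule cred_handle_return, simp)

lemma red_handle_LetIn:
  "\<lbrakk>ren_handler H Suc = H'; ren_cmp N (up_ren Suc) = N'; red_handle M H' N' L; red_handler H H''\<rbrakk>
   \<Longrightarrow> red_handle (LetIn K M) H N (Handle K H'' L)"
  unfolding red_handle_def
  by (rule cred_trans, rule cred_handle_let, rule cred_trans, erule red_handlerD,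
      simp add: cred_Handle' cred_refl)

lemma red_handle_other:
  "\<lbrakk>cred N N'; red_handler H H'\<rbrakk> \<Longrightarrow> red_handle M H N (Handle M H' N')"
  unfolding red_handle_def by (rule cred_trans, erule red_handlerD, rule cred_Handle'[OF cred_refl])

text \<open>Contractions are listed before the \<open>refl\<close> fallbacks. General reflexivity is
  absent, so reducts are computed down to the variables; \<open>vred_refl\<close> and
  \<open>cred_refl\<close> are added only where opaque terms occur. Premises such as
  \<open>inst1 M W = M'\<close> leave the actual substitution to the simplifier.\<close>

lemmas red_intros = vred_Var vred_Tuple list_all2_Nil[THEN iffD2, OF refl] list_all2_Cons[THEN iffD2, OF conjI]
  red_ap red_thunk vred_Lam red_Proj red_proj_0 red_proj_1 red_proj_refl
  red_App red_app_Lam red_app_refl red_run red_run_thunk red_run_refl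
  cred_Return cred_Op
  red_LetIn red_let_Return red_let_LetIn red_let_other red_let'_eta red_let'_refl
  red_Handle red_handle_Return red_handle_LetIn red_handle_other red_proj_handler

section \<open>The syntactic model\<close>

text \<open>Source and target are stored with the class because \<open>compose\<close> and
  \<open>T_mor\<close> receive no objects and have to read them off their arguments.\<close>

definition mor :: "'op ty \<Rightarrow> 'op ty \<Rightarrow> 'op val \<Rightarrow> 'op ty \<times> 'op ty \<times> 'op val set" where
  "mor X Y V = (X, Y, {W. val_eq [X] V W Y})"

definition mor_term :: "'op ty \<times> 'op ty \<times> 'op val set \<Rightarrow> 'op val" where
  "mor_term f = (SOME V. V \<in> snd (snd f))"

definition Tty :: "'op sgn \<Rightarrow> 'op ty \<Rightarrow> 'op ty" where
  "Tty S X = TFun (TProd []) (Eff X S)"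

text \<open>The superfluous argument \<open>Y\<close> makes typing of composites syntax-directed.\<close>

definition comp_tm :: "'op ty \<Rightarrow> 'op val \<Rightarrow> 'op val \<Rightarrow> 'op val" where
  "comp_tm Y G F = ap G F"

definition map_tm :: "'op val \<Rightarrow> 'op val" where
  "map_tm F = thunk (LetIn (run (Var 0)) (Return (ap F (Var 0))))"

definition unit_tm :: "'op val" where
  "unit_tm = thunk (Return (Var 0))"

definition mult_tm :: "'op val" where
  "mult_tm = thunk (LetIn (run (Var 0)) (run (Var 0)))"

definition st_tm :: "'op val" where
  "st_tm = thunk (LetIn (run (Proj (Suc 0) (Var 0))) (Return (Tuple [Proj 0 (Var (Suc 0)), Var 0])))"

definition cur_tm :: "'op val \<Rightarrow> 'op val" where
  "cur_tm F = Lam (run (ap F (Tuple [Var (Suc 0), Var 0])))"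

definition uncur_tm :: "'op val \<Rightarrow> 'op val" where
  "uncur_tm F = thunk (App (ap F (Proj 0 (Var 0))) (Proj (Suc 0) (Var 0)))"

definition op_tm :: "'op \<Rightarrow> 'op val" where
  "op_tm oper = thunk (Op oper (Var 0))"

text \<open>The handled computation returns a thunk of the target monad, so the return clause merely
  forces it.\<close>

definition handle_tm :: "('op, 'a) fmap \<Rightarrow> 'op val" where
  "handle_tm S = thunk (Handle (run (Proj (Suc 0) (Var 0))) (proj_handler S (Proj 0 (Var 0))) (run (Var 0)))"

text \<open>Together with \<open>clauses_ty\<close> an explicit form of \<open>clause_obj\<close>
  and \<open>hobj\<close> for the structure \<open>syn\<close>; it has to precede
  \<open>syn\<close>, whose field \<open>hndl\<close> mentions these objects.\<close>

definition clause_ty :: "'op sgn \<Rightarrow> 'op ty \<Rightarrow> 'op ty \<times> 'op ty \<Rightarrow> 'op ty" where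
  "clause_ty S' X = (\<lambda>(A, B). TFun (TProd [A, TFun B (Eff X S')]) (Eff X S'))"

definition clauses_ty :: "'op sgn \<Rightarrow> 'op sgn \<Rightarrow> 'op ty \<Rightarrow> 'op ty" where
  "clauses_ty S S' X = TProd (map (\<lambda>oper. clause_ty S' X (the (fmlookup S oper))) (enum_ops (fmdom S)))"

text \<open>With types as objects, a semantic signature is literally a signature of the calculus, so
  \<open>S\<close> serves as an effect annotation without translation. The fields that take
  morphisms work on representatives chosen by \<open>mor_term\<close>; congruence lemmas later
  remove the dependence on the choice.\<close>

definition syn :: "'op syn_structure" where
  "syn = \<lparr>
     obj = UNIV,
     hom = (\<lambda>X Y. {mor X Y V |V. val_typed [X] V Y}),
     idm = (\<lambda>X. mor X X (Var 0)),
     compose = (\<lambda>g f. mor (fst f) (fst (snd g)) (comp_tm (fst g) (mor_term g) (mor_term f))),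
     prd = TProd,
     prj = (\<lambda>Ys i. mor (TProd Ys) (Ys ! i) (Proj i (Var 0))),
     T_ob = Tty,
     T_mor = (\<lambda>S f. mor (Tty S (fst f)) (Tty S (fst (snd f))) (map_tm (mor_term f))),
     T_unit = (\<lambda>S X. mor X (Tty S X) unit_tm),
     T_mult = (\<lambda>S X. mor (Tty S (Tty S X)) (Tty S X) mult_tm),
     T_st = (\<lambda>S X Y. mor (TProd [X, Tty S Y]) (Tty S (TProd [X, Y])) st_tm),
     kexp = (\<lambda>S Y Z. TFun Y (Eff Z S)),
     cur = (\<lambda>S X Y Z f. mor X (TFun Y (Eff Z S)) (cur_tm (mor_term f))),
     opm = (\<lambda>S oper. case the (fmlookup S oper) of (A, B) \<Rightarrow> mor A (Tty S B) (op_tm oper)),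
     hndl = (\<lambda>S S' X. mor (TProd [clauses_ty S S' X, Tty S (Tty S' X)]) (Tty S' X) (handle_tm S)) \<rparr>"

section \<open>Morphisms as equality classes\<close>

lemma morI: "val_eq [X] V W Y \<Longrightarrow> mor X Y V = mor X Y W"
  unfolding mor_def by (auto intro: veq_trans veq_sym)

text \<open>Typing one representative suffices: \<open>W\<close> then lies in its own class, hence
  in that of \<open>V\<close>, which is the equation sought.\<close>

lemma mor_eq_iff: "val_typed [X] W Y \<Longrightarrow> mor X Y V = mor X Y W \<longleftrightarrow> val_eq [X] V W Y"
  using morI[of X V W Y] by (auto simp: mor_def set_eq_iff intro: veq_refl)

lemma fst_mor [simp]: "fst (mor X Y V) = X" "fst (snd (mor X Y V)) = Y"
  by (simp_all add: mor_def)

lemma mor_term: "val_typed [X] V Y \<Longrightarrow> val_eq [X] (mor_term (mor X Y V)) V Y"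
  unfolding mor_term_def mor_def
  by (rule veq_sym) (auto intro!: someI[where P = "\<lambda>W. val_eq [X] V W Y"] veq_refl)

lemma syn_simps [simp]:
  "obj syn = UNIV"
  "idm syn X = mor X X (Var 0)"
  "prd syn = TProd"
  "prj syn Ys i = mor (TProd Ys) (Ys ! i) (Proj i (Var 0))"
  "T_ob syn = Tty"
  "T_unit syn S X = mor X (Tty S X) unit_tm"
  "T_mult syn S X = mor (Tty S (Tty S X)) (Tty S X) mult_tm"
  "T_st syn S X Y = mor (TProd [X, Tty S Y]) (Tty S (TProd [X, Y])) st_tm"
  "kexp syn S Y Z = TFun Y (Eff Z S)"
  "hndl syn S S' X = mor (TProd [clauses_ty S S' X, Tty S (Tty S' X)]) (Tty S' X) (handle_tm S)"
  "fmlookup S oper = Some (A, B) \<Longrightarrow> opm syn S oper = mor A (Tty S B) (op_tm oper)"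
  "ssgns syn = UNIV"
  by (simp_all add: syn_def ssgns_def)

lemma syn_hom: "hom syn X Y = {mor X Y V |V. val_typed [X] V Y}"
  by (simp add: syn_def)

lemma syn_homE:
  assumes "f \<in> hom syn X Y"
  obtains V where "f = mor X Y V" "val_typed [X] V Y"
  using assms by (auto simp: syn_hom)

lemma syn_homI [simp]: "val_typed [X] V Y \<Longrightarrow> mor X Y V \<in> hom syn X Y"
  by (auto simp: syn_hom)

lemma syn_obj_simps [simp]:
  "binprod syn X Y = TProd [X, Y]"
  "p1 syn X Y = mor (TProd [X, Y]) X (Proj 0 (Var 0))"
  "p2 syn X Y = mor (TProd [X, Y]) Y (Proj (Suc 0) (Var 0))"
  "clause_obj syn S' X = clause_ty S' X"
  "hobj syn S S' X = clauses_ty S S' X"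
  by (simp_all add: binprod_def p1_def p2_def clause_obj_def clause_ty_def hobj_def clauses_ty_def
      clause_objs_def fun_eq_iff)

lemma enum_ops: "distinct (enum_ops D)" "set (enum_ops D) = fset D"
proof -
  have "\<exists>xs. distinct xs \<and> set xs = fset D"
    using finite_distinct_list[OF finite_fset[of D]] by blast
  from someI_ex[OF this] show "distinct (enum_ops D)" "set (enum_ops D) = fset D"
    by (auto simp: enum_ops_def)
qed

lemma op_index_nth:
  "i < length (enum_ops (fmdom S)) \<Longrightarrow> op_index S (enum_ops (fmdom S) ! i) = i"
  unfolding op_index_def using enum_ops(1)[of "fmdom S"]
  by (intro the_equality) (auto simp: nth_eq_iff_index_eq)

lemma op_index:
  assumes "fmlookup S oper = Some AB"
  shows "op_index S oper < length (enum_ops (fmdom S))" "enum_ops (fmdom S) ! op_index S oper = oper"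
proof -
  have "oper \<in> set (enum_ops (fmdom S))"
    using assms by (simp add: enum_ops fmdomI)
  then obtain i where "i < length (enum_ops (fmdom S))" "enum_ops (fmdom S) ! i = oper"
    by (auto simp: in_set_conv_nth)
  then show "op_index S oper < length (enum_ops (fmdom S))" "enum_ops (fmdom S) ! op_index S oper = oper"
    using op_index_nth[of i S] by auto
qed

section \<open>Typing of the terms that represent the structure\<close>

lemma comp_tm_typed [simp]:
  "val_typed [Y] G Z \<Longrightarrow> val_typed \<Gamma> F Y \<Longrightarrow> val_typed \<Gamma> (comp_tm Y G F) Z"
  unfolding comp_tm_def by (rule ap_typed)

lemma pair_typed [simp]:
  "val_typed \<Gamma> V A \<Longrightarrow> val_typed \<Gamma> W B \<Longrightarrow> val_typed \<Gamma> (Tuple [V, W]) (TProd [A, B])"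
  by (rule ty_Tuple) (auto simp: less_Suc_eq_0_disj)

lemma Var0_typed [simp]: "val_typed (X # \<Gamma>) (Var 0) X"
  by (rule ty_VarI) auto

lemma Var1_typed [simp]: "val_typed (Y # X # \<Gamma>) (Var (Suc 0)) X"
  by (rule ty_VarI) auto

lemma Proj_Var0_typed [simp]:
  "i < length Ys \<Longrightarrow> Ys ! i = Y \<Longrightarrow> val_typed (TProd Ys # \<Gamma>) (Proj i (Var 0)) Y"
  by (rule ty_ProjI) auto

lemma run_typed_Tty: "val_typed \<Gamma> V (Tty S X) \<Longrightarrow> cmp_typed \<Gamma> (run V) (Eff X S)"
  unfolding Tty_def by (rule run_typed)

lemma thunk_typed_Tty: "cmp_typed \<Gamma> M (Eff X S) \<Longrightarrow> val_typed \<Gamma> (thunk M) (Tty S X)"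
  unfolding Tty_def by (rule thunk_typed)

lemma map_tm_typed [simp]: "val_typed [X] F Y \<Longrightarrow> val_typed [Tty S X] (map_tm F) (Tty S Y)"
  unfolding map_tm_def
  by (rule thunk_typed_Tty, rule ty_LetIn, rule run_typed_Tty, rule Var0_typed, rule ty_Return,
      erule ap_typed, rule Var0_typed)

lemma unit_tm_typed [simp]: "val_typed [X] unit_tm (Tty S X)"
  unfolding unit_tm_def by (auto intro!: thunk_typed_Tty ty_Return)

lemma mult_tm_typed [simp]: "val_typed [Tty S (Tty S X)] mult_tm (Tty S X)"
  unfolding mult_tm_def
  by (rule thunk_typed_Tty, rule ty_LetIn, (rule run_typed_Tty, rule Var0_typed)+)

lemma st_tm_typed [simp]: "val_typed [TProd [X, Tty S Y]] st_tm (Tty S (TProd [X, Y]))"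
  unfolding st_tm_def
  by (rule thunk_typed_Tty, rule ty_LetIn, rule run_typed_Tty, rule Proj_Var0_typed)
    (auto intro!: ty_Return pair_typed ty_ProjI[of _ _ "[X, Tty S Y]"])

lemma cur_tm_typed [simp]:
  "val_typed [TProd [X, Y]] F (Tty S Z) \<Longrightarrow> val_typed [X] (cur_tm F) (TFun Y (Eff Z S))"
  unfolding cur_tm_def by (rule ty_Lam, rule run_typed_Tty, erule ap_typed) simp

lemma uncur_tm_typed [simp]:
  "val_typed [X] F (TFun Y (Eff Z S)) \<Longrightarrow> val_typed [TProd [X, Y]] (uncur_tm F) (Tty S Z)"
  unfolding uncur_tm_def by (rule thunk_typed_Tty, rule ty_App, erule ap_typed) simp_all

lemma op_tm_typed [simp]:
  "fmlookup S oper = Some (A, B) \<Longrightarrow> val_typed [A] (op_tm oper) (Tty S B)"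
  unfolding op_tm_def by (rule thunk_typed_Tty, erule ty_Op) simp

lemma proj_handler_typed:
  assumes "val_typed \<Gamma> h (clauses_ty S S' X)"
  shows "handler_typed \<Gamma> (proj_handler S h) S (Eff X S')"
proof (rule ty_handler)
  fix oper A B M
  assume S: "fmlookup S oper = Some (A, B)" and M: "fmlookup (proj_handler S h) oper = Some M"
  let ?\<Delta> = "TFun B (Eff X S') # A # \<Gamma>"
  have "val_typed ?\<Delta> (ren_val h (\<lambda>n. Suc (Suc n))) (clauses_ty S S' X)"
    by (rule typed_ren(1)[OF assms]) (simp add: ren_typed_def)
  then have "val_typed ?\<Delta> (Proj (op_index S oper) (ren_val h (\<lambda>n. Suc (Suc n))))
      (TFun (TProd [A, TFun B (Eff X S')]) (Eff X S'))"
    unfolding clauses_ty_def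
    by (rule ty_ProjI) (use op_index[OF S] S in \<open>auto simp: clause_ty_def\<close>)
  with M S show "cmp_typed ?\<Delta> M (Eff X S')"
    by (auto intro!: ty_App)
qed simp

lemma handle_tm_typed [simp]:
  "val_typed [TProd [clauses_ty S S' X, Tty S (Tty S' X)]] (handle_tm S) (Tty S' X)"
  unfolding handle_tm_def
  by (rule thunk_typed_Tty, rule ty_Handle, rule run_typed_Tty, rule Proj_Var0_typed)
    (auto intro!: proj_handler_typed run_typed_Tty)

text \<open>The representatives picked by \<open>compose\<close> are derivably equal to the given
  terms, and \<open>ap\<close> respects equality in both arguments.\<close>

lemma syn_comp [simp]:
  assumes "val_typed [Y] G Z" "val_typed [X] F Y"
  shows "compose syn (mor Y Z G) (mor X Y F) = mor X Z (comp_tm Y G F)"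
  using mor_term[OF assms(1)] mor_term[OF assms(2)]
  by (auto simp: syn_def comp_tm_def intro!: morI ap_eq)

lemma map_tm_eq: "val_eq [X] F G Y \<Longrightarrow> val_eq [Tty S X] (map_tm F) (map_tm G) (Tty S Y)"
  unfolding map_tm_def Tty_def
  by (rule thunk_eq, rule cong_LetIn, rule ceq_refl, rule run_typed, rule Var0_typed, rule cong_Return,
      erule ap_eq, rule veq_refl, rule Var0_typed)

lemma cur_tm_eq: "val_eq [TProd [X, Y]] F G (Tty S Z) \<Longrightarrow> val_eq [X] (cur_tm F) (cur_tm G) (TFun Y (Eff Z S))"
  unfolding cur_tm_def Tty_def
  by (rule cong_Lam, rule run_eq, erule ap_eq, rule veq_refl, simp)

lemma uncur_tm_eq: "val_eq [X] F G (TFun Y (Eff Z S)) \<Longrightarrow> val_eq [TProd [X, Y]] (uncur_tm F) (uncur_tm G) (Tty S Z)"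
  unfolding uncur_tm_def Tty_def
  by (rule thunk_eq, rule cong_App, erule ap_eq; rule veq_refl, simp)

lemma syn_T_mor [simp]:
  "val_typed [X] F Y \<Longrightarrow> T_mor syn S (mor X Y F) = mor (Tty S X) (Tty S Y) (map_tm F)"
  by (auto simp: syn_def intro!: morI map_tm_eq mor_term)

lemma syn_cur [simp]:
  "val_typed [TProd [X, Y]] F (Tty S Z)
   \<Longrightarrow> cur syn S X Y Z (mor (TProd [X, Y]) (Tty S Z) F) = mor X (TFun Y (Eff Z S)) (cur_tm F)"
  by (auto simp: syn_def intro!: morI cur_tm_eq mor_term)

text \<open>The projections of a tuple are given by \<beta>, uniqueness by \<eta> for products. The
  equivalence form serves twice: for the unique existence in the product axiom and for the definite
  description behind \<open>tuple\<close>.\<close>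

lemma syn_prd_universal:
  assumes len: "length fs = length Ys" "length Vs = length Ys"
    and fs: "\<And>i. i < length Ys \<Longrightarrow> fs ! i = mor X (Ys ! i) (Vs ! i)"
    and Vs: "\<And>i. i < length Ys \<Longrightarrow> val_typed [X] (Vs ! i) (Ys ! i)"
  shows "h \<in> hom syn X (prd syn Ys) \<and> (\<forall>i<length Ys. compose syn (prj syn Ys i) h = fs ! i)
    \<longleftrightarrow> h = mor X (TProd Ys) (Tuple Vs)"
proof (intro iffI conjI allI impI)
  assume h: "h \<in> hom syn X (prd syn Ys) \<and> (\<forall>i<length Ys. compose syn (prj syn Ys i) h = fs ! i)"
  then obtain V where V: "h = mor X (TProd Ys) V" "val_typed [X] V (TProd Ys)"
    by (auto elim: syn_homE)
  have eq: "val_eq [X] (Proj i V) (Vs ! i) (Ys ! i)" if "i < length Ys" for i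
  proof -
    have "mor X (Ys ! i) (comp_tm (TProd Ys) (Proj i (Var 0)) V) = mor X (Ys ! i) (Vs ! i)"
      using h V fs[OF that] that by simp
    then show ?thesis using Vs[OF that] by (simp add: mor_eq_iff comp_tm_def)
  qed
  have "val_eq [X] V (Tuple (map (\<lambda>i. Proj i V) [0..<length Ys])) (TProd Ys)"
    by (rule eta_prod[OF V(2)])
  also have "val_eq [X] (Tuple (map (\<lambda>i. Proj i V) [0..<length Ys])) (Tuple Vs) (TProd Ys)"
    by (rule cong_Tuple) (use len eq in auto)
  finally show "h = mor X (TProd Ys) (Tuple Vs)"
    unfolding V(1) by (rule morI)
next
  assume h: "h = mor X (TProd Ys) (Tuple Vs)"
  have T: "val_typed [X] (Tuple Vs) (TProd Ys)"
    by (rule ty_Tuple) (use len Vs in auto)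
  then show "h \<in> hom syn X (prd syn Ys)" using h by simp
  fix i assume i: "i < length Ys"
  show "compose syn (prj syn Ys i) h = fs ! i"
    using h T i by (auto simp: fs comp_tm_def intro!: morI beta_prod simp flip: ap_Tuple)
qed

lemma syn_tuple:
  assumes "length fs = length Ys" "length Vs = length Ys"
    and "\<And>i. i < length Ys \<Longrightarrow> fs ! i = mor X (Ys ! i) (Vs ! i)"
    and "\<And>i. i < length Ys \<Longrightarrow> val_typed [X] (Vs ! i) (Ys ! i)"
  shows "tuple syn X Ys fs = mor X (TProd Ys) (Tuple Vs)"
  unfolding tuple_def using syn_prd_universal[OF assms] by simp

lemma syn_pair [simp]:
  assumes "val_typed [X] V Y" "val_typed [X] W Z"
  shows "pair syn X Y Z (mor X Y V) (mor X Z W) = mor X (TProd [Y, Z]) (Tuple [V, W])"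
  unfolding pair_def by (rule syn_tuple) (use assms in \<open>auto simp: less_Suc_eq_0_disj\<close>)

section \<open>Verification of the model axioms\<close>

lemmas syn_defs = pmap_def swap_def assocr_def assocl_def Let_def
lemmas tm_defs = comp_tm_def map_tm_def unit_tm_def mult_tm_def st_tm_def cur_tm_def uncur_tm_def
  op_tm_def handle_tm_def

text \<open>Typing is checked on \<open>V\<close> and \<open>W\<close> as they come from the model,
  where \<open>comp_tm\<close> still records the intermediate objects; the primed terms are what
  unfolding makes of them, and these are reduced.\<close>

lemma red_mor:
  assumes "val_typed [X] V Y" "val_typed [X] W Y" "V = V'" "W = W'" "vred V' U" "vred W' U'" "U = U'"
  shows "mor X Y V = mor X Y W"
  using assms by (auto intro!: morI red_joinV)

lemma syn_cartesian: "cartesian_category syn"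
proof
  fix X Y f assume "f \<in> hom syn X Y"
  then obtain V where V: "f = mor X Y V" "val_typed [X] V Y" by (rule syn_homE)
  then show "compose syn (idm syn Y) f = f" "compose syn f (idm syn X) = f"
    by (auto simp: comp_tm_def intro!: morI ap_Var_right)
next
  fix X Y Z W f g h assume "f \<in> hom syn X Y" "g \<in> hom syn Y Z" "h \<in> hom syn Z W"
  then show "compose syn (compose syn h g) f = compose syn h (compose syn g f)"
    by (elim syn_homE) (simp, simp add: comp_tm_def)
next
  fix X Ys fs assume fs: "length fs = length Ys" "\<And>i. i < length Ys \<Longrightarrow> fs ! i \<in> hom syn X (Ys ! i)"
  then have "\<forall>i. \<exists>V. i < length Ys \<longrightarrow> fs ! i = mor X (Ys ! i) V \<and> val_typed [X] V (Ys ! i)"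
    by (meson syn_homE)
  then obtain F where F: "\<And>i. i < length Ys \<Longrightarrow> fs ! i = mor X (Ys ! i) (F i) \<and> val_typed [X] (F i) (Ys ! i)"
    by metis
  show "\<exists>!h. h \<in> hom syn X (prd syn Ys) \<and> (\<forall>i<length Ys. compose syn (prj syn Ys i) h = fs ! i)"
    by (subst syn_prd_universal[of fs Ys "map F [0..<length Ys]"]) (use fs F in auto)
qed (auto elim!: syn_homE)

lemmas red_simps = tm_defs inst1_def sub_simps

text \<open>Functor and composition produce the representative as \<open>ap V (Var 0)\<close> in
  some places and as \<open>V\<close> in others. Starting from this form, it always occurs as the
  first argument of \<open>ap\<close>, and the two reducts can agree literally.\<close>

lemma syn_homE':
  assumes "f \<in> hom syn X Y"
  obtains V where "f = mor X Y (comp_tm X V (Var 0))" "val_typed [X] V Y"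
proof -
  from assms obtain V where V: "f = mor X Y V" "val_typed [X] V Y" by (rule syn_homE)
  have "mor X Y V = mor X Y (comp_tm X V (Var 0))"
    unfolding comp_tm_def by (rule morI, rule veq_sym, rule ap_Var_right[OF V(2)])
  with V that show ?thesis by simp
qed

text \<open>For laws in which one side \<open>W\<close> is a variable or a projection: the other
  side reduces to a thunk, and \<open>thunk_run\<close> supplies the missing \<eta> step.\<close>

lemma red_mor_run:
  assumes "val_typed [X] V (Tty S Y)" "val_typed [X] W (Tty S Y)" "V = V'" "vred V' U" "U = thunk (run W)"
  shows "mor X (Tty S Y) V = mor X (Tty S Y) W"
proof (rule morI)
  have "val_eq [X] V U (Tty S Y)"
    using assms(1,3,4) by (simp add: red_eq)
  also have "val_eq [X] U W (Tty S Y)"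
    using assms(2,5) by (simp add: Tty_def thunk_run)
  finally show "val_eq [X] V W (Tty S Y)" .
qed

lemma pair_eta:
  "val_typed \<Gamma> V (TProd [X, Y]) \<Longrightarrow> val_eq \<Gamma> (Tuple [Proj 0 V, Proj (Suc 0) V]) V (TProd [X, Y])"
  using eta_prod[of \<Gamma> V "[X, Y]"] by (auto intro: veq_sym)

lemma syn_strong_monads: "strong_monads (syn :: 'op syn_structure)"
proof (intro strong_monads.intro syn_cartesian strong_monads_axioms.intro)
  fix S :: "'op sgn" and X :: "'op ty"
  show "compose syn (T_mor syn S (p2 syn (prd syn []) X)) (T_st syn S (prd syn []) X)
      = p2 syn (prd syn []) (T_ob syn S X)"
    by (simp, rule red_mor_run, simp, simp, (simp add: red_simps; fail),
        (rule red_intros | (simp add: red_simps; fail))+)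
  show "T_mor syn S (idm syn X) = idm syn (T_ob syn S X)"
    by (simp, rule red_mor_run, simp, simp, (simp add: red_simps; fail),
        (rule red_intros | (simp add: red_simps; fail))+)
  show "compose syn (T_mult syn S X) (T_unit syn S (T_ob syn S X)) = idm syn (T_ob syn S X)"
    by (simp, rule red_mor_run, simp, simp, (simp add: red_simps; fail),
        (rule red_intros | (simp add: red_simps; fail))+)
  show "compose syn (T_mult syn S X) (T_mor syn S (T_unit syn S X)) = idm syn (T_ob syn S X)"
    by (simp, rule red_mor_run, simp, simp, (simp add: red_simps; fail),
        (rule red_intros | (simp add: red_simps; fail))+)
next
  fix S :: "'op sgn" and X Y Z :: "'op ty" and f g
    assume "f \<in> hom syn X Y" "g \<in> hom syn Y Z"
  then show "T_mor syn S (compose syn g f) = compose syn (T_mor syn S g) (T_mor syn S f)"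
    by (elim syn_homE', simp add: syn_defs)
     (rule red_mor, (simp; fail), (simp; fail),
      (simp add: red_simps; fail), (simp add: red_simps; fail),
      (rule red_intros | (simp add: red_simps; fail))+)
next
  fix S :: "'op sgn" and X Y :: "'op ty" and f
    assume "f \<in> hom syn X Y"
  then show "compose syn (T_mor syn S f) (T_unit syn S X) = compose syn (T_unit syn S Y) f"
    by (elim syn_homE', simp add: syn_defs)
     (rule red_mor, (simp; fail), (simp; fail),
      (simp add: red_simps; fail), (simp add: red_simps; fail),
      (rule red_intros | (simp add: red_simps; fail))+)
next
  fix S :: "'op sgn" and X Y :: "'op ty" and f
    assume "f \<in> hom syn X Y"
  then show "compose syn (T_mor syn S f) (T_mult syn S X)
      = compose syn (T_mult syn S Y) (T_mor syn S (T_mor syn S f))"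
    by (elim syn_homE', simp add: syn_defs)
     (rule red_mor, (simp; fail), (simp; fail),
      (simp add: red_simps; fail), (simp add: red_simps; fail),
      (rule red_intros | (simp add: red_simps; fail))+)
next
  fix S :: "'op sgn" and X :: "'op ty"
  show "compose syn (T_mult syn S X) (T_mult syn S (T_ob syn S X))
      = compose syn (T_mult syn S X) (T_mor syn S (T_mult syn S X))"
    by (simp add: syn_defs)
     (rule red_mor, (simp; fail), (simp; fail),
      (simp add: red_simps; fail), (simp add: red_simps; fail),
      (rule red_intros | (simp add: red_simps; fail))+)
next
  fix S :: "'op sgn" and X Y X' Y' :: "'op ty" and f g
    assume "f \<in> hom syn X X'" "g \<in> hom syn Y Y'"
  then show "compose syn (T_mor syn S (pmap syn X Y X' Y' f g)) (T_st syn S X Y)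
      = compose syn (T_st syn S X' Y') (pmap syn X (T_ob syn S Y) X' (T_ob syn S Y') f (T_mor syn S g))"
    by (elim syn_homE', simp add: syn_defs)
     (rule red_mor, (simp; fail), (simp; fail),
      (simp add: red_simps; fail), (simp add: red_simps; fail),
      (rule red_intros | (simp add: red_simps; fail))+)
next
  fix S :: "'op sgn" and X Y Z :: "'op ty"
  show "compose syn (T_mor syn S (assocr syn X Y Z)) (T_st syn S (binprod syn X Y) Z)
      = compose syn (T_st syn S X (binprod syn Y Z))
          (compose syn (pmap syn X (binprod syn Y (T_ob syn S Z)) X (T_ob syn S (binprod syn Y Z))
            (idm syn X) (T_st syn S Y Z))
          (assocr syn X Y (T_ob syn S Z)))"
    by (simp add: syn_defs)
     (rule red_mor, (simp; fail), (simp; fail),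
      (simp add: red_simps; fail), (simp add: red_simps; fail),
      (rule red_intros | (simp add: red_simps; fail))+)
next
  fix S :: "'op sgn" and X Y :: "'op ty"
  show "compose syn (T_st syn S X Y) (pmap syn X Y X (T_ob syn S Y) (idm syn X) (T_unit syn S Y))
      = T_unit syn S (binprod syn X Y)" (is "?l = ?r")
  proof -
    \<comment> \<open>Reduction rebuilds the variable from its two projections; surjective pairing,
      which is not a reduction, closes the gap.\<close>
    let ?V = "Tuple [Proj 0 (Var 0), Proj (Suc 0) (Var 0)] :: 'op val"
    have "?l = mor (TProd [X, Y]) (Tty S (TProd [X, Y])) (thunk (Return ?V))"
      by (simp add: syn_defs) (rule red_mor, (simp; fail), (simp add: thunk_typed_Tty ty_Return; fail),
        (simp add: red_simps; fail), (simp add: red_simps; fail),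
        (rule red_intros | (simp add: red_simps; fail))+)
    also have "\<dots> = ?r"
      by (auto simp: unit_tm_def Tty_def intro!: morI thunk_eq cong_Return pair_eta)
    finally show ?thesis .
  qed
next
  fix S :: "'op sgn" and X Y :: "'op ty"
  show "compose syn (T_st syn S X Y)
        (pmap syn X (T_ob syn S (T_ob syn S Y)) X (T_ob syn S Y) (idm syn X) (T_mult syn S Y))
      = compose syn (T_mult syn S (binprod syn X Y))
          (compose syn (T_mor syn S (T_st syn S X Y)) (T_st syn S X (T_ob syn S Y)))"
    by (simp add: syn_defs)
     (rule red_mor, (simp; fail), (simp; fail),
      (simp add: red_simps; fail), (simp add: red_simps; fail),
      (rule red_intros | (simp add: red_simps; fail))+)
qed (auto elim!: syn_homE)

text \<open>Reduction cancels the thunk and leaves the function \<eta>-expansion of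
  \<open>ap F (Var 0)\<close>.\<close>

lemma syn_curE:
  assumes "val_typed [X] F (TFun Y (Eff Z S))"
  shows "val_eq [X] (cur_tm (uncur_tm F)) F (TFun Y (Eff Z S))"
proof -
  have "val_eq [X] (cur_tm (uncur_tm F)) (Lam (App (ren_val (ap F (Var 0)) Suc) (Var 0))) (TFun Y (Eff Z S))"
    by (rule red_eq, (simp add: red_simps, (rule red_intros)+), simp add: assms)
  also have "val_eq [X] (Lam (App (ren_val (ap F (Var 0)) Suc) (Var 0))) (ap F (Var 0)) (TFun Y (Eff Z S))"
    by (rule veq_sym, rule eta_fun, rule ap_typed[OF assms]) simp
  also have "val_eq [X] (ap F (Var 0)) F (TFun Y (Eff Z S))"
    by (rule ap_Var_right[OF assms])
  finally show ?thesis .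
qed

text \<open>After reduction, \<open>F\<close> is applied to the pair of the two projections, and the
  result is forced and suspended again; the \<eta> laws of thunks and of pairs remove these two
  layers.\<close>

lemma syn_uncurE:
  assumes "val_typed [TProd [X, Y]] F (Tty S Z)"
  shows "val_eq [TProd [X, Y]] (uncur_tm (cur_tm F)) F (Tty S Z)"
proof -
  have "val_eq [TProd [X, Y]] (uncur_tm (cur_tm F))
     (thunk (run (ap F (Tuple [Proj 0 (Var 0), Proj (Suc 0) (Var 0)])))) (Tty S Z)"
    by (rule red_eq, (simp add: red_simps, (rule red_intros | (simp add: red_simps; fail))+),
        simp add: assms)
  also have "val_eq [TProd [X, Y]] (thunk (run (ap F (Tuple [Proj 0 (Var 0), Proj (Suc 0) (Var 0)]))))
      (ap F (Tuple [Proj 0 (Var 0), Proj (Suc 0) (Var 0)])) (Tty S Z)"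
    unfolding Tty_def by (rule thunk_run, rule ap_typed[OF assms[unfolded Tty_def]]) simp
  also have "val_eq [TProd [X, Y]] (ap F (Tuple [Proj 0 (Var 0), Proj (Suc 0) (Var 0)]))
     (ap F (Var 0)) (Tty S Z)"
    by (rule ap_cong_typed[OF assms], rule pair_eta) simp
  also have "val_eq [TProd [X, Y]] (ap F (Var 0)) F (Tty S Z)"
    by (rule ap_Var_right[OF assms])
  finally show ?thesis .
qed

lemma syn_cur_bij:
  "bij_betw (cur syn S X Y Z) (hom syn (TProd [X, Y]) (Tty S Z)) (hom syn X (TFun Y (Eff Z S)))"
proof -
  let ?f = "cur syn S X Y Z" and ?g = "\<lambda>f. mor (TProd [X, Y]) (Tty S Z) (uncur_tm (mor_term f))"
  have g: "?g (mor X (TFun Y (Eff Z S)) F) = mor (TProd [X, Y]) (Tty S Z) (uncur_tm F)"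
    if "val_typed [X] F (TFun Y (Eff Z S))" for F
    by (intro morI uncur_tm_eq mor_term that)
  show ?thesis
  proof (rule bij_betw_byWitness[where f' = ?g]; (rule ballI | rule image_subsetI))
    show "?g (?f f) = f" if "f \<in> hom syn (TProd [X, Y]) (Tty S Z)" for f
      using that by (rule syn_homE) (simp add: g mor_eq_iff syn_uncurE)
    show "?f (?g f) = f" if "f \<in> hom syn X (TFun Y (Eff Z S))" for f
      using that by (rule syn_homE) (simp add: g mor_eq_iff syn_curE)
    show "?f f \<in> hom syn X (TFun Y (Eff Z S))" if "f \<in> hom syn (TProd [X, Y]) (Tty S Z)" for f
      using that by (rule syn_homE) simp
    show "?g f \<in> hom syn (TProd [X, Y]) (Tty S Z)" if "f \<in> hom syn X (TFun Y (Eff Z S))" for f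
      using that by (rule syn_homE) (simp add: g)
  qed
qed

text \<open>\<open>ev\<close> is the preimage of the identity under \<open>cur\<close>; by
  injectivity it is enough to exhibit one preimage, the uncurried identity.\<close>

lemma syn_ev [simp]:
  "ev syn S Y Z = mor (TProd [TFun Y (Eff Z S), Y]) (Tty S Z) (uncur_tm (Var 0))"
proof -
  have "inv_into (hom syn (TProd [TFun Y (Eff Z S), Y]) (Tty S Z)) (cur syn S (TFun Y (Eff Z S)) Y Z)
      (mor (TFun Y (Eff Z S)) (TFun Y (Eff Z S)) (Var 0))
     = mor (TProd [TFun Y (Eff Z S), Y]) (Tty S Z) (uncur_tm (Var 0))"
    by (rule inv_into_f_eq[OF bij_betw_imp_inj_on[OF syn_cur_bij]])
      (auto intro!: morI syn_curE)
  then show ?thesis by (simp add: ev_def)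
qed

lemma syn_kleisli: "kleisli_exponentials syn"
proof (intro kleisli_exponentials.intro syn_strong_monads kleisli_exponentials_axioms.intro)
  show "bij_betw (cur syn S X Y Z) (hom syn (binprod syn X Y) (T_ob syn S Z)) (hom syn X (kexp syn S Y Z))"
    for S X Y Z
    using syn_cur_bij by simp
  fix S X X' Y Z f h
  assume "f \<in> hom syn (binprod syn X Y) (T_ob syn S Z)" "h \<in> hom syn X' X"
  then show "cur syn S X' Y Z (compose syn f (pmap syn X' Y X Y h (idm syn Y)))
     = compose syn (cur syn S X Y Z f) h"
    by (elim syn_homE', simp add: syn_defs) (rule red_mor, (simp; fail), (simp; fail),
      (simp add: red_simps; fail), (simp add: red_simps; fail),
      (rule red_intros | (simp add: red_simps; fail))+)
qed simp

lemma syn_model: "leff_model (syn :: 'op syn_structure)"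
proof (intro leff_model.intro syn_kleisli leff_model_axioms.intro)
  fix S S' :: "'op sgn" and X :: "'op ty"
  show "let H = hobj syn S S' X; Y = T_ob syn S' X in
     compose syn (hndl syn S S' X) (pmap syn H Y H (T_ob syn S Y) (idm syn H) (T_unit syn S Y)) = p2 syn H Y"
    by (simp add: syn_defs, rule red_mor_run, simp, simp, (simp add: red_simps; fail),
        (rule red_intros | (simp add: red_simps; fail))+)
  show "let H = hobj syn S S' X; Y = T_ob syn S' X in
            compose syn (hndl syn S S' X) (pmap syn H (T_ob syn S (T_ob syn S Y)) H (T_ob syn S Y) (idm syn H) (T_mult syn S Y))
          = compose syn (hndl syn S S' X)
            (compose syn (pmap syn H (T_ob syn S (binprod syn H (T_ob syn S Y))) H (T_ob syn S Y) (idm syn H) (T_mor syn S (hndl syn S S' X)))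
            (pair syn (binprod syn H (T_ob syn S (T_ob syn S Y))) H (T_ob syn S (binprod syn H (T_ob syn S Y)))
                (p1 syn H (T_ob syn S (T_ob syn S Y))) (T_st syn S H (T_ob syn S Y))))"
    by (simp add: syn_defs) (rule red_mor, (simp; fail), (simp; fail),
      (simp add: red_simps; fail), (simp add: red_simps; fail),
      (rule red_intros | (simp add: red_simps; fail))+)
  fix i oper A B
  assume "i < length (enum_ops (fmdom S))" "enum_ops (fmdom S) ! i = oper"
    and S: "fmlookup S oper = Some (A, B)"
  \<comment> \<open>The enumeration has no repetitions, so the given position is the one that
    \<open>proj_handler\<close> uses for this operation.\<close>
  then have i: "i = op_index S oper" by (metis op_index_nth)
  have nth: "clause_objs syn S S' X ! i = clause_ty S' X (A, B)" "i < length (clause_objs syn S S' X)"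
    unfolding i using op_index[OF S] S by (simp_all add: clause_objs_def)
  have clauses: "clauses_ty S S' X = TProd (clause_objs syn S S' X)"
    by (simp add: clauses_ty_def clause_objs_def)
  have typed: "val_typed (clauses_ty S S' X # \<Gamma>) (Proj i (Var 0)) (clause_ty S' X (A, B))" for \<Gamma>
    unfolding clauses using nth by simp
  \<comment> \<open>The projection is restated with \<open>clauses_ty\<close> and
    \<open>clause_ty\<close> as its objects, in place of a list product and a list lookup.\<close>
  have prj: "prj syn (clause_objs syn S S' X) i
      = mor (clauses_ty S S' X) (clause_ty S' X (A, B)) (Proj i (Var 0))"
    using nth by (simp add: clauses)
  let ?D = "TProd [clauses_ty S S' X, TProd [A, TFun B (Eff X S')]]"
  let ?h = "Proj 0 (Var 0) :: 'op val" and ?p = "Proj (Suc 0) (Var 0) :: 'op val"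
  let ?k = "Proj (Suc 0) ?p"
  \<comment> \<open>The reduct of the left side: the clause receives the pair of the operation's
    argument and a resumption, and the resumption built by handling is the continuation
    \<open>?k\<close> in \<eta>-expanded form.\<close>
  define U where "U = App (Proj i ?h) (Tuple [Proj 0 ?p, Lam (App (ren_val ?k Suc) (Var 0))])"
  have p: "val_typed [?D] ?p (TProd [A, TFun B (Eff X S')])" by simp
  then have k: "val_typed [?D] ?k (TFun B (Eff X S'))"
    by (rule ty_ProjI) simp_all
  have a: "val_typed [?D] (Proj 0 ?p) A"
    using p by (rule ty_ProjI) simp_all
  have h: "val_typed [?D] (Proj i ?h) (TFun (TProd [A, TFun B (Eff X S')]) (Eff X S'))"
    unfolding clauses
    by (rule ty_ProjI[of _ _ "clause_objs syn S S' X"]) (use nth in \<open>simp_all add: clause_ty_def\<close>)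
  have U: "cmp_eq [?D] U (App (Proj i ?h) ?p) (Eff X S')"
    unfolding U_def
  proof (rule cong_App[OF veq_refl[OF h]])
    have "val_eq [?D] (Tuple [Proj 0 ?p, Lam (App (ren_val ?k Suc) (Var 0))]) (Tuple [Proj 0 ?p, ?k])
        (TProd [A, TFun B (Eff X S')])"
      by (rule cong_Tuple)
        (use a veq_sym[OF eta_fun[OF k]] in \<open>auto simp: less_Suc_eq_0_disj intro: veq_refl\<close>)
    also have "val_eq [?D] (Tuple [Proj 0 ?p, ?k]) ?p (TProd [A, TFun B (Eff X S')])"
      by (rule pair_eta[OF p])
    finally show "val_eq [?D] (Tuple [Proj 0 ?p, Lam (App (ren_val ?k Suc) (Var 0))]) ?p
        (TProd [A, TFun B (Eff X S')])" .
  qed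
  \<comment> \<open>Contracting a handled operation is not among \<open>red_intros\<close>; it is
    applied once, after those rules have exposed the operation under the handler.\<close>
  have handle: "cred (Handle (Op oper (Proj 0 ?p)) (proj_handler S ?h) (App (ren_val ?k Suc) (Var 0))) U"
    using cred_handle_op[of "proj_handler S ?h" oper _ "Proj 0 ?p" "App (ren_val ?k Suc) (Var 0)"] S
    by (simp add: U_def inst2_def i)
  show "let H = hobj syn S S' X; AK = binprod syn A (kexp syn S' B X) in
            compose syn (hndl syn S S' X) (pmap syn H AK H (T_ob syn S (T_ob syn S' X)) (idm syn H) (algop syn S S' X oper))
          = compose syn (ev syn S' AK X)
            (pmap syn H AK (clause_obj syn S' X (A, B)) AK (prj syn (clause_objs syn S S' X) i) (idm syn AK))"
    (is "let H = _; AK = _ in ?l H AK = ?r H AK")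
  proof -
    have "?l (hobj syn S S' X) (binprod syn A (kexp syn S' B X)) = mor ?D (Tty S' X) (thunk U)"
      using S eq_typed(2)[OF U]
      by (simp add: syn_defs algop_def) (rule red_mor, (simp; fail), (simp add: thunk_typed_Tty; fail),
         (simp add: red_simps; fail), rule refl, rule red_thunk, rule cred_trans[OF _ handle],
         (simp add: red_simps, (rule red_intros | (simp add: red_simps; fail))+)[1],
         rule vred_refl, rule refl)
    also have "\<dots> = mor ?D (Tty S' X) (thunk (App (Proj i ?h) ?p))"
      unfolding Tty_def by (intro morI thunk_eq U)
    also have "\<dots> = ?r (hobj syn S S' X) (binprod syn A (kexp syn S' B X))"
      using typed eq_typed(2)[OF U]
      by (simp add: syn_defs clause_ty_def prj del: syn_simps(4))
        (rule red_mor, (simp add: thunk_typed_Tty; fail), (simp; fail),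
         rule refl, (simp add: red_simps; fail), rule vred_refl,
         (rule red_intros | (simp add: red_simps; fail))+)
    finally show ?thesis by (simp add: Let_def del: syn_simps(4))
  qed
qed simp_all

section \<open>Interpretation in the syntactic model\<close>

text \<open>Every type former is interpreted by a field of \<open>syn\<close> that is this very type
  former. In the \<open>Eff\<close> case the induction hypotheses cover the argument and result
  types stored in the signature.\<close>

lemma ty_int_syn:
  fixes A :: "'op ty" and C :: "'op cty"
  shows "ty_int syn A = A" "cty_int syn C = (case C of Eff A \<Sigma> \<Rightarrow> (\<Sigma>, A))"
proof (induction A and C rule: ty.induct cty.induct)
  case (TFun A C)
  then show ?case by (cases C) simp
next
  case (TProd As)
  then show ?case by (simp add: map_idI)
next
  case (Eff A \<Sigma>)
  have "fmmap (map_prod (ty_int syn) (ty_int syn)) \<Sigma> = fmmap (\<lambda>AB. AB) \<Sigma>"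
    by (rule handler_map_cong) (use Eff.IH(2,3) in \<open>auto simp: prod_set_simps\<close>)
  then show ?case using Eff.IH(1) by (simp add: fmap.map_ident)
qed

lemma ty_int_syn_simps [simp]:
  "ty_int syn A = A" "map (ty_int syn) As = As"
  by (simp_all add: ty_int_syn map_idI)

declare ty_int.simps [simp del]

lemma sgn_int_syn [simp]: "sgn_int syn \<Sigma> = \<Sigma>"
proof -
  have "cty_int syn (Eff (TProd []) \<Sigma>) = (\<Sigma>, TProd [])"
    by (simp only: ty_int_syn cty.case)
  then show ?thesis by (simp add: sgn_int_def)
qed

text \<open>A context denotes a product nested to the left with the newest variable outermost.
  \<open>ctx_sub V\<close>, read as a substitution, sends a variable to its projection from a value
  \<open>V\<close> of that product.\<close>

fun ctx_sub :: "'op val \<Rightarrow> nat \<Rightarrow> 'op val" where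
  "ctx_sub V 0 = Proj (Suc 0) V"
| "ctx_sub V (Suc i) = ctx_sub (Proj 0 V) i"

lemma sub_ctx_sub [simp]: "sub_val (ctx_sub V i) \<sigma> = ctx_sub (sub_val V \<sigma>) i"
  by (induction V i rule: ctx_sub.induct) simp_all

lemma ren_ctx_sub [simp]: "ren_val (ctx_sub V i) \<xi> = ctx_sub (ren_val V \<xi>) i"
  by (induction V i rule: ctx_sub.induct) simp_all

lemma ap_ctx_sub [simp]: "ap (ctx_sub V i) W = ctx_sub (ap V W) i"
  by (simp add: ap_def)

lemma ctx_sub_eq:
  "val_eq \<Delta> V W (ctx_int syn \<Gamma>) \<Longrightarrow> i < length \<Gamma> \<Longrightarrow> val_eq \<Delta> (ctx_sub V i) (ctx_sub W i) (\<Gamma> ! i)"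
proof (induction \<Gamma> arbitrary: V W i)
  case (Cons A \<Gamma>)
  then have "val_eq \<Delta> (Proj 0 V) (Proj 0 W) (ctx_int syn \<Gamma>)" "val_eq \<Delta> (Proj (Suc 0) V) (Proj (Suc 0) W) A"
    using cong_Proj[of \<Delta> V W "[ctx_int syn \<Gamma>, A]" 0] cong_Proj[of \<Delta> V W "[ctx_int syn \<Gamma>, A]" "Suc 0"]
    by simp_all
  with Cons show ?case by (cases i) auto
qed simp

lemma ctx_sub_typed: "val_typed \<Delta> V (ctx_int syn \<Gamma>) \<Longrightarrow> sub_typed \<Delta> (ctx_sub V) \<Gamma>"
  unfolding sub_typed_def using ctx_sub_eq[OF veq_refl] eq_typed(1) by blast

lemma red_ctx_sub: "vred V W \<Longrightarrow> vred (ctx_sub V i) (ctx_sub W i)"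
  by (induction V i arbitrary: W rule: ctx_sub.induct) (auto intro: vred_Proj)

text \<open>Under a binder the model extends the context value to a pair, whereas the syntax lifts
  the substitution; the two agree by \<beta> for products. An arbitrary \<open>\<sigma>\<close>
  equal to \<open>ctx_sub V\<close> is allowed so that the statement can be iterated.\<close>

lemma ctx_sub_up:
  assumes "val_typed \<Delta> V (ctx_int syn \<Gamma>)" "sub_eq \<Delta> (ctx_sub V) \<sigma> \<Gamma>"
  shows "sub_eq (A # \<Delta>) (ctx_sub (Tuple [ren_val V Suc, Var 0])) (up_sub \<sigma>) (A # \<Gamma>)"
  unfolding sub_eq_def
proof (intro allI impI)
  fix i assume i: "i < length (A # \<Gamma>)"
  have typed: "val_typed (A # \<Delta>) (Tuple [ren_val V Suc, Var 0]) (TProd [ctx_int syn \<Gamma>, A])"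
    using assms(1) by (intro pair_typed typed_weaken) simp_all
  show "val_eq (A # \<Delta>) (ctx_sub (Tuple [ren_val V Suc, Var 0]) i) (up_sub \<sigma> i) ((A # \<Gamma>) ! i)"
  proof (cases i)
    case 0
    then show ?thesis using beta_prod[OF typed, of "Suc 0"] by simp
  next
    case (Suc j)
    then have j: "j < length \<Gamma>" using i by simp
    have "val_eq (A # \<Delta>) (Proj 0 (Tuple [ren_val V Suc, Var 0])) (ren_val V Suc) (ctx_int syn \<Gamma>)"
      using beta_prod[OF typed, of 0] by simp
    then have "val_eq (A # \<Delta>) (ctx_sub (Proj 0 (Tuple [ren_val V Suc, Var 0])) j)
        (ren_val (ctx_sub V j) Suc) (\<Gamma> ! j)"
      using ctx_sub_eq j by simp
    also have "val_eq (A # \<Delta>) (ren_val (ctx_sub V j) Suc) (ren_val (\<sigma> j) Suc) (\<Gamma> ! j)"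
      using assms(2) j by (intro eq_ren(1)[OF _ ren_typed_Suc]) (simp add: sub_eq_def)
    finally show ?thesis using Suc by simp
  qed
qed

lemma sub_eq_refl: "sub_typed \<Delta> \<sigma> \<Gamma> \<Longrightarrow> sub_eq \<Delta> \<sigma> \<sigma> \<Gamma>"
  by (simp add: sub_typed_def sub_eq_def veq_refl)

abbreviation ctx_proj :: "nat \<Rightarrow> 'op val" where
  "ctx_proj \<equiv> ctx_sub (Var 0)"

lemma ctx_proj_typed: "sub_typed [ctx_int syn \<Gamma>] ctx_proj \<Gamma>"
  by (rule ctx_sub_typed) simp

lemma ctx_proj_up:
  "sub_eq [A, ctx_int syn \<Gamma>] (ctx_sub (Tuple [Var (Suc 0), Var 0])) (up_sub ctx_proj) (A # \<Gamma>)"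
  using ctx_sub_up[of "[ctx_int syn \<Gamma>]" "Var 0" \<Gamma> ctx_proj A] ctx_proj_typed[of \<Gamma>]
  by (simp add: sub_eq_refl)

lemma ctx_proj_up_up:
  "sub_eq [B, A, ctx_int syn \<Gamma>] (ctx_sub (Tuple [Tuple [Var (Suc (Suc 0)), Var (Suc 0)], Var 0]))
     (up_sub (up_sub ctx_proj)) (B # A # \<Gamma>)"
  using ctx_sub_up[of "[A, ctx_int syn \<Gamma>]" "Tuple [Var (Suc 0), Var 0]" "A # \<Gamma>" "up_sub ctx_proj" B]
    ctx_proj_up[of A \<Gamma>]
  by simp

primrec ctx_tm :: "'op ctx \<Rightarrow> 'op val" where
  "ctx_tm [] = Tuple []"
| "ctx_tm (A # \<Gamma>) = Tuple [ren_val (ctx_tm \<Gamma>) Suc, Var 0]"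

lemma ctx_tm_typed: "val_typed \<Gamma> (ctx_tm \<Gamma>) (ctx_int syn \<Gamma>)"
  by (induction \<Gamma>) (auto intro!: ty_Tuple[of "[]" "[]", simplified] pair_typed typed_weaken)

text \<open>The induction step is \<open>ctx_sub_up\<close> at \<open>\<sigma> = Var\<close>, which
  lifting leaves unchanged.\<close>

lemma ctx_tm_inverse: "sub_eq \<Gamma> (ctx_sub (ctx_tm \<Gamma>)) Var \<Gamma>"
proof (induction \<Gamma>)
  case (Cons A \<Gamma>)
  then show ?case using ctx_sub_up[OF ctx_tm_typed Cons, of A] by (simp add: up_sub_Var)
qed (simp add: sub_eq_def)

lemma ctx_proj_reflects:
  "val_typed \<Gamma> V A \<Longrightarrow> val_typed \<Gamma> W A \<Longrightarrow>
     val_eq [ctx_int syn \<Gamma>] (sub_val V ctx_proj) (sub_val W ctx_proj) A \<Longrightarrow> val_eq \<Gamma> V W A"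
  "cmp_typed \<Gamma> M C \<Longrightarrow> cmp_typed \<Gamma> N C \<Longrightarrow>
     cmp_eq [ctx_int syn \<Gamma>] (sub_cmp M ctx_proj) (sub_cmp N ctx_proj) C \<Longrightarrow> cmp_eq \<Gamma> M N C"
  "handler_typed \<Gamma> H \<Sigma> C \<Longrightarrow> handler_typed \<Gamma> H' \<Sigma> C \<Longrightarrow>
     handler_eq [ctx_int syn \<Gamma>] (sub_handler H ctx_proj) (sub_handler H' ctx_proj) \<Sigma> C \<Longrightarrow>
     handler_eq \<Gamma> H H' \<Sigma> C"
proof -
  \<comment> \<open>The interpreted terms have a single variable, so a constant substitution will
    do; fused with \<open>ctx_proj\<close> it becomes
    \<open>ctx_sub (ctx_tm \<Gamma>)\<close>.\<close>
  let ?\<tau> = "\<lambda>_. ctx_tm \<Gamma>"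
  have \<tau>: "sub_typed \<Gamma> ?\<tau> [ctx_int syn \<Gamma>]"
    by (simp add: sub_typed_def ctx_tm_typed)
  note inv = sub_cong[OF _ ctx_tm_inverse]
  show "val_eq \<Gamma> V W A" if V: "val_typed \<Gamma> V A" and W: "val_typed \<Gamma> W A"
    and "val_eq [ctx_int syn \<Gamma>] (sub_val V ctx_proj) (sub_val W ctx_proj) A"
    using veq_trans[OF veq_trans[OF veq_sym[OF inv(1)[OF V]]] inv(1)[OF W]] eq_sub(1)[OF that(3) \<tau>]
    by (simp add: sub_simps)
  show "cmp_eq \<Gamma> M N C" if M: "cmp_typed \<Gamma> M C" and N: "cmp_typed \<Gamma> N C"
    and "cmp_eq [ctx_int syn \<Gamma>] (sub_cmp M ctx_proj) (sub_cmp N ctx_proj) C"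
    using ceq_trans[OF ceq_trans[OF ceq_sym[OF inv(2)[OF M]]] inv(2)[OF N]] eq_sub(2)[OF that(3) \<tau>]
    by (simp add: sub_simps)
  show "handler_eq \<Gamma> H H' \<Sigma> C" if H: "handler_typed \<Gamma> H \<Sigma> C" and H': "handler_typed \<Gamma> H' \<Sigma> C"
    and "handler_eq [ctx_int syn \<Gamma>] (sub_handler H ctx_proj) (sub_handler H' ctx_proj) \<Sigma> C"
    using heq_trans[OF heq_trans[OF heq_sym[OF inv(3)[OF H]]] inv(3)[OF H']] eq_sub(3)[OF that(3) \<tau>]
    by (simp add: sub_simps)
qed

lemma var_int_syn:
  "i < length \<Gamma> \<Longrightarrow> var_int syn \<Gamma> i = mor (ctx_int syn \<Gamma>) (\<Gamma> ! i) (ctx_proj i)"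
proof (induction \<Gamma> arbitrary: i)
  case (Cons A \<Gamma>)
  show ?case
  proof (cases i)
    case (Suc j)
    then have j: "j < length \<Gamma>" using Cons.prems by simp
    have "val_typed [ctx_int syn \<Gamma>] (ctx_proj j) (\<Gamma> ! j)"
      using ctx_proj_typed[of \<Gamma>] j by (simp add: sub_typed_def)
    then show ?thesis using Suc Cons.IH[OF j] by (simp add: comp_tm_def)
  qed simp
qed simp

lemma red_mor_eq:
  assumes "val_typed [X] V Y" "V = V'" "vred V' U" "val_eq [X] U W Y"
  shows "mor X Y V = mor X Y W"
  using red_eq(1)[OF assms(3), of "[X]" Y] assms(1,2,4) by (auto intro: morI veq_trans)

section \<open>Computation formers and handlers in the syntactic model\<close>

lemma syn_app:
  assumes "val_typed [X] V (TFun A (Eff B \<Sigma>))" "val_typed [X] W A"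
  shows "compose syn (ev syn \<Sigma> A B) (pair syn X (TFun A (Eff B \<Sigma>)) A
      (mor X (TFun A (Eff B \<Sigma>)) V) (mor X A W)) = mor X (Tty \<Sigma> B) (thunk (App V W))"
  using assms thunk_typed_Tty[OF ty_App[OF assms]]
  by simp (rule red_mor_eq, (simp; fail), (simp add: red_simps; fail),
      (rule red_intros vred_refl | (simp add: red_simps; fail))+, erule veq_refl)

text \<open>The model sees context and bound variable as one variable of product type, for which the
  strength supplies the pair of the two. The body \<open>N'\<close> is a parameter because the
  lifted substitution of the source term agrees with the result only up to derivable
  equality.\<close>

lemma syn_let:
  assumes "cmp_typed [X] M (Eff A \<Sigma>)" "cmp_typed [TProd [X, A]] N (Eff B \<Sigma>)"
    and "cmp_eq [A, X] (sub_cmp N (\<lambda>_. Tuple [Var (Suc 0), Var 0])) N' (Eff B \<Sigma>)"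
  shows "compose syn (T_mult syn \<Sigma> B) (compose syn (T_mor syn \<Sigma> (mor (TProd [X, A]) (Tty \<Sigma> B) (thunk N)))
      (compose syn (T_st syn \<Sigma> X A) (pair syn X X (T_ob syn \<Sigma> A) (idm syn X) (mor X (Tty \<Sigma> A) (thunk M)))))
    = mor X (Tty \<Sigma> B) (thunk (LetIn M N'))"
proof -
  have "val_eq [X] (thunk (LetIn M (sub_cmp N (\<lambda>_. Tuple [Var (Suc 0), Var 0])))) (thunk (LetIn M N')) (Tty \<Sigma> B)"
    unfolding Tty_def by (rule thunk_eq, rule cong_LetIn, rule ceq_refl, rule assms(1), rule assms(3))
  then show ?thesis using thunk_typed_Tty[OF assms(1)] thunk_typed_Tty[OF assms(2)]
    by simp (rule red_mor_eq, (simp; fail), (simp add: red_simps; fail),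
      (rule red_intros cred_refl | (simp add: red_simps; fail))+)
qed

text \<open>As for \<open>let\<close>, with a second such parameter: reduction yields
  \<open>proj_handler \<Sigma> h\<close>, and the handler of the source term is reached through a
  derivable equation.\<close>

lemma syn_handle:
  assumes "cmp_typed [X] M (Eff A \<Sigma>)" "cmp_typed [TProd [X, A]] N (Eff B \<Sigma>')"
    and "val_typed [X] h (clauses_ty \<Sigma> \<Sigma>' B)"
    and "handler_eq [X] (proj_handler \<Sigma> h) H \<Sigma> (Eff B \<Sigma>')"
    and "cmp_eq [A, X] (sub_cmp N (\<lambda>_. Tuple [Var (Suc 0), Var 0])) N' (Eff B \<Sigma>')"
  shows "compose syn (hndl syn \<Sigma> \<Sigma>' B) (pair syn X (hobj syn \<Sigma> \<Sigma>' B) (T_ob syn \<Sigma> (T_ob syn \<Sigma>' B))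
      (mor X (clauses_ty \<Sigma> \<Sigma>' B) h)
      (compose syn (T_mor syn \<Sigma> (mor (TProd [X, A]) (Tty \<Sigma>' B) (thunk N)))
      (compose syn (T_st syn \<Sigma> X A) (pair syn X X (T_ob syn \<Sigma> A) (idm syn X) (mor X (Tty \<Sigma> A) (thunk M))))))
    = mor X (Tty \<Sigma>' B) (thunk (Handle M H N'))"
proof -
  have "val_eq [X] (thunk (Handle M (proj_handler \<Sigma> h) (sub_cmp N (\<lambda>_. Tuple [Var (Suc 0), Var 0]))))
      (thunk (Handle M H N')) (Tty \<Sigma>' B)"
    unfolding Tty_def by (rule thunk_eq, rule cong_Handle, rule ceq_refl, rule assms(1), rule assms(4), rule assms(5))
  then show ?thesis using thunk_typed_Tty[OF assms(1)] thunk_typed_Tty[OF assms(2)] assms(3)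
    by simp (rule red_mor_eq, (simp; fail), (simp add: red_simps; fail),
      (rule red_intros cred_refl vred_refl | (simp add: red_simps; fail))+)
qed

text \<open>\<open>Var (Suc 0)\<close> is the context value and \<open>Var 0\<close> the pair of
  operation argument and resumption; the nested tuple regroups them, as \<open>assocl\<close> does,
  into a value of the context extended by both.\<close>

definition clause_tm :: "'op cmp \<Rightarrow> 'op val" where
  "clause_tm L = Lam (sub_cmp L (ctx_sub (Tuple [Tuple [Var (Suc 0), Proj 0 (Var 0)], Proj (Suc 0) (Var 0)])))"

definition handler_tm :: "'op sgn \<Rightarrow> 'op handler \<Rightarrow> 'op val" where
  "handler_tm \<Sigma> H = Tuple (map (\<lambda>oper. clause_tm (the (fmlookup H oper))) (enum_ops (fmdom \<Sigma>)))"

lemma clause_tm_typed: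
  assumes "cmp_typed (TFun B C # A # \<Gamma>) L C"
  shows "val_typed [ctx_int syn \<Gamma>] (clause_tm L) (TFun (TProd [A, TFun B C]) C)"
  unfolding clause_tm_def
  by (rule ty_Lam, rule typed_sub(2)[OF assms], rule ctx_sub_typed) simp

lemma handler_typed_clause:
  assumes "handler_typed \<Gamma> H \<Sigma> C" "fmlookup \<Sigma> oper = Some (A, B)"
  obtains L where "fmlookup H oper = Some L" "cmp_typed (TFun B C # A # \<Gamma>) L C"
proof -
  from assms(1) have dom: "fmdom \<Sigma> = fmdom H"
    and clause: "\<And>L. fmlookup H oper = Some L \<Longrightarrow> cmp_typed (TFun B C # A # \<Gamma>) L C"
    using assms(2) by (auto elim: handler_typedE)
  from fmdom_eq_lookup[OF dom assms(2)] obtain L where "fmlookup H oper = Some L" by blast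
  with clause that show ?thesis by blast
qed

lemma handler_tm_typed:
  assumes "handler_typed \<Gamma> H \<Sigma> (Eff D \<Sigma>')"
  shows "val_typed [ctx_int syn \<Gamma>] (handler_tm \<Sigma> H) (clauses_ty \<Sigma> \<Sigma>' D)"
  unfolding handler_tm_def clauses_ty_def
proof (rule ty_Tuple)
  let ?ops = "enum_ops (fmdom \<Sigma>)"
  fix i assume "i < length (map (\<lambda>oper. clause_ty \<Sigma>' D (the (fmlookup \<Sigma> oper))) ?ops)"
  then have i: "i < length ?ops" by simp
  then have "?ops ! i |\<in>| fmdom \<Sigma>" by (metis enum_ops(2) nth_mem)
  then obtain A B where S: "fmlookup \<Sigma> (?ops ! i) = Some (A, B)"
    by (auto simp: fmlookup_dom_iff)
  with assms obtain L where L: "fmlookup H (?ops ! i) = Some L"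
    "cmp_typed (TFun B (Eff D \<Sigma>') # A # \<Gamma>) L (Eff D \<Sigma>')"
    by (rule handler_typed_clause)
  from clause_tm_typed[OF L(2)]
  show "val_typed [ctx_int syn \<Gamma>] (map (\<lambda>oper. clause_tm (the (fmlookup H oper))) ?ops ! i)
      (map (\<lambda>oper. clause_ty \<Sigma>' D (the (fmlookup \<Sigma> oper))) ?ops ! i)"
    using i S L(1) by (simp add: clause_ty_def)
qed simp

text \<open>Packing the clauses into a tuple loses nothing: selecting a component, applying the
  curried clause and cancelling the regrouping restores the clause. This serves both for
  interpreting \<open>Handle\<close> and for recovering handlers from equal tuples.\<close>

lemma proj_handler_handler_tm:
  assumes "handler_typed \<Gamma> H \<Sigma> (Eff D \<Sigma>')"
  shows "handler_eq [ctx_int syn \<Gamma>] (proj_handler \<Sigma> (handler_tm \<Sigma> H)) (sub_handler H ctx_proj) \<Sigma> (Eff D \<Sigma>')"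
proof (rule cong_handler)
  show "fmdom (sub_handler H ctx_proj) = fmdom \<Sigma>"
    using assms by (auto elim: handler_typedE)
  fix oper A B M M'
  assume S: "fmlookup \<Sigma> oper = Some (A, B)" and M: "fmlookup (proj_handler \<Sigma> (handler_tm \<Sigma> H)) oper = Some M"
    and "fmlookup (sub_handler H ctx_proj) oper = Some M'"
  then obtain L where L: "fmlookup H oper = Some L" "M' = sub_cmp L (up_sub (up_sub ctx_proj))"
    by auto
  have typed: "cmp_typed (TFun B (Eff D \<Sigma>') # A # \<Gamma>) L (Eff D \<Sigma>')"
    using handler_typed_clause[OF assms S] L(1) by auto
  let ?\<Delta> = "[TFun B (Eff D \<Sigma>'), A, ctx_int syn \<Gamma>]" and ?\<xi> = "\<lambda>n. Suc (Suc n)"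
  have proj_typed: "handler_typed [ctx_int syn \<Gamma>] (proj_handler \<Sigma> (handler_tm \<Sigma> H)) \<Sigma> (Eff D \<Sigma>')"
    by (rule proj_handler_typed[OF handler_tm_typed[OF assms]])
  have Mtyped: "cmp_typed ?\<Delta> M (Eff D \<Sigma>')"
    using handler_typed_clause[OF proj_typed S] M by auto
  have "vred (Proj (op_index \<Sigma> oper) (ren_val (handler_tm \<Sigma> H) ?\<xi>)) (ren_val (clause_tm L) ?\<xi>)"
    using vred_proj_tuple[of "op_index \<Sigma> oper" "map (\<lambda>oper. ren_val (clause_tm (the (fmlookup H oper))) ?\<xi>) (enum_ops (fmdom \<Sigma>))"]
      op_index[OF S] L by (simp add: handler_tm_def comp_def)
  then have "cred M (App (ren_val (clause_tm L) ?\<xi>) (Tuple [Var (Suc 0), Var 0]))"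
    using M S by (auto intro: cred_App vred_refl)
  moreover have "cred (App (ren_val (clause_tm L) ?\<xi>) (Tuple [Var (Suc 0), Var 0]))
    (sub_cmp L (ctx_sub (Tuple [Tuple [Var (Suc (Suc 0)), Proj 0 (Tuple [Var (Suc 0), Var 0])],
       Proj (Suc 0) (Tuple [Var (Suc 0), Var 0])])))"
    unfolding clause_tm_def ren_val.simps
    by (rule cred_trans[OF cred_beta]) (simp add: inst1_def sub_simps cred_refl)
  \<comment> \<open>The remaining projection redexes lie in the substituted values, hence the
    congruence of reduction under substitution.\<close>
  moreover have "cred (sub_cmp L (ctx_sub (Tuple [Tuple [Var (Suc (Suc 0)), Proj 0 (Tuple [Var (Suc 0), Var 0])],
       Proj (Suc 0) (Tuple [Var (Suc 0), Var 0])])))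
     (sub_cmp L (ctx_sub (Tuple [Tuple [Var (Suc (Suc 0)), Var (Suc 0)], Var 0])))"
    by (rule red_sub_cong(2), rule red_ctx_sub) (rule red_intros)+
  ultimately have "cred M (sub_cmp L (ctx_sub (Tuple [Tuple [Var (Suc (Suc 0)), Var (Suc 0)], Var 0])))"
    by (rule cred_trans[OF cred_trans])
  then have "cmp_eq ?\<Delta> M (sub_cmp L (ctx_sub (Tuple [Tuple [Var (Suc (Suc 0)), Var (Suc 0)], Var 0]))) (Eff D \<Sigma>')"
    using Mtyped by (rule red_eq)
  also have "cmp_eq ?\<Delta> (sub_cmp L (ctx_sub (Tuple [Tuple [Var (Suc (Suc 0)), Var (Suc 0)], Var 0]))) M' (Eff D \<Sigma>')"
    unfolding L(2) by (rule sub_cong(2)[OF typed ctx_proj_up_up])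
  finally show "cmp_eq ?\<Delta> M M' (Eff D \<Sigma>')" .
qed simp

lemma proj_handler_eq:
  assumes "val_eq \<Gamma> h h' (clauses_ty \<Sigma> \<Sigma>' D)"
  shows "handler_eq \<Gamma> (proj_handler \<Sigma> h) (proj_handler \<Sigma> h') \<Sigma> (Eff D \<Sigma>')"
proof (rule cong_handler)
  fix oper A B M M'
  assume S: "fmlookup \<Sigma> oper = Some (A, B)" and M: "fmlookup (proj_handler \<Sigma> h) oper = Some M"
    "fmlookup (proj_handler \<Sigma> h') oper = Some M'"
  let ?\<Delta> = "TFun B (Eff D \<Sigma>') # A # \<Gamma>" and ?\<xi> = "\<lambda>n. Suc (Suc n)"
  let ?As = "map (\<lambda>oper. clause_ty \<Sigma>' D (the (fmlookup \<Sigma> oper))) (enum_ops (fmdom \<Sigma>))"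
  have "val_eq ?\<Delta> (ren_val h ?\<xi>) (ren_val h' ?\<xi>) (TProd ?As)"
    using eq_ren(1)[OF assms, of ?\<Delta> ?\<xi>] by (simp add: ren_typed_def clauses_ty_def)
  from cong_Proj[OF this, of "op_index \<Sigma> oper"]
  have "val_eq ?\<Delta> (Proj (op_index \<Sigma> oper) (ren_val h ?\<xi>)) (Proj (op_index \<Sigma> oper) (ren_val h' ?\<xi>))
      (TFun (TProd [A, TFun B (Eff D \<Sigma>')]) (Eff D \<Sigma>'))"
    using op_index[OF S] S by (simp add: clause_ty_def)
  from cong_App[OF this veq_refl, of "Tuple [Var (Suc 0), Var 0]"]
  show "cmp_eq ?\<Delta> M M' (Eff D \<Sigma>')"
    using M S by auto
qed simp_all

text \<open>One component of an interpreted handler: \<open>assocl\<close> contributes the regrouped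
  tuple and \<open>cur\<close> the abstraction in \<open>clause_tm\<close>.\<close>

lemma syn_clause:
  assumes "cmp_typed (TFun B (Eff D \<Sigma>') # A # \<Gamma>) L (Eff D \<Sigma>')"
  shows "cur syn \<Sigma>' (ctx_int syn \<Gamma>) (TProd [A, TFun B (Eff D \<Sigma>')]) D
      (compose syn (mor (TProd [TProd [ctx_int syn \<Gamma>, A], TFun B (Eff D \<Sigma>')]) (Tty \<Sigma>' D) (thunk (sub_cmp L ctx_proj)))
        (assocl syn (ctx_int syn \<Gamma>) A (TFun B (Eff D \<Sigma>'))))
    = mor (ctx_int syn \<Gamma>) (TFun (TProd [A, TFun B (Eff D \<Sigma>')]) (Eff D \<Sigma>')) (clause_tm L)"
proof -
  have "val_typed [TProd [TProd [ctx_int syn \<Gamma>, A], TFun B (Eff D \<Sigma>')]] (thunk (sub_cmp L ctx_proj)) (Tty \<Sigma>' D)"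
    using typed_sub(2)[OF assms ctx_proj_typed] by (simp add: thunk_typed_Tty)
  moreover have red: "vred (Lam (run (thunk (sub_cmp L (ctx_sub V))))) (Lam (sub_cmp L (ctx_sub W)))"
    if "vred V W" for V W
    by (intro vred_Lam cred_trans[OF run_thunk] red_sub_cong red_ctx_sub that)
  ultimately show ?thesis
    using clause_tm_typed[OF assms]
    by (simp add: syn_defs) (rule red_mor, (simp; fail), (simp; fail),
      (simp add: red_simps; fail), rule clause_tm_def,
      rule red, ((rule red_intros)+)[1], rule vred_refl, rule refl)
qed

section \<open>The interpretation computed in the syntactic model, and completeness\<close>

abbreviation cty_ob :: "'op cty \<Rightarrow> 'op ty" where
  "cty_ob C \<equiv> TFun (TProd []) C"

text \<open>The right-hand sides depend on the judgement alone, so the choice of derivation does not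
  matter. Since only values represent morphisms, computations enter as thunks and handlers as tuples
  of curried clauses.\<close>

lemma int_syn:
  "val_int syn \<Gamma> V A f \<Longrightarrow> f = mor (ctx_int syn \<Gamma>) A (sub_val V ctx_proj)"
  "cmp_int syn \<Gamma> M C f \<Longrightarrow> f = mor (ctx_int syn \<Gamma>) (cty_ob C) (thunk (sub_cmp M ctx_proj))"
  "handler_int syn \<Gamma> H \<Sigma> C f \<Longrightarrow>
     f = mor (ctx_int syn \<Gamma>) (case C of Eff D \<Sigma>' \<Rightarrow> clauses_ty \<Sigma> \<Sigma>' D) (handler_tm \<Sigma> H)"
proof (induction rule: val_int_cmp_int_handler_int.inducts)
  case (int_Var i \<Gamma>)
  then show ?case by (simp add: var_int_syn)
next
  case (int_Lam A \<Gamma> N B \<Sigma> f)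
  then have N: "cmp_typed (A # \<Gamma>) N (Eff B \<Sigma>)"
    by (blast dest: interpretation_typed)
  have "val_typed [TProd [ctx_int syn \<Gamma>, A]] (thunk (sub_cmp N ctx_proj)) (Tty \<Sigma> B)"
    using typed_sub(2)[OF N ctx_proj_typed] by (simp add: thunk_typed_Tty)
  \<comment> \<open>Currying substitutes projections from the pair of context and argument, whereas
    substitution into the abstraction lifts \<open>ctx_proj\<close>; \<open>ctx_proj_up\<close>
    reconciles them.\<close>
  moreover have "val_eq [ctx_int syn \<Gamma>] (Lam (sub_cmp N (ctx_sub (Tuple [Var (Suc 0), Var 0]))))
      (Lam (sub_cmp N (up_sub ctx_proj))) (TFun A (Eff B \<Sigma>))"
    by (intro cong_Lam sub_cong(2)[OF N ctx_proj_up])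
  ultimately show ?case using int_Lam
    by (simp add: Tty_def[symmetric]) (rule red_mor_eq, (simp; fail), (simp add: red_simps; fail),
      rule vred_Lam, rule run_thunk)
next
  case (int_Tuple Vs As fs \<Gamma>)
  have "val_typed [ctx_int syn \<Gamma>] (sub_val (Vs ! i) ctx_proj) (As ! i)" if "i < length As" for i
    using int_Tuple that by (blast intro: typed_sub ctx_proj_typed dest: interpretation_typed)
  then show ?case using int_Tuple by (auto intro!: syn_tuple)
next
  case (int_Proj \<Gamma> V As f i)
  have "val_typed [ctx_int syn \<Gamma>] (sub_val V ctx_proj) (TProd As)"
    using int_Proj by (blast intro: typed_sub ctx_proj_typed dest: interpretation_typed)
  then show ?case using int_Proj by (simp add: comp_tm_def)
next
  case (int_App \<Gamma> V A B \<Sigma> f W g)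
  then have typed: "val_typed \<Gamma> V (TFun A (Eff B \<Sigma>))" "val_typed \<Gamma> W A"
    by (blast dest: interpretation_typed)+
  from int_App have f: "f = mor (ctx_int syn \<Gamma>) (TFun A (Eff B \<Sigma>)) (sub_val V ctx_proj)"
    "g = mor (ctx_int syn \<Gamma>) A (sub_val W ctx_proj)" by simp_all
  show ?case
    using syn_app[OF typed[THEN typed_sub(1)[OF _ ctx_proj_typed]]]
    by (simp only:  sgn_int_syn ty_int_syn_simps f sub_cmp.simps(1-4) sub_cmp_Handle Tty_def
        cty.case ctx_int.simps(2) syn_obj_simps(1))
next
  case (int_Return \<Gamma> V A f \<Sigma>)
  have "val_typed [ctx_int syn \<Gamma>] (sub_val V ctx_proj) A"
    using int_Return by (blast intro: typed_sub ctx_proj_typed dest: interpretation_typed)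
  then show ?case using int_Return by (simp flip: Tty_def) (simp add: red_simps)
next
  case (int_LetIn \<Gamma> L A \<Sigma> f N B g S G X)
  then have typed: "cmp_typed \<Gamma> L (Eff A \<Sigma>)" "cmp_typed (A # \<Gamma>) N (Eff B \<Sigma>)"
    by (blast dest: interpretation_typed)+
  from int_LetIn have f: "f = mor (ctx_int syn \<Gamma>) (Tty \<Sigma> A) (thunk (sub_cmp L ctx_proj))"
    "g = mor (TProd [ctx_int syn \<Gamma>, A]) (Tty \<Sigma> B) (thunk (sub_cmp N ctx_proj))"
    by (simp_all add: Tty_def)
  have "cmp_eq [A, ctx_int syn \<Gamma>] (sub_cmp (sub_cmp N ctx_proj) (\<lambda>_. Tuple [Var (Suc 0), Var 0]))
      (sub_cmp N (up_sub ctx_proj)) (Eff B \<Sigma>)"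
    using sub_cong(2)[OF typed(2) ctx_proj_up] by (simp add: sub_simps)
  from syn_let[OF typed_sub(2)[OF typed(1) ctx_proj_typed] typed_sub(2)[OF typed(2) ctx_proj_typed, simplified] this]
  show ?case
    by (simp only: int_LetIn sgn_int_syn ty_int_syn_simps f sub_cmp.simps(1-4) sub_cmp_Handle Tty_def
        cty.case ctx_int.simps(2) syn_obj_simps(1))
next
  case (int_Op \<Sigma> oper A B \<Gamma> V f)
  have "val_typed [ctx_int syn \<Gamma>] (sub_val V ctx_proj) A"
    using int_Op by (blast intro: typed_sub ctx_proj_typed dest: interpretation_typed)
  then show ?case using int_Op by (simp flip: Tty_def) (simp add: red_simps)
next
  case (int_Handle \<Gamma> L A \<Sigma> f H B \<Sigma>' h N g S S' G X Y)
  then have typed: "cmp_typed \<Gamma> L (Eff A \<Sigma>)" "cmp_typed (A # \<Gamma>) N (Eff B \<Sigma>')"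
    "handler_typed \<Gamma> H \<Sigma> (Eff B \<Sigma>')"
    by (blast dest: interpretation_typed)+
  from int_Handle have f: "f = mor (ctx_int syn \<Gamma>) (Tty \<Sigma> A) (thunk (sub_cmp L ctx_proj))"
    "g = mor (TProd [ctx_int syn \<Gamma>, A]) (Tty \<Sigma>' B) (thunk (sub_cmp N ctx_proj))"
    "h = mor (ctx_int syn \<Gamma>) (clauses_ty \<Sigma> \<Sigma>' B) (handler_tm \<Sigma> H)"
    by (simp_all add: Tty_def)
  have "cmp_eq [A, ctx_int syn \<Gamma>] (sub_cmp (sub_cmp N ctx_proj) (\<lambda>_. Tuple [Var (Suc 0), Var 0]))
      (sub_cmp N (up_sub ctx_proj)) (Eff B \<Sigma>')"
    using sub_cong(2)[OF typed(2) ctx_proj_up] by (simp add: sub_simps)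
  from syn_handle[OF typed_sub(2)[OF typed(1) ctx_proj_typed]
      typed_sub(2)[OF typed(2) ctx_proj_typed, simplified]
      handler_tm_typed[OF typed(3)] proj_handler_handler_tm[OF typed(3)] this]
  show ?case
    by (simp only: int_Handle sgn_int_syn ty_int_syn_simps f sub_cmp.simps(1-4) sub_cmp_Handle Tty_def
        cty.case ctx_int.simps(2) syn_obj_simps(1))
next
  case (int_handler H \<Sigma> D \<Sigma>' \<Gamma> F S S' G Y)
  let ?ops = "enum_ops (fmdom \<Sigma>)" and ?f = "\<lambda>oper. case the (fmlookup \<Sigma> oper) of (A, B) \<Rightarrow>
    let K = kexp syn \<Sigma>' B D in
    cur syn \<Sigma>' (ctx_int syn \<Gamma>) (binprod syn A K) D (compose syn (F oper) (assocl syn (ctx_int syn \<Gamma>) A K))"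
  have *: "?f oper = mor (ctx_int syn \<Gamma>) (clause_ty \<Sigma>' D (the (fmlookup \<Sigma> oper))) (clause_tm (the (fmlookup H oper)))"
    "val_typed [ctx_int syn \<Gamma>] (clause_tm (the (fmlookup H oper))) (clause_ty \<Sigma>' D (the (fmlookup \<Sigma> oper)))"
    if oper: "oper \<in> set ?ops" for oper
  proof -
    obtain A B where S: "fmlookup \<Sigma> oper = Some (A, B)"
      using oper by (auto simp: enum_ops fmlookup_dom_iff)
    obtain L where L: "fmlookup H oper = Some L"
      using fmdom_eq_lookup[OF _ S, of H] int_handler by blast
    have typed: "cmp_typed (TFun B (Eff D \<Sigma>') # A # \<Gamma>) L (Eff D \<Sigma>')"
      and F: "F oper = mor (ctx_int syn (TFun B (Eff D \<Sigma>') # A # \<Gamma>)) (cty_ob (Eff D \<Sigma>')) (thunk (sub_cmp L ctx_proj))"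
      using int_handler S L by (blast dest: interpretation_typed)+
    show "?f oper = mor (ctx_int syn \<Gamma>) (clause_ty \<Sigma>' D (the (fmlookup \<Sigma> oper))) (clause_tm (the (fmlookup H oper)))"
      using S L F syn_clause[OF typed]
      by (simp add: clause_ty_def Tty_def)
    show "val_typed [ctx_int syn \<Gamma>] (clause_tm (the (fmlookup H oper))) (clause_ty \<Sigma>' D (the (fmlookup \<Sigma> oper)))"
      using S L clause_tm_typed[OF typed] by (simp add: clause_ty_def)
  qed
  have "tuple syn (ctx_int syn \<Gamma>) (clause_objs syn \<Sigma> \<Sigma>' D) (map ?f ?ops)
      = mor (ctx_int syn \<Gamma>) (TProd (clause_objs syn \<Sigma> \<Sigma>' D)) (handler_tm \<Sigma> H)"
    unfolding handler_tm_def
    by (rule syn_tuple) (use * in \<open>simp_all add: clause_objs_def\<close>)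
  then show ?case
    using int_handler by (simp add: clauses_ty_def clause_objs_def)
qed

theorem theorem4p9:
  shows "(\<forall>(\<Gamma> :: 'op ctx) V W A.
            val_typed \<Gamma> V A \<longrightarrow> val_typed \<Gamma> W A \<longrightarrow>
            (\<forall>M :: 'op syn_structure. leff_model M \<longrightarrow>
               (\<exists>f. val_int M \<Gamma> V A f \<and> val_int M \<Gamma> W A f)) \<longrightarrow>
            val_eq \<Gamma> V W A)
       \<and> (\<forall>(\<Gamma> :: 'op ctx) N N' C.
            cmp_typed \<Gamma> N C \<longrightarrow> cmp_typed \<Gamma> N' C \<longrightarrow>
            (\<forall>M :: 'op syn_structure. leff_model M \<longrightarrow>
               (\<exists>f. cmp_int M \<Gamma> N C f \<and> cmp_int M \<Gamma> N' C f)) \<longrightarrow>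
            cmp_eq \<Gamma> N N' C)
       \<and> (\<forall>(\<Gamma> :: 'op ctx) H H' \<Sigma> C.
            handler_typed \<Gamma> H \<Sigma> C \<longrightarrow> handler_typed \<Gamma> H' \<Sigma> C \<longrightarrow>
            (\<forall>M :: 'op syn_structure. leff_model M \<longrightarrow>
               (\<exists>f. handler_int M \<Gamma> H \<Sigma> C f \<and> handler_int M \<Gamma> H' \<Sigma> C f)) \<longrightarrow>
            handler_eq \<Gamma> H H' \<Sigma> C)"
proof (intro conjI allI impI)
  fix \<Gamma> :: "'op ctx" and V W A
  assume V: "val_typed \<Gamma> V A" and W: "val_typed \<Gamma> W A"
    and "\<forall>M :: 'op syn_structure. leff_model M \<longrightarrow> (\<exists>f. val_int M \<Gamma> V A f \<and> val_int M \<Gamma> W A f)"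
  then obtain f where f: "val_int syn \<Gamma> V A f" "val_int syn \<Gamma> W A f"
    using syn_model by blast
  have "mor (ctx_int syn \<Gamma>) A (sub_val V ctx_proj) = mor (ctx_int syn \<Gamma>) A (sub_val W ctx_proj)"
    using f[THEN int_syn(1)] by simp
  then show "val_eq \<Gamma> V W A"
    using ctx_proj_reflects(1)[OF V W] typed_sub(1)[OF W ctx_proj_typed] by (simp add: mor_eq_iff)
next
  fix \<Gamma> :: "'op ctx" and N N' C
  assume N: "cmp_typed \<Gamma> N C" and N': "cmp_typed \<Gamma> N' C"
    and "\<forall>M :: 'op syn_structure. leff_model M \<longrightarrow> (\<exists>f. cmp_int M \<Gamma> N C f \<and> cmp_int M \<Gamma> N' C f)"
  then obtain f where f: "cmp_int syn \<Gamma> N C f" "cmp_int syn \<Gamma> N' C f"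
    using syn_model by blast
  have "mor (ctx_int syn \<Gamma>) (cty_ob C) (thunk (sub_cmp N ctx_proj))
      = mor (ctx_int syn \<Gamma>) (cty_ob C) (thunk (sub_cmp N' ctx_proj))"
    using f[THEN int_syn(2)] by simp
  then have "val_eq [ctx_int syn \<Gamma>] (thunk (sub_cmp N ctx_proj)) (thunk (sub_cmp N' ctx_proj)) (cty_ob C)"
    using thunk_typed[OF typed_sub(2)[OF N' ctx_proj_typed]] by (simp add: mor_eq_iff)
  \<comment> \<open>Forcing turns the equation between thunks into one between computations.\<close>
  then have "cmp_eq [ctx_int syn \<Gamma>] (run (thunk (sub_cmp N ctx_proj))) (run (thunk (sub_cmp N' ctx_proj))) C"
    by (rule run_eq)
  then have "cmp_eq [ctx_int syn \<Gamma>] (sub_cmp N ctx_proj) (sub_cmp N' ctx_proj) C"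
    using ceq_trans[OF ceq_trans[OF ceq_sym[OF red_eq(2)[OF run_thunk]]] red_eq(2)[OF run_thunk]]
    by (blast dest: eq_typed(2))
  then show "cmp_eq \<Gamma> N N' C" by (rule ctx_proj_reflects(2)[OF N N'])
next
  fix \<Gamma> :: "'op ctx" and H H' \<Sigma> C
  assume H: "handler_typed \<Gamma> H \<Sigma> C" and H': "handler_typed \<Gamma> H' \<Sigma> C"
    and "\<forall>M :: 'op syn_structure. leff_model M \<longrightarrow> (\<exists>f. handler_int M \<Gamma> H \<Sigma> C f \<and> handler_int M \<Gamma> H' \<Sigma> C f)"
  then obtain f where f: "handler_int syn \<Gamma> H \<Sigma> C f" "handler_int syn \<Gamma> H' \<Sigma> C f"
    using syn_model by blast
  obtain D \<Sigma>' where C: "C = Eff D \<Sigma>'" by (cases C)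
  have "mor (ctx_int syn \<Gamma>) (clauses_ty \<Sigma> \<Sigma>' D) (handler_tm \<Sigma> H)
      = mor (ctx_int syn \<Gamma>) (clauses_ty \<Sigma> \<Sigma>' D) (handler_tm \<Sigma> H')"
    using f[THEN int_syn(3)] by (simp add: C)
  then have "val_eq [ctx_int syn \<Gamma>] (handler_tm \<Sigma> H) (handler_tm \<Sigma> H') (clauses_ty \<Sigma> \<Sigma>' D)"
    using handler_tm_typed[OF H'[unfolded C]] by (simp add: mor_eq_iff)
  \<comment> \<open>Both tuples are unpacked into handlers, which are equal to the given ones with
    \<open>ctx_proj\<close> substituted.\<close>
  from proj_handler_eq[OF this]
  have "handler_eq [ctx_int syn \<Gamma>] (sub_handler H ctx_proj) (sub_handler H' ctx_proj) \<Sigma> C"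
    unfolding C using heq_trans[OF heq_trans[OF heq_sym[OF proj_handler_handler_tm]] proj_handler_handler_tm]
      H H' C by blast
  then show "handler_eq \<Gamma> H H' \<Sigma> C" by (rule ctx_proj_reflects(3)[OF H H'])
qed

end
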